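(* Let $L>0$, $Z<0$ and let $N\ge1$ be an integer. Let $I=I(N,Z,L)$ be the open set of frequencies defined in the context. There is a smooth mapping $\omega\in I\mapsto e^{i\omega t}\Theta_\omega$ of standing-wave solutions for the cubic NLS model on the looping-edge graph $\mathcal{G}$ in which $$\Theta_\omega=\big(\Phi_{\omega,a},\Psi_{\omega,Z,N},\dots,\Psi_{\omega,Z,N}\big)\in D'_Z,$$ where $\Phi_{\omega,a}(x)=\Phi_\omega(x-a)$, $x\in[-L,L]$, $a=a(\omega)\in(0,L)$, $\Phi_\omega$ is the dnoidal profile of fundamental period $2L$, and $$\Psi_{\omega,Z,N}(x)=\sqrt{2\omega}\,\mathrm{sech}\Big(\sqrt\omega(x-L)+\tanh^{-1}\Big(\frac{-N}{Z\sqrt\omega}\Big)\Big),\qquad x\ge L.$$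
   Context: **Graph.** The looping-edge graph $\mathcal{G}$ consists of a loop identified with $[-L,L]$ and $N$ half-lines, each identified with $[L,\infty)$, all attached at a single vertex $\nu=L$. A function on $\mathcal{G}$ is a tuple $\mathbf{U}=(\phi,\psi_1,\dots,\psi_N)$ with $\phi$ on $[-L,L]$ and $\psi_j$ on $[L,\infty)$; $H^n(\mathcal{G})=H^n(-L,L)\oplus\bigoplus_{j=1}^NH^n(L,\infty)$. Set $$D'_Z=\Big\{\mathbf{U}\in H^2(\mathcal{G}):\phi(L)=\phi(-L),\ \phi'(L)=\phi'(-L)=\psi_1'(L)=\cdots=\psi_N'(L),\ \sum_{j=1}^N\psi_j(L)=Z\psi_1'(L)\Big\}.$$ (Note the derivative of the loop component is matched to those of the half-line components.) "Standing-wave solution $e^{i\omega t}\Theta_\omega$ of the cubic NLS" means that $\Theta_\omega$ satisfies, componentwise, $-\Theta_\omega''+\omega\Theta_\omega-|\Theta_\omega|^2\Theta_\omega=0$ on $(-L,L)$ and on each $(L,\infty)$. Smoothness is that of $\omega\mapsto\Theta_\omega$ as a map into $H^1(\mathcal{G})$. **Dnoidal profile.** For each $\omega>\frac{\pi^2}{2L^2}$ there is a unique $\eta_2\in(0,\sqrt\omega)$ such that, with $\eta_1=\sqrt{2\omega-\eta_2^2}$ and $k^2=(\eta_1^2-\eta_2^2)/\eta_1^2$, one has $\frac{\sqrt2}{\eta_1}K(k)=L$ ($K$ the complete elliptic integral of the first kind). Put $\Phi_\omega(x)=\eta_1\,\mathrm{dn}(\frac{\eta_1}{\sqrt2}x;k)$,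 $x\in\mathbb{R}$; it has fundamental period $2L$ and solves $-\Phi_\omega''+\omega\Phi_\omega-\Phi_\omega^3=0$. The functions $\eta_1,\eta_2$ and $k=k(\omega)\in(0,1)$ are smooth in $\omega>\frac{\pi^2}{2L^2}$ and $k$ is strictly increasing. **The set $I$.** Let $k_0$ be the infimum of $k(\omega)$ over $\omega>\max\{\frac{N^2}{Z^2},\frac{\pi^2}{2L^2}\}$ (so $k_0=k(N^2/Z^2)$ when $\frac{N^2}{Z^2}>\frac{\pi^2}{2L^2}$), let $p(x)=\frac{Z^2k_0^4}{16N^2}x^2-x+\frac{N^2}{Z^2}$, and set $$I(N,Z,L)=\Big\{\omega>\max\big\{\tfrac{\pi^2}{2L^2},\tfrac{N^2}{Z^2}\big\}:p(\omega)>0\Big\}.$$ When $k_0>0$, $p$ has two roots $r_1>r_2>0$ satisfying $\frac{N^2}{Z^2}<r_2<\frac{2N^2}{Z^2}<r_1$, and $I=(\frac{\pi^2}{2L^2},\infty)\cap\big((\frac{N^2}{Z^2},r_2)\cup(r_1,\infty)\big)$. *)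

theory Defs
  imports "HOL-Analysis.Analysis"
begin

section \<open>Sobolev spaces on an open interval\<close>

text \<open>Elements are represented by functions on the whole line; only their values almost everywhere
  on the interval \<open>J\<close> matter.\<close>

definition L2_on :: "real set \<Rightarrow> (real \<Rightarrow> complex) set" where
  "L2_on J = {f. set_borel_measurable lebesgue J f \<and>
                 set_integrable lebesgue J (\<lambda>x. (norm (f x))\<^sup>2)}"

definition loc_integrable_on :: "real set \<Rightarrow> (real \<Rightarrow> complex) \<Rightarrow> bool" where
  "loc_integrable_on J f \<longleftrightarrow> (\<forall>C. compact C \<and> C \<subseteq> J \<longrightarrow> set_integrable lebesgue C f)"

text \<open>Real-valued test functions of class \<open>C\<^sup>1\<close> with compact support in \<open>J\<close>, as in Brezis,
  Functional Analysis, Sobolev Spaces and Partial Differential Equations, Chapter 8.\<close>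

definition test_fun_on :: "real set \<Rightarrow> (real \<Rightarrow> real) \<Rightarrow> bool" where
  "test_fun_on J t \<longleftrightarrow> t C1_differentiable_on UNIV \<and>
     (\<exists>C. compact C \<and> C \<subseteq> J \<and> (\<forall>x. x \<notin> C \<longrightarrow> t x = 0))"

definition has_weak_deriv :: "real set \<Rightarrow> (real \<Rightarrow> complex) \<Rightarrow> (real \<Rightarrow> complex) \<Rightarrow> bool" where
  "has_weak_deriv J f g \<longleftrightarrow> loc_integrable_on J f \<and> loc_integrable_on J g \<and>
     (\<forall>t. test_fun_on J t \<longrightarrow>
        (LINT x:J|lebesgue. deriv t x *\<^sub>R f x) = - (LINT x:J|lebesgue. t x *\<^sub>R g x))"

definition weak_deriv :: "real set \<Rightarrow> (real \<Rightarrow> complex) \<Rightarrow> real \<Rightarrow> complex" where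
  "weak_deriv J f = (SOME g. has_weak_deriv J f g)"

primrec sobolev :: "nat \<Rightarrow> real set \<Rightarrow> (real \<Rightarrow> complex) set" where
  "sobolev 0 J = L2_on J"
| "sobolev (Suc n) J = {f \<in> L2_on J. \<exists>g \<in> sobolev n J. has_weak_deriv J f g}"

definition H1_norm :: "real set \<Rightarrow> (real \<Rightarrow> complex) \<Rightarrow> real" where
  "H1_norm J f = sqrt ((LINT x:J|lebesgue. (norm (f x))\<^sup>2) +
                       (LINT x:J|lebesgue. (norm (weak_deriv J f x))\<^sup>2))"

text \<open>The value at a point \<open>c\<close> of the closed interval is that of the representative which is
  continuous up to the boundary; it exists for every element of \<open>H\<^sup>1\<close>.\<close>

definition trace_at :: "real set \<Rightarrow> (real \<Rightarrow> complex) \<Rightarrow> real \<Rightarrow> complex" where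
  "trace_at J f = (SOME g. continuous_on (closure J) g \<and> (AE x in lebesgue. x \<in> J \<longrightarrow> g x = f x))"

abbreviation trace_deriv_at :: "real set \<Rightarrow> (real \<Rightarrow> complex) \<Rightarrow> real \<Rightarrow> complex" where
  "trace_deriv_at J f \<equiv> trace_at J (weak_deriv J f)"

section \<open>The looping-edge graph\<close>

text \<open>A tuple \<open>(\<phi>, \<psi>\<^sub>1, \<dots>, \<psi>\<^sub>N)\<close> is represented by \<open>U\<close> with \<open>U 0 = \<phi>\<close> and \<open>U j = \<psi>\<^sub>j\<close> for
  \<open>1 \<le> j \<le> N\<close>; components with index above \<open>N\<close> are ignored.\<close>

type_synonym graph_fun = "nat \<Rightarrow> real \<Rightarrow> complex"

definition edge :: "real \<Rightarrow> nat \<Rightarrow> real set" where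
  "edge L e = (if e = 0 then {-L<..<L} else {L<..})"

definition graph_sobolev :: "nat \<Rightarrow> nat \<Rightarrow> real \<Rightarrow> graph_fun set" where
  "graph_sobolev n N L = {U. \<forall>e\<le>N. U e \<in> sobolev n (edge L e)}"

definition graph_H1_norm :: "nat \<Rightarrow> real \<Rightarrow> graph_fun \<Rightarrow> real" where
  "graph_H1_norm N L U = sqrt (\<Sum>e\<le>N. (H1_norm (edge L e) (U e))\<^sup>2)"

definition D'_dom :: "nat \<Rightarrow> real \<Rightarrow> real \<Rightarrow> graph_fun set" where
  "D'_dom N Z L = {U \<in> graph_sobolev 2 N L.
     trace_at (edge L 0) (U 0) L = trace_at (edge L 0) (U 0) (-L) \<and>
     trace_deriv_at (edge L 0) (U 0) L = trace_deriv_at (edge L 0) (U 0) (-L) \<and>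
     (\<forall>j\<in>{1..N}. trace_deriv_at (edge L j) (U j) L = trace_deriv_at (edge L 0) (U 0) L) \<and>
     (\<Sum>j=1..N. trace_at (edge L j) (U j) L) = of_real Z * trace_deriv_at (edge L 1) (U 1) L}"

text \<open>\<open>e\<^bsup>i\<omega>t\<^esup> U\<close> is a standing wave: classical solution of \<open>-U'' + \<omega> U - |U|\<^sup>2 U = 0\<close> in the
  interior of each edge.\<close>

definition standing_wave :: "nat \<Rightarrow> real \<Rightarrow> real \<Rightarrow> graph_fun \<Rightarrow> bool" where
  "standing_wave N L \<omega> U \<longleftrightarrow> (\<forall>e\<le>N. \<exists>U1 U2. \<forall>x \<in> edge L e.
     (U e has_vector_derivative U1 x) (at x) \<and>
     (U1 has_vector_derivative U2 x) (at x) \<and>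
     - U2 x + of_real \<omega> * U e x - of_real ((norm (U e x))\<^sup>2) * U e x = 0)"

text \<open>Infinitely differentiable maps from a set of reals without isolated points into the normed
  space \<open>H\<^sup>1\<close> of the graph; \<open>D k\<close> is the \<open>k\<close>-th derivative.\<close>

definition H1_smooth_on :: "nat \<Rightarrow> real \<Rightarrow> real set \<Rightarrow> (real \<Rightarrow> graph_fun) \<Rightarrow> bool" where
  "H1_smooth_on N L S F \<longleftrightarrow> (\<exists>D :: nat \<Rightarrow> real \<Rightarrow> graph_fun.
     (\<forall>\<omega>\<in>S. D 0 \<omega> = F \<omega>) \<and>
     (\<forall>k. \<forall>\<omega>\<in>S. D k \<omega> \<in> graph_sobolev 1 N L \<and>
        ((\<lambda>\<mu>. graph_H1_norm N L
                (\<lambda>e x. (D k \<mu> e x - D k \<omega> e x) /\<^sub>R (\<mu> - \<omega>) - D (Suc k) \<omega> e x)) \<longlongrightarrow> 0)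
          (at \<omega> within S)))"

section \<open>Jacobi elliptic functions\<close>

text \<open>The argument \<open>k\<close> is the modulus, \<open>0 < k < 1\<close>.\<close>

definition elliptic_F :: "real \<Rightarrow> real \<Rightarrow> real" where
  "elliptic_F \<theta> k = (LBINT s=0..\<theta>. 1 / sqrt (1 - k\<^sup>2 * (sin s)\<^sup>2))"

definition elliptic_K :: "real \<Rightarrow> real" where
  "elliptic_K k = elliptic_F (pi / 2) k"

definition jacobi_am :: "real \<Rightarrow> real \<Rightarrow> real" where
  "jacobi_am u k = (THE \<theta>. elliptic_F \<theta> k = u)"

definition jacobi_dn :: "real \<Rightarrow> real \<Rightarrow> real" where
  "jacobi_dn u k = sqrt (1 - k\<^sup>2 * (sin (jacobi_am u k))\<^sup>2)"

section \<open>Profiles and frequencies\<close>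

definition eta1_of :: "real \<Rightarrow> real \<Rightarrow> real" where
  "eta1_of \<omega> y = sqrt (2 * \<omega> - y\<^sup>2)"

definition modulus_of :: "real \<Rightarrow> real \<Rightarrow> real" where
  "modulus_of \<omega> y = sqrt (((eta1_of \<omega> y)\<^sup>2 - y\<^sup>2) / (eta1_of \<omega> y)\<^sup>2)"

definition eta2 :: "real \<Rightarrow> real \<Rightarrow> real" where
  "eta2 L \<omega> = (THE y. 0 < y \<and> y < sqrt \<omega> \<and>
     sqrt 2 / eta1_of \<omega> y * elliptic_K (modulus_of \<omega> y) = L)"

definition eta1 :: "real \<Rightarrow> real \<Rightarrow> real" where
  "eta1 L \<omega> = eta1_of \<omega> (eta2 L \<omega>)"

definition dn_modulus :: "real \<Rightarrow> real \<Rightarrow> real" where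
  "dn_modulus L \<omega> = modulus_of \<omega> (eta2 L \<omega>)"

definition dnoidal :: "real \<Rightarrow> real \<Rightarrow> real \<Rightarrow> real" where
  "dnoidal L \<omega> x = eta1 L \<omega> * jacobi_dn (eta1 L \<omega> / sqrt 2 * x) (dn_modulus L \<omega>)"

definition tail :: "nat \<Rightarrow> real \<Rightarrow> real \<Rightarrow> real \<Rightarrow> real \<Rightarrow> real" where
  "tail N Z L \<omega> x =
     sqrt (2 * \<omega>) * (1 / cosh (sqrt \<omega> * (x - L) + artanh (- real N / (Z * sqrt \<omega>))))"

definition Theta :: "nat \<Rightarrow> real \<Rightarrow> real \<Rightarrow> real \<Rightarrow> real \<Rightarrow> graph_fun" where
  "Theta N Z L a \<omega> e x =
     of_real (if e = 0 then dnoidal L \<omega> (x - a) else tail N Z L \<omega> x)"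

definition omega_min :: "nat \<Rightarrow> real \<Rightarrow> real \<Rightarrow> real" where
  "omega_min N Z L = max (pi\<^sup>2 / (2 * L\<^sup>2)) ((real N)\<^sup>2 / Z\<^sup>2)"

definition k0 :: "nat \<Rightarrow> real \<Rightarrow> real \<Rightarrow> real" where
  "k0 N Z L = (INF \<omega>\<in>{omega_min N Z L<..}. dn_modulus L \<omega>)"

definition freq_set :: "nat \<Rightarrow> real \<Rightarrow> real \<Rightarrow> real set" where
  "freq_set N Z L = {\<omega>. \<omega> > omega_min N Z L \<and>
     Z\<^sup>2 * (k0 N Z L)^4 / (16 * (real N)\<^sup>2) * \<omega>\<^sup>2 - \<omega> + (real N)\<^sup>2 / Z\<^sup>2 > 0}"

end

theory Submission
  imports Defs
begin

text \<open>With \<open>q = k\<^sup>2 / (2 - k\<^sup>2)\<close> the dnoidal profile is \<open>\<Phi>\<^sub>\<omega>(x)\<^sup>2 = \<omega> (1 + q cos T)\<close>, where \<open>T\<close> is the inverse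
  of the pendulum integral \<open>\<integral>\<^sub>0\<^sup>T (1 + q cos t)\<^sup>-\<^sup>1\<^sup>/\<^sup>2 dt = sqrt (2 \<omega>) x\<close>. The period condition becomes
  \<open>\<integral>\<^sub>0\<^sup>\<pi> (1 + q cos t)\<^sup>-\<^sup>1\<^sup>/\<^sup>2 dt = sqrt (2 \<omega>) L\<close>, whose left side increases in \<open>q\<close> from \<open>\<pi>\<close> to infinity, so
  \<open>q\<close> is a smooth function of \<open>\<omega>\<close>. Since \<open>\<Phi>' = - \<omega> q sin T / sqrt 2\<close>, matching the derivatives at the
  vertex asks for \<open>sin T = 2 c sqrt (\<omega> - c\<^sup>2) / (\<omega> q)\<close> with \<open>c = N / |Z|\<close>. The right side is less than \<open>1\<close> on
  the set \<open>I\<close>, because \<open>q \<ge> k\<^sup>2 / 2 \<ge> k\<^sub>0\<^sup>2 / 2\<close>, and \<open>a\<close> is then given by an explicit smooth formula.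
  Smoothness into \<open>H\<^sup>1\<close> follows from pointwise smoothness in \<open>(\<omega>, x)\<close> together with \<open>L\<^sup>2\<close> bounds in \<open>x\<close>,
  locally uniform in \<open>\<omega>\<close>, on all derivatives.\<close>

section \<open>Smooth functions of several real variables\<close>

text \<open>Several notions are given by a choice or a definite description:
  \<open>weak_deriv\<close>, \<open>trace_at\<close>, \<open>eta2\<close>, \<open>jacobi_am\<close>.
  Much of the work is therefore uniqueness: the fundamental lemma of the calculus of variations for
  weak derivatives, equality of continuous representatives for traces, strict monotonicity of the
  pendulum integral and of its half period for the elliptic functions.

  At the vertex only one scalar equation remains for the one unknown a. With c = N / |Z|, the phase
  of the tail is such that psi'(L) = - c psi(L), which is already N psi(L) = Z psi'(L); and both
  conditions that compare the two ends of the loop hold because the profile has period 2 L.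

  For the map into H^1, the error of a difference quotient must be small together with its
  x-derivative, also on unbounded edges. This calls for classes of families that are closed under
  both partial derivatives and locally dominated: all smooth families on the bounded loop, and sums
  of powers of x - L times tanh^i times sech on the half-lines, where each derivative in \<omega>
  may bring out a factor x - L.\<close>

primrec Ck_on :: "nat \<Rightarrow> 'a::real_normed_vector set \<Rightarrow> ('a \<Rightarrow> real) \<Rightarrow> bool" where
  "Ck_on 0 S f \<longleftrightarrow> continuous_on S f"
| "Ck_on (Suc n) S f \<longleftrightarrow>
     (\<exists>f'. (\<forall>x\<in>S. (f has_derivative f' x) (at x)) \<and> (\<forall>v. Ck_on n S (\<lambda>x. f' x v)))"

definition smooth_on :: "'a::real_normed_vector set \<Rightarrow> ('a \<Rightarrow> real) \<Rightarrow> bool" where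
  "smooth_on S f \<longleftrightarrow> (\<forall>n. Ck_on n S f)"

lemma Ck_on_SucD: "Ck_on (Suc n) S f \<Longrightarrow> Ck_on n S f"
proof (induction n arbitrary: f)
  case 0
  then show ?case
    by (metis Ck_on.simps continuous_at_imp_continuous_on has_derivative_continuous)
next
  case (Suc n)
  from Suc.prems obtain f' where "\<forall>x\<in>S. (f has_derivative f' x) (at x)"
    and "\<forall>v. Ck_on (Suc n) S (\<lambda>x. f' x v)"
    unfolding Ck_on.simps(2)[of "Suc n"] by blast
  then show ?case using Suc.IH by (auto simp del: Ck_on.simps(2) simp: Ck_on.simps(2)[of n])
qed

lemma Ck_on_cong:
  assumes "open S" "\<And>x. x \<in> S \<Longrightarrow> f x = g x" "Ck_on n S f"
  shows "Ck_on n S g"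
proof (cases n)
  case 0
  then show ?thesis using assms continuous_on_cong by (metis Ck_on.simps(1))
next
  case (Suc m)
  then obtain f' where "\<forall>x\<in>S. (f has_derivative f' x) (at x)" "\<forall>v. Ck_on m S (\<lambda>x. f' x v)"
    using assms(3) by auto
  moreover have "\<forall>x\<in>S. (g has_derivative f' x) (at x)"
    using calculation(1) assms(1,2) has_derivative_transform_within_open by metis
  ultimately show ?thesis using Suc by auto
qed

lemma Ck_on_subset: "Ck_on n T f \<Longrightarrow> S \<subseteq> T \<Longrightarrow> Ck_on n S f"
proof (induction n arbitrary: f)
  case 0
  then show ?case by (auto intro: continuous_on_subset)
next
  case (Suc n)
  then show ?case by (simp only: Ck_on.simps) blast
qed

lemma Ck_on_const [simp]: "Ck_on n S (\<lambda>_. c)"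
proof (induction n arbitrary: c)
  case (Suc n)
  then show ?case by (auto intro!: exI[of _ "\<lambda>_ _. 0"])
qed auto

lemma Ck_on_bounded_linear:
  assumes "bounded_linear f"
  shows "Ck_on n S f"
  using assms by (cases n)
    (auto intro!: exI[of _ "\<lambda>_. f"] bounded_linear_imp_has_derivative linear_continuous_on)

lemma Ck_on_add:
  "Ck_on n S f \<Longrightarrow> Ck_on n S g \<Longrightarrow> Ck_on n S (\<lambda>x. f x + g x)"
proof (induction n arbitrary: f g)
  case 0
  then show ?case by (auto intro: continuous_intros)
next
  case (Suc n)
  then obtain f' g' where "\<forall>x\<in>S. (f has_derivative f' x) (at x)" "\<forall>v. Ck_on n S (\<lambda>x. f' x v)"
     "\<forall>x\<in>S. (g has_derivative g' x) (at x)" "\<forall>v. Ck_on n S (\<lambda>x. g' x v)"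
    by auto
  then show ?case using Suc.IH
    by (auto intro!: exI[of _ "\<lambda>x v. f' x v + g' x v"] has_derivative_add)
qed

lemma Ck_on_mult:
  "Ck_on n S f \<Longrightarrow> Ck_on n S g \<Longrightarrow> Ck_on n S (\<lambda>x. f x * g x)"
proof (induction n arbitrary: f g)
  case 0
  then show ?case by (auto intro: continuous_intros)
next
  case (Suc n)
  have fg: "Ck_on n S f" "Ck_on n S g" using Suc.prems Ck_on_SucD by auto
  obtain f' g' where *: "\<forall>x\<in>S. (f has_derivative f' x) (at x)" "\<forall>v. Ck_on n S (\<lambda>x. f' x v)"
     "\<forall>x\<in>S. (g has_derivative g' x) (at x)" "\<forall>v. Ck_on n S (\<lambda>x. g' x v)"
    using Suc.prems by auto
  show ?case unfolding Ck_on.simps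
  proof (intro exI conjI ballI allI)
    fix x assume "x \<in> S"
    then show "((\<lambda>x. f x * g x) has_derivative (\<lambda>v. f x * g' x v + f' x v * g x)) (at x)"
      using * by (auto intro!: has_derivative_mult)
  next
    fix v
    show "Ck_on n S (\<lambda>x. f x * g' x v + f' x v * g x)"
      using * fg by (intro Ck_on_add Suc.IH) auto
  qed
qed

lemma Ck_on_sum:
  "(\<And>i. i \<in> I \<Longrightarrow> Ck_on n S (f i)) \<Longrightarrow> Ck_on n S (\<lambda>x. \<Sum>i\<in>I. f i x)"
  by (induction I rule: infinite_finite_induct) (auto intro: Ck_on_add)

text \<open>\<open>Ck_on\<close> covers scalar functions only, so the inner map is controlled
  through its coordinates. The derivative of the composite is a finite sum of products of coordinate
  derivatives with \<open>g'\<close> taken along \<open>f\<close>; both factors are one class lower,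
  where the induction hypothesis applies.\<close>

lemma Ck_on_compose:
  fixes f :: "'a::real_normed_vector \<Rightarrow> 'b::euclidean_space"
  assumes "Ck_on n T g" "\<And>b. b \<in> Basis \<Longrightarrow> Ck_on n S (\<lambda>x. f x \<bullet> b)" "f ` S \<subseteq> T"
  shows "Ck_on n S (\<lambda>x. g (f x))"
  using assms
proof (induction n arbitrary: g)
  case 0
  then have "continuous_on S f" using continuous_on_componentwise[of S f] by auto
  then show ?case using 0 by (auto intro: continuous_on_compose2)
next
  case (Suc n)
  obtain g' where g': "\<forall>x\<in>T. (g has_derivative g' x) (at x)" "\<forall>v. Ck_on n T (\<lambda>x. g' x v)"
    using Suc.prems by auto
  have "\<forall>b\<in>Basis. \<exists>f'. (\<forall>x\<in>S. ((\<lambda>x. f x \<bullet> b) has_derivative f' x) (at x)) \<and>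
     (\<forall>v. Ck_on n S (\<lambda>x. f' x v))"
    using Suc.prems by auto
  then obtain f' where f': "\<And>b x. b \<in> Basis \<Longrightarrow> x \<in> S \<Longrightarrow> ((\<lambda>x. f x \<bullet> b) has_derivative f' b x) (at x)"
     "\<And>b v. b \<in> Basis \<Longrightarrow> Ck_on n S (\<lambda>x. f' b x v)"
    by metis
  have fn: "\<And>b. b \<in> Basis \<Longrightarrow> Ck_on n S (\<lambda>x. f x \<bullet> b)" using Suc.prems Ck_on_SucD by blast
  show ?case unfolding Ck_on.simps
  proof (intro exI conjI ballI allI)
    fix x assume x: "x \<in> S"
    then have gx: "(g has_derivative g' (f x)) (at (f x))" using g' Suc.prems by auto
    have "(f has_derivative (\<lambda>v. \<Sum>b\<in>Basis. f' b x v *\<^sub>R b)) (at x)"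
      unfolding has_derivative_componentwise_within[of f]
      using f'(1)[OF _ x] by (auto simp: inner_sum_left_Basis)
    from has_derivative_compose[OF this gx]
    show "((\<lambda>x. g (f x)) has_derivative (\<lambda>v. \<Sum>b\<in>Basis. f' b x v * g' (f x) b)) (at x)"
      using has_derivative_linear[OF gx] by (simp add: linear_sum linear_cmul)
  next
    fix v
    show "Ck_on n S (\<lambda>x. \<Sum>b\<in>Basis. f' b x v * g' (f x) b)"
      using f'(2) Suc.IH[OF spec[OF g'(2)] fn Suc.prems(3)] by (intro Ck_on_sum Ck_on_mult) auto
  qed
qed

lemma Ck_on_compose_real:
  fixes f :: "'a::real_normed_vector \<Rightarrow> real"
  assumes "Ck_on n T g" "Ck_on n S f" "\<And>x. x \<in> S \<Longrightarrow> f x \<in> T"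
  shows "Ck_on n S (\<lambda>x. g (f x))"
  using Ck_on_compose[of n T g S f] assms by auto

lemma Ck_on_compose_Pair:
  fixes f1 f2 :: "'a::real_normed_vector \<Rightarrow> real"
  assumes "Ck_on n T g" "Ck_on n S f1" "Ck_on n S f2" "\<And>x. x \<in> S \<Longrightarrow> (f1 x, f2 x) \<in> T"
  shows "Ck_on n S (\<lambda>x. g (f1 x, f2 x))"
proof (rule Ck_on_compose[of n T g S "\<lambda>x. (f1 x, f2 x)"])
  show "Ck_on n S (\<lambda>x. (f1 x, f2 x) \<bullet> b)" if "b \<in> Basis" for b
    using that assms(2,3) by (auto simp: Basis_prod_def)
qed (use assms in auto)

lemma Ck_on_SucI_real:
  fixes f :: "real \<Rightarrow> real"
  assumes "\<And>x. x \<in> S \<Longrightarrow> (f has_real_derivative f' x) (at x)" "Ck_on n S f'"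
  shows "Ck_on (Suc n) S f"
  unfolding Ck_on.simps
  using assms by (intro exI[of _ "\<lambda>x v. f' x * v"]) (auto intro!: Ck_on_mult simp: has_field_derivative_def)

lemma Ck_on_SucI_prod:
  fixes f :: "real \<times> real \<Rightarrow> real"
  assumes "\<And>p. p \<in> S \<Longrightarrow> (f has_derivative (\<lambda>v. f1 p * fst v + f2 p * snd v)) (at p)"
     "Ck_on n S f1" "Ck_on n S f2"
  shows "Ck_on (Suc n) S f"
  unfolding Ck_on.simps
  using assms by (intro exI[of _ "\<lambda>p v. f1 p * fst v + f2 p * snd v"] conjI ballI allI Ck_on_add Ck_on_mult Ck_on_const)

lemma smooth_onD_continuous: "smooth_on S f \<Longrightarrow> continuous_on S f"
  unfolding smooth_on_def by (metis Ck_on.simps(1))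

text \<open>\<open>Ck_on\<close> supplies a possibly different derivative map for every order.
  Uniqueness of the derivative makes them agree on \<open>S\<close>, and openness lets
  \<open>Ck_on_cong\<close> carry every order over to the map obtained from order one.\<close>

lemma smooth_on_derivative:
  fixes f :: "'a::real_normed_vector \<Rightarrow> real"
  assumes "open S" "smooth_on S f"
  shows "\<exists>f'. (\<forall>x\<in>S. (f has_derivative f' x) (at x)) \<and> (\<forall>v. smooth_on S (\<lambda>x. f' x v))"
proof -
  have "Ck_on (Suc 0) S f" using assms(2) unfolding smooth_on_def by blast
  then obtain f' where f': "\<forall>x\<in>S. (f has_derivative f' x) (at x)"
    by auto
  have "Ck_on n S (\<lambda>x. f' x v)" for n v
  proof -
    have "Ck_on (Suc n) S f" using assms(2) unfolding smooth_on_def by blast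
    then obtain g where g: "\<forall>x\<in>S. (f has_derivative g x) (at x)" "\<forall>v. Ck_on n S (\<lambda>x. g x v)"
      by auto
    have "g x v = f' x v" if "x \<in> S" for x
      using has_derivative_unique[OF bspec[OF g(1) that] bspec[OF f' that]] by simp
    then show ?thesis by (rule Ck_on_cong[OF assms(1) _ spec[OF g(2)]])
  qed
  then have "smooth_on S (\<lambda>x. f' x v)" for v by (simp add: smooth_on_def)
  with f' show ?thesis by auto
qed

lemma smooth_on_real_derivative:
  fixes f :: "real \<Rightarrow> real"
  assumes "open S" "smooth_on S f"
  obtains f' where "\<And>x. x \<in> S \<Longrightarrow> (f has_real_derivative f' x) (at x)" "smooth_on S f'"
proof -
  obtain f' where "\<forall>x\<in>S. (f has_derivative f' x) (at x)"
    and f'2: "\<forall>v. smooth_on S (\<lambda>x. f' x v)"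
    using smooth_on_derivative[OF assms] by blast
  then have f': "(f has_derivative f' x) (at x)" if "x \<in> S" for x using that by blast
  have "(f has_real_derivative f' x 1) (at x)" if "x \<in> S" for x
  proof -
    have "f' x v = f' x 1 * v" for v
      using linear_cmul[OF has_derivative_linear[OF f'[OF that]], of v 1] by (simp add: mult.commute)
    then have "f' x = (*) (f' x 1)" by (rule ext)
    then show ?thesis using f'[OF that] unfolding has_field_derivative_def by simp
  qed
  then show ?thesis using f'2 by (intro that[of "\<lambda>x. f' x 1"]) auto
qed

lemma smooth_on_gradient:
  fixes f :: "real \<times> real \<Rightarrow> real"
  assumes "open S" "smooth_on S f"
  shows "\<exists>f1 f2. (\<forall>p\<in>S. (f has_derivative (\<lambda>v. f1 p * fst v + f2 p * snd v)) (at p)) \<and>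
    smooth_on S f1 \<and> smooth_on S f2"
proof -
  obtain f' where "\<forall>x\<in>S. (f has_derivative f' x) (at x)"
    and f'2: "\<forall>v. smooth_on S (\<lambda>x. f' x v)"
    using smooth_on_derivative[OF assms] by blast
  then have f': "(f has_derivative f' x) (at x)" if "x \<in> S" for x using that by blast
  have "(f has_derivative (\<lambda>v. f' p (1, 0) * fst v + f' p (0, 1) * snd v)) (at p)" if p: "p \<in> S" for p
  proof -
    note lin = has_derivative_linear[OF f'[OF p]]
    have "f' p v = f' p (1, 0) * fst v + f' p (0, 1) * snd v" for v
      using linear_add[OF lin, of "fst v *\<^sub>R (1, 0)" "snd v *\<^sub>R (0, 1)"]
        linear_cmul[OF lin, of "fst v" "(1, 0)"] linear_cmul[OF lin, of "snd v" "(0, 1)"]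
      by (simp add: mult.commute)
    then have "f' p = (\<lambda>v. f' p (1, 0) * fst v + f' p (0, 1) * snd v)" by (rule ext)
    with f'[OF p] show ?thesis by simp
  qed
  then show ?thesis
    using f'2 by (intro exI[of _ "\<lambda>p. f' p (1, 0)"] exI[of _ "\<lambda>p. f' p (0, 1)"]) auto
qed

lemma has_derivative_imp_partials:
  fixes f :: "real \<times> real \<Rightarrow> real"
  assumes "(f has_derivative (\<lambda>v. a * fst v + b * snd v)) (at (x, y))"
  shows "((\<lambda>x. f (x, y)) has_real_derivative a) (at x)" "((\<lambda>y. f (x, y)) has_real_derivative b) (at y)"
proof -
  have "((\<lambda>x. (x, y)) has_derivative (\<lambda>v. (v, 0))) (at x)" by (auto intro!: derivative_eq_intros)
  from has_derivative_compose[OF this assms]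
  show "((\<lambda>x. f (x, y)) has_real_derivative a) (at x)" by (simp add: has_field_derivative_def)
  have "((\<lambda>y. (x, y)) has_derivative (\<lambda>v. (0, v))) (at y)" by (auto intro!: derivative_eq_intros)
  from has_derivative_compose[OF this assms]
  show "((\<lambda>y. f (x, y)) has_real_derivative b) (at y)" by (simp add: has_field_derivative_def)
qed

lemma smooth_on_partially_differentiable:
  fixes f :: "real \<times> real \<Rightarrow> real"
  assumes "open S" "smooth_on S f" "(x, y) \<in> S"
  shows "\<exists>d. ((\<lambda>x. f (x, y)) has_real_derivative d) (at x)"
    and "\<exists>d. ((\<lambda>y. f (x, y)) has_real_derivative d) (at y)"
proof -
  obtain f1 f2 where "\<forall>p\<in>S. (f has_derivative (\<lambda>v. f1 p * fst v + f2 p * snd v)) (at p)"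
    using smooth_on_gradient[OF assms(1,2)] by blast
  note has_derivative_imp_partials[OF bspec[OF this assms(3)]]
  then show "\<exists>d. ((\<lambda>x. f (x, y)) has_real_derivative d) (at x)"
    and "\<exists>d. ((\<lambda>y. f (x, y)) has_real_derivative d) (at y)" by blast+
qed

section \<open>Closure rules and elementary smooth functions\<close>

lemma smooth_on_const [simp]: "smooth_on S (\<lambda>_. c)"
  by (simp add: smooth_on_def)

lemma smooth_on_bounded_linear: "bounded_linear f \<Longrightarrow> smooth_on S f"
  by (simp add: smooth_on_def Ck_on_bounded_linear)

lemma smooth_on_id: "smooth_on S (\<lambda>x::real. x)"
  by (simp add: smooth_on_bounded_linear)

lemma smooth_on_fst: "smooth_on S (fst :: real \<times> 'a::real_normed_vector \<Rightarrow> real)"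
  by (simp add: smooth_on_bounded_linear bounded_linear_fst)

lemma smooth_on_snd: "smooth_on S (snd :: 'a::real_normed_vector \<times> real \<Rightarrow> real)"
  by (simp add: smooth_on_bounded_linear bounded_linear_snd)

lemma smooth_on_add: "smooth_on S f \<Longrightarrow> smooth_on S g \<Longrightarrow> smooth_on S (\<lambda>x. f x + g x)"
  by (simp add: smooth_on_def Ck_on_add)

lemma smooth_on_mult: "smooth_on S f \<Longrightarrow> smooth_on S g \<Longrightarrow> smooth_on S (\<lambda>x. f x * g x)"
  by (simp add: smooth_on_def Ck_on_mult)

lemma smooth_on_minus: "smooth_on S f \<Longrightarrow> smooth_on S (\<lambda>x. - f x)"
  using smooth_on_mult[of S "\<lambda>_. -1" f] by simp

lemma smooth_on_diff: "smooth_on S f \<Longrightarrow> smooth_on S g \<Longrightarrow> smooth_on S (\<lambda>x. f x - g x)"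
  using smooth_on_add[of S f "\<lambda>x. - g x"] smooth_on_minus[of S g] by simp

lemma smooth_on_compose:
  fixes f :: "'a::real_normed_vector \<Rightarrow> real"
  assumes "smooth_on T g" "smooth_on S f" "\<And>x. x \<in> S \<Longrightarrow> f x \<in> T"
  shows "smooth_on S (\<lambda>x. g (f x))"
  using assms Ck_on_compose_real unfolding smooth_on_def by blast

lemma smooth_on_compose_Pair:
  fixes f1 f2 :: "'a::real_normed_vector \<Rightarrow> real"
  assumes "smooth_on T g" "smooth_on S f1" "smooth_on S f2" "\<And>x. x \<in> S \<Longrightarrow> (f1 x, f2 x) \<in> T"
  shows "smooth_on S (\<lambda>x. g (f1 x, f2 x))"
  using assms Ck_on_compose_Pair unfolding smooth_on_def by blast

lemma smooth_on_realI:
  fixes f :: "real \<Rightarrow> real"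
  assumes "\<And>x. x \<in> S \<Longrightarrow> (f has_real_derivative f' x) (at x)" "smooth_on S f'"
  shows "smooth_on S f"
proof -
  have "Ck_on (Suc n) S f" for n
    using Ck_on_SucI_real[OF assms(1)] assms(2) by (auto simp: smooth_on_def)
  then show ?thesis using Ck_on_SucD unfolding smooth_on_def by blast
qed

lemma smooth_on_cong:
  "open S \<Longrightarrow> smooth_on S f \<Longrightarrow> (\<And>x. x \<in> S \<Longrightarrow> f x = g x) \<Longrightarrow> smooth_on S g"
  unfolding smooth_on_def by (auto intro: Ck_on_cong[of S f g])

lemma smooth_on_subset: "smooth_on T f \<Longrightarrow> S \<subseteq> T \<Longrightarrow> smooth_on S f"
  unfolding smooth_on_def using Ck_on_subset by blast

text \<open>The exponent varies in the induction because differentiation lowers it. Square roots and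
  reciprocals are later obtained as the exponents 1/2 and -1.\<close>

lemma smooth_on_powr: "smooth_on {0<..} (\<lambda>x. x powr r)"
proof -
  have "Ck_on n {0<..} (\<lambda>x. x powr r)" for n
  proof (induction n arbitrary: r)
    case 0
    then show ?case by (auto intro!: continuous_intros)
  next
    case (Suc n)
    show ?case
    proof (rule Ck_on_SucI_real)
      show "((\<lambda>x. x powr r) has_real_derivative r * x powr (r - 1)) (at x)" if "x \<in> {0<..}" for x
        using that by (auto intro!: derivative_eq_intros)
    qed (auto intro: Ck_on_mult Suc)
  qed
  then show ?thesis by (simp add: smooth_on_def)
qed

lemma smooth_on_sin: "smooth_on S sin" and smooth_on_cos: "smooth_on S cos"
proof -
  have "Ck_on n S (sin::real\<Rightarrow>real) \<and> Ck_on n S (cos::real\<Rightarrow>real)" for n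
  proof (induction n)
    case 0
    then show ?case by (auto intro!: continuous_intros)
  next
    case (Suc n)
    have "Ck_on n S (\<lambda>x. - 1 * sin x)" using Suc by (intro Ck_on_mult) auto
    then have "Ck_on n S (\<lambda>x. - sin x)" by simp
    then show ?case
      using Suc Ck_on_SucI_real[of S sin cos n] Ck_on_SucI_real[of S cos "\<lambda>x. - sin x" n]
        DERIV_sin DERIV_cos by blast
  qed
  then show "smooth_on S (sin::real\<Rightarrow>real)" "smooth_on S (cos::real\<Rightarrow>real)" by (auto simp: smooth_on_def)
qed

lemma smooth_on_compose_powr:
  fixes f :: "'a::real_normed_vector \<Rightarrow> real"
  assumes "smooth_on S f" "\<And>x. x \<in> S \<Longrightarrow> 0 < f x"
  shows "smooth_on S (\<lambda>x. f x powr r)"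
  using smooth_on_compose[OF smooth_on_powr, of S f r] assms by auto

lemma smooth_on_compose_sqrt:
  fixes f :: "'a::real_normed_vector \<Rightarrow> real"
  assumes "open S" "smooth_on S f" "\<And>x. x \<in> S \<Longrightarrow> 0 < f x"
  shows "smooth_on S (\<lambda>x. sqrt (f x))"
  by (rule smooth_on_cong[OF assms(1) smooth_on_compose_powr[OF assms(2,3), where r = "1/2"]])
     (auto simp: powr_half_sqrt less_imp_le[OF assms(3)])

lemma smooth_on_divide:
  fixes f :: "'a::real_normed_vector \<Rightarrow> real"
  assumes "open S" "smooth_on S f" "smooth_on S g" "\<And>x. x \<in> S \<Longrightarrow> 0 < g x"
  shows "smooth_on S (\<lambda>x. f x / g x)"
  by (rule smooth_on_cong[OF assms(1) smooth_on_mult[OF assms(2) smooth_on_compose_powr[OF assms(3,4), where r = "-1"]]])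
     (auto simp: powr_minus_divide less_imp_le[OF assms(4)])

lemma smooth_on_arcsin: "smooth_on {-1<..<1} arcsin"
proof (rule smooth_on_realI)
  show "(arcsin has_real_derivative 1 / sqrt (1 - x * x)) (at x)" if "x \<in> {-1<..<1}" for x
    using that by (auto intro!: derivative_eq_intros simp: field_simps power2_eq_square)
  show "smooth_on {-1<..<1} (\<lambda>x::real. 1 / sqrt (1 - x * x))"
    by (intro smooth_on_divide smooth_on_compose_sqrt smooth_on_diff smooth_on_mult smooth_on_const smooth_on_id)
       (auto simp: power2_eq_square[symmetric] abs_square_less_1)
qed

lemma smooth_on_artanh: "smooth_on {-1<..<1} (artanh :: real \<Rightarrow> real)"
proof (rule smooth_on_realI)
  show "(artanh has_real_derivative 1 / (1 - x * x)) (at x)" if "x \<in> {-1<..<1}" for x::real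
    using that by (auto intro!: derivative_eq_intros simp: field_simps power2_eq_square)
  show "smooth_on {-1<..<1} (\<lambda>x::real. 1 / (1 - x * x))"
    by (intro smooth_on_divide smooth_on_diff smooth_on_mult smooth_on_const smooth_on_id)
       (auto simp: power2_eq_square[symmetric] abs_square_less_1)
qed

section \<open>Parameter integrals and inverse functions\<close>

text \<open>Differentiating in \<open>\<theta>\<close> produces a factor \<open>s\<close>, hence the weight \<open>s ^ m\<close>: with it the family of
  integrals is closed under partial derivatives.\<close>

lemma has_derivative_param_integral:
  fixes g g1 g2 :: "real \<times> real \<Rightarrow> real"
  assumes I: "open I" "convex I" "q \<in> I"
    and g: "\<And>p. p \<in> UNIV \<times> I \<Longrightarrow> (g has_derivative (\<lambda>v. g1 p * fst v + g2 p * snd v)) (at p)"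
    and c1: "continuous_on (UNIV \<times> I) g1" and c2: "continuous_on (UNIV \<times> I) g2"
  shows "((\<lambda>p. integral {0..1} (\<lambda>s. s ^ m * g (fst p * s, snd p))) has_derivative
    (\<lambda>v. integral {0..1} (\<lambda>s. s ^ Suc m * g1 (\<theta> * s, q)) * fst v +
         integral {0..1} (\<lambda>s. s ^ m * g2 (\<theta> * s, q)) * snd v)) (at (\<theta>, q))"
proof -
  let ?U = "UNIV \<times> I :: (real \<times> real) set"
  \<comment> \<open>\<open>leibniz_rule\<close> wants a total derivative valued in bounded linear
    maps; here it combines the two coordinate projections, and the chain rule through
    \<open>fst p * s\<close> raises the power of \<open>s\<close>.\<close>
  define fx :: "real \<times> real \<Rightarrow> real \<Rightarrow> (real \<times> real) \<Rightarrow>\<^sub>L real" where "fx p s = (s ^ Suc m * g1 (fst p * s, snd p)) *\<^sub>R fst_blinfun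
      + (s ^ m * g2 (fst p * s, snd p)) *\<^sub>R snd_blinfun" for p and s :: real
  have cg: "continuous_on ?U g"
    using g has_derivative_continuous continuous_at_imp_continuous_on by blast
  have cc: "continuous_on (?U \<times> {0..1}) (\<lambda>(p, s). s ^ k * h (fst p * s, snd p))"
    if "continuous_on ?U h" for h :: "real \<times> real \<Rightarrow> real" and k
    unfolding split_beta
    by (intro continuous_intros continuous_on_compose2[OF that]) auto
  have cs: "continuous_on {0..1} (\<lambda>s. s ^ k * h (x * s, r))"
    if "continuous_on ?U h" "r \<in> I" for h :: "real \<times> real \<Rightarrow> real" and k x r
    using that(2) by (intro continuous_intros continuous_on_compose2[OF that(1)]) auto
  have "((\<lambda>p. integral (cbox 0 1) (\<lambda>s. s ^ m * g (fst p * s, snd p))) has_derivative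
      blinfun_apply (integral (cbox 0 1) (fx (\<theta>, q)))) (at (\<theta>, q) within ?U)"
  proof (rule leibniz_rule)
    fix p s assume p: "p \<in> ?U"
    have "((\<lambda>p. (fst p * s, snd p)) has_derivative (\<lambda>v. (fst v * s, snd v))) (at p)"
      by (auto intro!: derivative_eq_intros)
    from has_derivative_compose[OF this g] p
    have "((\<lambda>p. g (fst p * s, snd p)) has_derivative
        (\<lambda>v. g1 (fst p * s, snd p) * (fst v * s) + g2 (fst p * s, snd p) * snd v)) (at p)"
      by (auto simp: mem_Times_iff)
    then have "((\<lambda>p. s ^ m * g (fst p * s, snd p)) has_derivative blinfun_apply (fx p s)) (at p)"
      by (rule has_derivative_eq_rhs[OF has_derivative_mult_right])
        (auto simp: fx_def blinfun.bilinear_simps algebra_simps)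
    then show "((\<lambda>p. s ^ m * g (fst p * s, snd p)) has_derivative blinfun_apply (fx p s)) (at p within ?U)"
      by (rule has_derivative_at_withinI)
    show "(\<lambda>s. s ^ m * g (fst p * s, snd p)) integrable_on cbox 0 1"
      using cs[OF cg, of "snd p" m "fst p"] p by (auto intro!: integrable_continuous_real)
  next
    show "continuous_on (?U \<times> cbox 0 1) (\<lambda>(p, s). fx p s)"
      unfolding fx_def split_beta
      using cc[OF c1, of "Suc m"] cc[OF c2, of m] by (auto intro!: continuous_intros simp: split_beta simp del: power_Suc)
  qed (use I in \<open>auto intro: convex_Times\<close>)
  moreover have "integral {0..1} (fx (\<theta>, q)) =
      integral {0..1} (\<lambda>s. s ^ Suc m * g1 (\<theta> * s, q)) *\<^sub>R fst_blinfun +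
      integral {0..1} (\<lambda>s. s ^ m * g2 (\<theta> * s, q)) *\<^sub>R snd_blinfun"
  proof (rule integral_unique)
    have "((\<lambda>s. s ^ Suc m * g1 (\<theta> * s, q)) has_integral integral {0..1} (\<lambda>s. s ^ Suc m * g1 (\<theta> * s, q))) {0..1}"
      "((\<lambda>s. s ^ m * g2 (\<theta> * s, q)) has_integral integral {0..1} (\<lambda>s. s ^ m * g2 (\<theta> * s, q))) {0..1}"
      using cs[OF c1 I(3), of "Suc m" \<theta>] cs[OF c2 I(3), of m \<theta>]
      by (auto intro!: integrable_integral integrable_continuous_real)
    then show "(fx (\<theta>, q) has_integral
      integral {0..1} (\<lambda>s. s ^ Suc m * g1 (\<theta> * s, q)) *\<^sub>R fst_blinfun +
      integral {0..1} (\<lambda>s. s ^ m * g2 (\<theta> * s, q)) *\<^sub>R snd_blinfun) {0..1}"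
      unfolding fx_def fst_conv snd_conv by (intro has_integral_add has_integral_scaleR_left)
  qed
  moreover have "at (\<theta>, q) within ?U = at (\<theta>, q)"
    using I by (intro at_within_open) (auto intro: open_Times)
  moreover have "blinfun_apply (a *\<^sub>R fst_blinfun + b *\<^sub>R snd_blinfun) = (\<lambda>v :: real \<times> real. a * fst v + b * snd v)" for a b
    by (auto simp: fun_eq_iff blinfun.bilinear_simps)
  ultimately show ?thesis by simp
qed

lemma smooth_on_param_integral:
  fixes g :: "real \<times> real \<Rightarrow> real"
  assumes I: "open I" "convex I" and g: "smooth_on (UNIV \<times> I) g"
  shows "smooth_on (UNIV \<times> I) (\<lambda>p. integral {0..1} (\<lambda>s. s ^ m * g (fst p * s, snd p)))"
proof -
  have op: "open (UNIV \<times> I)" using I by (intro open_Times) auto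
  have "Ck_on n (UNIV \<times> I) (\<lambda>p. integral {0..1} (\<lambda>s. s ^ m * g (fst p * s, snd p)))" for n
    using g
  proof (induction n arbitrary: g m)
    case 0
    obtain g1 g2 where *: "\<forall>p\<in>UNIV \<times> I. (g has_derivative (\<lambda>v. g1 p * fst v + g2 p * snd v)) (at p)"
      "smooth_on (UNIV \<times> I) g1" "smooth_on (UNIV \<times> I) g2"
      using smooth_on_gradient[OF op 0] by blast
    show ?case unfolding Ck_on.simps
    proof (intro continuous_at_imp_continuous_on ballI)
      fix p :: "real \<times> real" assume p: "p \<in> UNIV \<times> I"
      obtain \<theta> q where "p = (\<theta>, q)" "q \<in> I" using p by auto
      then show "isCont (\<lambda>p. integral {0..1} (\<lambda>s. s ^ m * g (fst p * s, snd p))) p"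
        using has_derivative_continuous[OF has_derivative_param_integral[OF I _ bspec[OF *(1)] smooth_onD_continuous[OF *(2)] smooth_onD_continuous[OF *(3)]]]
        by simp
    qed
  next
    case (Suc n)
    obtain g1 g2 where *: "\<forall>p\<in>UNIV \<times> I. (g has_derivative (\<lambda>v. g1 p * fst v + g2 p * snd v)) (at p)"
      "smooth_on (UNIV \<times> I) g1" "smooth_on (UNIV \<times> I) g2"
      using smooth_on_gradient[OF op Suc.prems] by blast
    show ?case
    proof (rule Ck_on_SucI_prod)
      fix p :: "real \<times> real" assume p: "p \<in> UNIV \<times> I"
      obtain \<theta> q where pq: "p = (\<theta>, q)" "q \<in> I" using p by auto
      show "((\<lambda>p. integral {0..1} (\<lambda>s. s ^ m * g (fst p * s, snd p))) has_derivative
         (\<lambda>v. integral {0..1} (\<lambda>s. s ^ Suc m * g1 (fst p * s, snd p)) * fst v +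
         integral {0..1} (\<lambda>s. s ^ m * g2 (fst p * s, snd p)) * snd v)) (at p)"
        unfolding pq fst_conv snd_conv
        by (rule has_derivative_param_integral[OF I pq(2) bspec[OF *(1)] smooth_onD_continuous[OF *(2)] smooth_onD_continuous[OF *(3)]])
    qed (intro Suc.IH *)+
  qed
  then show ?thesis by (simp add: smooth_on_def)
qed

text \<open>After the substitution t = \<theta> s this is the integral of g(., q) from 0 to
  \<theta>. Differentiating under the integral sign leaves the integral over s of d/ds (s g(\<theta>
  s, q)), which telescopes to g(\<theta>, q).\<close>

lemma smooth_antiderivative:
  fixes g :: "real \<times> real \<Rightarrow> real"
  assumes I: "open I" "convex I" and g: "smooth_on (UNIV \<times> I) g"
  shows "smooth_on (UNIV \<times> I) (\<lambda>p. fst p * integral {0..1} (\<lambda>s. g (fst p * s, snd p)))" (is "smooth_on _ ?G")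
    and "\<And>\<theta> q. q \<in> I \<Longrightarrow>
      ((\<lambda>\<theta>. \<theta> * integral {0..1} (\<lambda>s. g (\<theta> * s, q))) has_real_derivative g (\<theta>, q)) (at \<theta>)"
proof -
  have op: "open (UNIV \<times> I)" using I by (intro open_Times) auto
  show "smooth_on (UNIV \<times> I) ?G"
    using smooth_on_mult[OF smooth_on_fst smooth_on_param_integral[OF assms, of 0]] by simp
  fix \<theta> q assume q: "q \<in> I"
  obtain g1 g2 where *: "\<forall>p\<in>UNIV \<times> I. (g has_derivative (\<lambda>v. g1 p * fst v + g2 p * snd v)) (at p)"
      "smooth_on (UNIV \<times> I) g1" "smooth_on (UNIV \<times> I) g2"
    using smooth_on_gradient[OF op g] by blast
  have "((\<lambda>\<theta>. integral {0..1} (\<lambda>s. g (\<theta> * s, q))) has_real_derivative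
      integral {0..1} (\<lambda>s. s * g1 (\<theta> * s, q))) (at \<theta>)"
    using has_derivative_imp_partials(1)[OF has_derivative_param_integral[OF I q bspec[OF *(1)] smooth_onD_continuous[OF *(2)] smooth_onD_continuous[OF *(3)], of 0]]
    by simp
  from DERIV_mult[OF DERIV_ident this]
  have D: "((\<lambda>\<theta>. \<theta> * integral {0..1} (\<lambda>s. g (\<theta> * s, q))) has_real_derivative
      integral {0..1} (\<lambda>s. g (\<theta> * s, q)) + \<theta> * integral {0..1} (\<lambda>s. s * g1 (\<theta> * s, q))) (at \<theta>)"
    by (simp add: algebra_simps)
  have c: "continuous_on {0..1} (\<lambda>s. h (\<theta> * s, q))" if "continuous_on (UNIV \<times> I) h" for h :: "real \<times> real \<Rightarrow> real"
    using q by (intro continuous_on_compose2[OF that] continuous_intros) auto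
  have "((\<lambda>s. g (\<theta> * s, q) + \<theta> * (s * g1 (\<theta> * s, q))) has_integral (1 * g (\<theta> * 1, q) - 0 * g (\<theta> * 0, q))) {0..1}"
  proof (rule fundamental_theorem_of_calculus)
    fix s :: real
    have "((\<lambda>t. g (t, q)) has_real_derivative g1 (\<theta> * s, q)) (at (\<theta> * s))"
      using q by (intro has_derivative_imp_partials(1)[OF bspec[OF *(1)]]) auto
    from DERIV_chain2[where f = "\<lambda>t. g (t, q)" and g = "\<lambda>s. \<theta> * s" and x = s, OF this DERIV_cmult_Id]
    have "((\<lambda>s. g (\<theta> * s, q)) has_real_derivative g1 (\<theta> * s, q) * \<theta>) (at s)" .
    from DERIV_mult[OF DERIV_ident this]
    have "((\<lambda>s. s * g (\<theta> * s, q)) has_real_derivative g (\<theta> * s, q) + \<theta> * (s * g1 (\<theta> * s, q))) (at s)"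
      by (simp add: algebra_simps)
    then show "((\<lambda>s. s * g (\<theta> * s, q)) has_vector_derivative g (\<theta> * s, q) + \<theta> * (s * g1 (\<theta> * s, q))) (at s within {0..1})"
      by (simp add: has_real_derivative_iff_has_vector_derivative has_vector_derivative_at_within)
  qed simp
  then have "integral {0..1} (\<lambda>s. g (\<theta> * s, q) + \<theta> * (s * g1 (\<theta> * s, q))) = g (\<theta>, q)"
    by (simp add: integral_unique)
  moreover have "integral {0..1} (\<lambda>s. g (\<theta> * s, q) + \<theta> * (s * g1 (\<theta> * s, q))) =
     integral {0..1} (\<lambda>s. g (\<theta> * s, q)) + \<theta> * integral {0..1} (\<lambda>s. s * g1 (\<theta> * s, q))"
    using c[OF smooth_onD_continuous[OF g]] c[OF smooth_onD_continuous[OF *(2)]]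
    by (subst integral_add) (auto intro!: integrable_continuous_real continuous_intros)
  ultimately show "((\<lambda>\<theta>. \<theta> * integral {0..1} (\<lambda>s. g (\<theta> * s, q))) has_real_derivative g (\<theta>, q)) (at \<theta>)"
    using D by simp
qed

section \<open>Smoothness of inverse functions\<close>

text \<open>The inverse function theorem for the map from (\<theta>, q) to (F(\<theta>, q), q) makes
  \<open>T\<close> differentiable, with partial derivatives 1 / f1 and - f2 / f1 taken at (T, q).
  These are smooth functions composed with \<open>T\<close> itself, so class C^n of \<open>T\<close>
  improves to the next class.\<close>

lemma smooth_on_partial_inverse:
  fixes F T :: "real \<times> real \<Rightarrow> real"
  assumes U: "open U" and F: "smooth_on U F"
    and F1: "\<And>\<theta> q. (\<theta>, q) \<in> U \<Longrightarrow> \<exists>d>0. ((\<lambda>\<theta>. F (\<theta>, q)) has_real_derivative d) (at \<theta>)"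
    and FT: "\<And>y q. (y, q) \<in> W \<Longrightarrow> (T (y, q), q) \<in> U \<and> F (T (y, q), q) = y"
    and TF: "\<And>\<theta> q. (\<theta>, q) \<in> U \<Longrightarrow> T (F (\<theta>, q), q) = \<theta>"
  shows "smooth_on W T"
proof -
  obtain f1 f2 where f: "\<forall>p\<in>U. (F has_derivative (\<lambda>v. f1 p * fst v + f2 p * snd v)) (at p)"
      "smooth_on U f1" "smooth_on U f2"
    using smooth_on_gradient[OF U F] by blast
  have pos: "0 < f1 p" if p: "p \<in> U" for p
  proof -
    obtain \<theta> q where [simp]: "p = (\<theta>, q)" by (cases p)
    have "((\<lambda>\<theta>. F (\<theta>, q)) has_real_derivative f1 p) (at \<theta>)"
      using has_derivative_imp_partials(1)[of F "f1 p" "f2 p" \<theta> q] bspec[OF f(1) p] by simp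
    then show ?thesis using F1[of \<theta> q] p DERIV_unique by fastforce
  qed
  have der: "(T has_derivative (\<lambda>v. 1 / f1 (T p, snd p) * fst v + (0 - f2 (T p, snd p) / f1 (T p, snd p)) * snd v)) (at p)"
    if p: "p \<in> W" for p
  proof -
    obtain y q where pq: "p = (y, q)" by (cases p)
    let ?P = "(T p, snd p)"
    have P: "?P \<in> U" "F ?P = y" using FT[of y q] p pq by auto
    have "((\<lambda>p. (T p, snd p)) has_derivative (\<lambda>v. ((fst v - f2 ?P * snd v) / f1 ?P, snd v))) (at p)"
    proof (rule has_derivative_inverse_strong_x[OF U, where f = "\<lambda>p. (F p, snd p)"])
      show "continuous_on U (\<lambda>p. (F p, snd p))"
        by (intro continuous_intros smooth_onD_continuous F)
      show "((\<lambda>p. (F p, snd p)) has_derivative (\<lambda>v. (f1 ?P * fst v + f2 ?P * snd v, snd v))) (at ?P)"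
        by (intro has_derivative_Pair bspec[OF f(1)] P has_derivative_snd has_derivative_ident)
      show "(\<lambda>v. (f1 ?P * fst v + f2 ?P * snd v, snd v)) \<circ> (\<lambda>v. ((fst v - f2 ?P * snd v) / f1 ?P, snd v)) = id"
        using pos[OF P(1)] by (auto simp: fun_eq_iff)
    qed (use P TF pq in auto)
    from has_derivative_fst[OF this] show ?thesis
      by (simp add: diff_divide_distrib)
  qed
  have s: "smooth_on U (\<lambda>p. 1 / f1 p)" "smooth_on U (\<lambda>p. 0 - f2 p / f1 p)"
    by (rule smooth_on_divide[OF U smooth_on_const f(2) pos], assumption)
      (rule smooth_on_diff[OF smooth_on_const smooth_on_divide[OF U f(3) f(2) pos]], assumption)
  have "Ck_on n W T" for n
  proof (induction n)
    case 0
    show ?case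
      unfolding Ck_on.simps
      by (intro continuous_at_imp_continuous_on ballI) (rule has_derivative_continuous[OF der])
  next
    case (Suc n)
    have "Ck_on n W snd" by (simp add: Ck_on_bounded_linear bounded_linear_snd)
    then have comp: "Ck_on n W (\<lambda>p. g (T p, snd p))" if "smooth_on U g" for g
      using Suc that FT by (intro Ck_on_compose_Pair[of n U g]) (auto simp: smooth_on_def)
    show ?case
      by (rule Ck_on_SucI_prod[OF der comp[OF s(1)] comp[OF s(2)]])
  qed
  then show ?thesis by (simp add: smooth_on_def)
qed

lemma smooth_on_inverse:
  fixes f g :: "real \<Rightarrow> real"
  assumes S: "open S" and f: "smooth_on S f"
    and f1: "\<And>x. x \<in> S \<Longrightarrow> \<exists>d>0. (f has_real_derivative d) (at x)"
    and fg: "\<And>y. y \<in> T \<Longrightarrow> g y \<in> S \<and> f (g y) = y" and gf: "\<And>x. x \<in> S \<Longrightarrow> g (f x) = x"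
  shows "smooth_on T g"
proof -
  \<comment> \<open>A dummy second variable reduces the one-variable statement to the parametrised
    one.\<close>
  have "smooth_on (T \<times> (UNIV :: real set)) (\<lambda>p. g (fst p))"
  proof (rule smooth_on_partial_inverse[where U = "S \<times> UNIV" and F = "\<lambda>p. f (fst p)" and T = "\<lambda>p. g (fst p)"])
    show "smooth_on (S \<times> UNIV) (\<lambda>p. f (fst p))" by (rule smooth_on_compose[OF f smooth_on_fst]) auto
  qed (use S f1 fg gf in \<open>auto intro: open_Times\<close>)
  from smooth_on_compose_Pair[OF this smooth_on_id smooth_on_const[of _ 0], of T]
  show ?thesis by simp
qed

section \<open>Weak derivatives and traces\<close>

lemma borel_measurable_lebesgue_continuous:
  fixes f :: "real \<Rightarrow> 'b::real_normed_vector"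
  assumes "continuous_on UNIV f"
  shows "f \<in> borel_measurable lebesgue"
  using assms by (intro measurable_completion) (simp add: borel_measurable_continuous_onI)

lemma set_borel_measurable_lebesgue_continuous:
  fixes f :: "real \<Rightarrow> 'b::{real_normed_vector, second_countable_topology}"
  assumes "continuous_on J f" "open J"
  shows "set_borel_measurable lebesgue J f"
  unfolding set_borel_measurable_def
  using borel_measurable_continuous_on_indicator[OF _ assms(1)] assms(2)
  by (intro measurable_completion) simp

lemma loc_integrable_on_continuous:
  assumes "continuous_on J f"
  shows "loc_integrable_on J f"
  unfolding loc_integrable_on_def
proof (intro allI impI)
  fix C assume C: "compact C \<and> C \<subseteq> J"
  then have "integrable lborel (\<lambda>x. indicator C x *\<^sub>R f x)"
    using assms by (intro borel_integrable_compact) (auto intro: continuous_on_subset)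
  then show "set_integrable lebesgue C f"
    unfolding set_integrable_def by (subst integrable_completion) auto
qed

lemma test_fun_onD:
  assumes "test_fun_on J t"
  shows "(t has_real_derivative deriv t x) (at x)" "continuous_on UNIV (deriv t)" "continuous_on UNIV t"
proof -
  obtain D where D: "\<And>x. (t has_vector_derivative D x) (at x)" "continuous_on UNIV D"
    using assms unfolding test_fun_on_def C1_differentiable_on_def by auto
  then have *: "(t has_real_derivative D x) (at x)" for x
    by (simp add: has_real_derivative_iff_has_vector_derivative)
  then have "deriv t = D" using DERIV_imp_deriv by blast
  with * D show "(t has_real_derivative deriv t x) (at x)" "continuous_on UNIV (deriv t)" by auto
  show "continuous_on UNIV t" using * DERIV_isCont continuous_at_imp_continuous_on by blast
qed

text \<open>The fundamental theorem of calculus wants an interval instead of a compact set, and the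
  hull of a compact subset stays inside the convex set \<open>J\<close>. The endpoints are limits of
  points outside the interval, so continuity makes \<open>t\<close> vanish there. If the compact set
  is empty, a single point of \<open>J\<close> serves as the interval.\<close>

lemma test_fun_on_interval:
  assumes "test_fun_on J t" "convex J" "J \<noteq> {}"
  obtains a b where "{a..b} \<subseteq> J" "a \<le> b" "t a = 0" "t b = 0"
    "\<And>x. x \<notin> {a..b} \<Longrightarrow> t x = 0" "\<And>x. x \<notin> {a..b} \<Longrightarrow> deriv t x = 0"
proof -
  obtain C where C: "compact C" "C \<subseteq> J" "\<And>x. x \<notin> C \<Longrightarrow> t x = 0"
    using assms(1) unfolding test_fun_on_def by auto
  have "\<exists>a b. {a..b} \<subseteq> J \<and> a \<le> b \<and> C \<subseteq> {a..b}"
  proof (cases "C = {}")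
    case True
    with assms(3) show ?thesis by (metis atLeastAtMost_singleton empty_subsetI insert_subset order_refl equals0I)
  next
    case False
    then have "Inf C \<in> C" "Sup C \<in> C"
      using C(1) by (auto intro!: closed_contains_Inf closed_contains_Sup compact_imp_closed
          bounded_imp_bdd_below bounded_imp_bdd_above compact_imp_bounded)
    moreover have "C \<subseteq> {Inf C..Sup C}"
      using C(1) by (auto intro!: cInf_lower cSup_upper
          bounded_imp_bdd_below bounded_imp_bdd_above compact_imp_bounded)
    moreover have "{Inf C..Sup C} \<subseteq> J"
      using calculation(1,2) C(2) assms(2) by (metis convex_contains_segment closed_segment_eq_real_ivl1 
          subset_iff atLeastatMost_empty_iff2 empty_iff)
    ultimately show ?thesis by (meson atLeastAtMost_iff subset_iff order_refl)
  qed
  then obtain a b where ab: "{a..b} \<subseteq> J" "a \<le> b" "C \<subseteq> {a..b}" by blast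
  have 0: "t x = 0" if "x \<notin> {a..b}" for x using C ab that by blast
  have cl: "t x = 0" if "x \<in> closure (- {a..b})" for x
    using continuous_constant_on_closure[OF continuous_on_subset[OF test_fun_onD(3)[OF assms(1)]] _ that] 0
    by simp
  have "a \<in> closure {..<a}" "b \<in> closure {b<..}" by auto
  moreover have "{..<a} \<subseteq> - {a..b}" "{b<..} \<subseteq> - {a..b}" by auto
  ultimately have "a \<in> closure (- {a..b})" "b \<in> closure (- {a..b})"
    using closure_mono by blast+
  then have "t a = 0" "t b = 0" using cl by auto
  moreover have "deriv t x = 0" if "x \<notin> {a..b}" for x
  proof -
    have "open (- {a..b})" by auto
    then have "(t has_real_derivative 0) (at x)"
      using that 0 by (intro has_field_derivative_transform_within_open[OF DERIV_const[of 0]]) auto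
    then show ?thesis by (rule DERIV_imp_deriv)
  qed
  ultimately show ?thesis by (intro that[OF ab(1,2) _ _ 0])
qed

text \<open>Integration by parts on a compact interval that carries \<open>t\<close>: the derivative
  of the product of \<open>t\<close> and \<open>f\<close> integrates to zero because
  \<open>t\<close> vanishes at both ends.\<close>

lemma has_weak_derivI:
  assumes "open J" "convex J" "J \<noteq> {}"
    and f: "\<And>x. x \<in> J \<Longrightarrow> (f has_vector_derivative g x) (at x)" and g: "continuous_on J g"
  shows "has_weak_deriv J f g"
  unfolding has_weak_deriv_def
proof (intro conjI allI impI)
  have cf: "continuous_on J f"
    using f has_vector_derivative_continuous continuous_at_imp_continuous_on by blast
  then show "loc_integrable_on J f" "loc_integrable_on J g"
    using g by (auto intro: loc_integrable_on_continuous)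
  fix t assume t: "test_fun_on J t"
  obtain a b where ab: "{a..b} \<subseteq> J" "a \<le> b" "t a = 0" "t b = 0"
    "\<And>x. x \<notin> {a..b} \<Longrightarrow> t x = 0" "\<And>x. x \<notin> {a..b} \<Longrightarrow> deriv t x = 0"
    using test_fun_on_interval[OF t assms(2,3)] by metis
  note td = test_fun_onD[OF t]
  have cont: "continuous_on {a..b} (\<lambda>x. deriv t x *\<^sub>R f x)" "continuous_on {a..b} (\<lambda>x. t x *\<^sub>R g x)"
    using cf g ab(1) td by (auto intro!: continuous_intros intro: continuous_on_subset)
  have restrict: "(LINT x:J|lebesgue. u x) = integral {a..b} u"
    if "\<And>x. x \<notin> {a..b} \<Longrightarrow> u x = 0" "continuous_on {a..b} u" for u :: "real \<Rightarrow> complex"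
  proof -
    have "(LINT x:J|lebesgue. u x) = (LINT x:{a..b}|lebesgue. u x)"
      unfolding set_lebesgue_integral_def using ab(1) that(1)
      by (intro Bochner_Integration.integral_cong) (auto simp: indicator_def)
    also have "\<dots> = integral {a..b} u"
      using that(2) absolutely_integrable_continuous_real[of a b u]
      by (intro set_lebesgue_integral_eq_integral(2))
    finally show ?thesis .
  qed
  have "((\<lambda>x. t x *\<^sub>R g x + deriv t x *\<^sub>R f x) has_integral (t b *\<^sub>R f b - t a *\<^sub>R f a)) {a..b}"
  proof (rule fundamental_theorem_of_calculus[OF ab(2)])
    fix x assume "x \<in> {a..b}"
    then have "((\<lambda>x. t x *\<^sub>R f x) has_vector_derivative t x *\<^sub>R g x + deriv t x *\<^sub>R f x) (at x)"
      using ab(1) by (intro has_vector_derivative_scaleR td f) auto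
    then show "((\<lambda>x. t x *\<^sub>R f x) has_vector_derivative t x *\<^sub>R g x + deriv t x *\<^sub>R f x) (at x within {a..b})"
      by (rule has_vector_derivative_at_within)
  qed
  then have "integral {a..b} (\<lambda>x. t x *\<^sub>R g x + deriv t x *\<^sub>R f x) = 0"
    using ab by (simp add: integral_unique)
  then have "integral {a..b} (\<lambda>x. t x *\<^sub>R g x) + integral {a..b} (\<lambda>x. deriv t x *\<^sub>R f x) = 0"
    using cont by (subst (asm) integral_add) (auto intro: integrable_continuous_real)
  moreover have "(LINT x:J|lebesgue. deriv t x *\<^sub>R f x) = integral {a..b} (\<lambda>x. deriv t x *\<^sub>R f x)"
    "(LINT x:J|lebesgue. t x *\<^sub>R g x) = integral {a..b} (\<lambda>x. t x *\<^sub>R g x)"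
    using ab cont by (auto intro!: restrict)
  ultimately show "(LINT x:J|lebesgue. deriv t x *\<^sub>R f x) = - (LINT x:J|lebesgue. t x *\<^sub>R g x)"
    by (simp add: eq_neg_iff_add_eq_0 add.commute)
qed

section \<open>The fundamental lemma of the calculus of variations\<close>

text \<open>The positive and negative parts of \<open>H\<close> are densities of two measures that
  agree, with finite values, on all rays. Rays determine such measures, so the densities coincide
  almost everywhere, and the two parts can be equal only where both vanish.\<close>

lemma AE_zero_if_integrals_zero_halfline:
  fixes H :: "real \<Rightarrow> real"
  assumes H: "integrable lborel H" and zero: "\<And>x. (LINT y:{x<..}|lborel. H y) = 0"
  shows "AE x in lborel. H x = 0"
proof -
  have Hm [measurable]: "H \<in> borel_measurable borel" using H by auto
  define P where "P = (\<lambda>y. max 0 (H y))"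
  define Q where "Q = (\<lambda>y. max 0 (- H y))"
  have PQ [measurable]: "P \<in> borel_measurable borel" "Q \<in> borel_measurable borel"
    unfolding P_def Q_def by auto
  have int: "integrable lborel P" "integrable lborel Q"
    unfolding P_def Q_def
    by (rule integrable_max[OF integrable_zero H])
       (rule integrable_max[OF integrable_zero Bochner_Integration.integrable_minus[OF H]])
  have ints: "integrable lborel (\<lambda>y. indicator {x<..} y * P y)" "integrable lborel (\<lambda>y. indicator {x<..} y * Q y)" for x
    using integrable_mult_indicator[of "{x<..}" lborel P] integrable_mult_indicator[of "{x<..}" lborel Q] int
    by simp_all
  have em: "emeasure (density lborel (\<lambda>y. ennreal (R y))) {x<..} = ennreal (LINT y|lborel. indicator {x<..} y * R y)"
    if [measurable]: "R \<in> borel_measurable borel" and "integrable lborel (\<lambda>y. indicator {x<..} y * R y)"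
      and "\<And>y. 0 \<le> R y" for R :: "real \<Rightarrow> real" and x
  proof -
    have "emeasure (density lborel (\<lambda>y. ennreal (R y))) {x<..}
        = (\<integral>\<^sup>+ y. ennreal (indicator {x<..} y * R y) \<partial>lborel)"
      by (subst emeasure_density) (auto intro!: nn_integral_cong borel_open simp: indicator_def)
    also have "\<dots> = ennreal (LINT y|lborel. indicator {x<..} y * R y)"
      using that by (intro nn_integral_eq_integral) auto
    finally show ?thesis .
  qed
  have "density lborel (\<lambda>y. ennreal (P y)) = density lborel (\<lambda>y. ennreal (Q y))"
  proof (rule measure_eqI_lessThan)
    fix x
    have pos: "0 \<le> P y" "0 \<le> Q y" for y by (auto simp: P_def Q_def)
    show "emeasure (density lborel (\<lambda>y. ennreal (P y))) {x<..} < \<infinity>"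
      using em[OF PQ(1) ints(1)] pos by simp
    have "indicator {x<..} y * P y - indicator {x<..} y * Q y = indicator {x<..} y * H y" for y
      by (auto simp: P_def Q_def indicator_def)
    then have "(LINT y|lborel. indicator {x<..} y * P y) - (LINT y|lborel. indicator {x<..} y * Q y) = 0"
      using zero[of x] Bochner_Integration.integral_diff[OF ints[of x]]
      unfolding set_lebesgue_integral_def by (simp add: mult.assoc)
    then show "emeasure (density lborel (\<lambda>y. ennreal (P y))) {x<..} = emeasure (density lborel (\<lambda>y. ennreal (Q y))) {x<..}"
      using em[OF PQ(1) ints(1)] em[OF PQ(2) ints(2)] pos by simp
  qed auto
  then have "AE x in lborel. ennreal (P x) = ennreal (Q x)"
    by (intro sigma_finite_measure.density_unique[OF sigma_finite_lborel]) auto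
  then show ?thesis
    by eventually_elim (auto simp: P_def Q_def max_def split: if_splits)
qed

text \<open>Test functions are only required to be C^1, so squared ramps are regular enough to build
  bumps from. At the kink the difference quotient is bounded by |h|.\<close>

lemma C1_ramp: "((\<lambda>x. (max 0 x)\<^sup>2) has_real_derivative 2 * max 0 x) (at x)"
proof -
  consider "x < 0" | "x = 0" | "x > 0" by linarith
  then show ?thesis
  proof cases
    case 1
    then show ?thesis
      using has_field_derivative_transform_within_open[of "\<lambda>_. 0" 0 x "{..<0}" "\<lambda>x. (max 0 x)\<^sup>2"] by simp
  next
    case 2
    have "((\<lambda>h. (max 0 h)\<^sup>2 / h) \<longlongrightarrow> 0) (at (0::real))"
    proof (rule Lim_null_comparison)
      show "\<forall>\<^sub>F h in at 0. norm ((max 0 h)\<^sup>2 / h) \<le> \<bar>h :: real\<bar>"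
        by (intro always_eventually) (auto simp: max_def power2_eq_square)
      show "((\<lambda>h. \<bar>h\<bar>) \<longlongrightarrow> 0) (at (0::real))" by (auto intro!: tendsto_eq_intros)
    qed
    then show ?thesis unfolding 2 by (simp add: DERIV_def)
  next
    case 3
    have "((\<lambda>x. x\<^sup>2) has_real_derivative 2 * x) (at x)" by (auto intro!: derivative_eq_intros)
    then have "((\<lambda>x. (max 0 x)\<^sup>2) has_real_derivative 2 * x) (at x)"
      using has_field_derivative_transform_within_open[of "\<lambda>x. x\<^sup>2" "2 * x" x "{0<..}" "\<lambda>x. (max 0 x)\<^sup>2"] 3 by simp
    then show ?thesis using 3 by simp
  qed
qed

definition bump :: "real \<Rightarrow> real \<Rightarrow> real \<Rightarrow> real" where
  "bump a b x = (max 0 (x - a))\<^sup>2 * (max 0 (b - x))\<^sup>2"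

lemma bump_pos_iff: "0 < bump a b x \<longleftrightarrow> x \<in> {a<..<b}"
  and bump_eq_0: "x \<notin> {a<..<b} \<Longrightarrow> bump a b x = 0"
  and bump_nonneg: "0 \<le> bump a b x"
  by (auto simp: bump_def zero_less_mult_iff max_def)

text \<open>For u \<ge> 0 the values n u / (1 + n u) lie in [0, 1) and tend to 1 if u > 0 and to 0
  if u = 0. Since the bump is positive exactly on the open interval, these test functions
  approximate its indicator.\<close>

lemma test_fun_on_bump:
  assumes "{a..b} \<subseteq> J"
  shows "test_fun_on J (\<lambda>x. real n * bump a b x / (1 + real n * bump a b x))"
proof -
  define B where "B x = 2 * max 0 (x - a) * (max 0 (b - x))\<^sup>2 - (max 0 (x - a))\<^sup>2 * (2 * max 0 (b - x))" for x
  have "(bump a b has_real_derivative B x) (at x)" for x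
  proof -
    have "((\<lambda>x. (max 0 (x - a))\<^sup>2) has_real_derivative (2 * max 0 (x - a)) * 1) (at x)"
      by (rule DERIV_chain2[OF C1_ramp]) (auto intro!: derivative_eq_intros)
    moreover have "((\<lambda>x. (max 0 (b - x))\<^sup>2) has_real_derivative (2 * max 0 (b - x)) * (-1)) (at x)"
      by (rule DERIV_chain2[OF C1_ramp]) (auto intro!: derivative_eq_intros)
    ultimately have "((\<lambda>x. (max 0 (x - a))\<^sup>2 * (max 0 (b - x))\<^sup>2) has_real_derivative B x) (at x)"
      by (rule DERIV_cong[OF DERIV_mult]) (simp add: B_def algebra_simps)
    then show ?thesis unfolding bump_def[abs_def] .
  qed
  note [derivative_intros] = DERIV_chain2[OF this]
  have pos: "1 + real n * bump a b x > 0" for x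
    using bump_nonneg[of a b x] by (simp add: add_pos_nonneg)
  have "((\<lambda>x. real n * bump a b x / (1 + real n * bump a b x)) has_real_derivative
      real n * B x / (1 + real n * bump a b x)\<^sup>2) (at x)" for x
    using pos[of x] by (auto intro!: derivative_eq_intros simp: field_simps power2_eq_square)
  moreover have "continuous_on UNIV (\<lambda>x. real n * B x / (1 + real n * bump a b x)\<^sup>2)"
    unfolding B_def bump_def
    by (intro continuous_intros ballI) (metis bump_def pos less_irrefl power_not_zero)
  ultimately have "(\<lambda>x. real n * bump a b x / (1 + real n * bump a b x)) C1_differentiable_on UNIV"
    unfolding C1_differentiable_on_def has_real_derivative_iff_has_vector_derivative
    by (intro exI[of _ "\<lambda>x. real n * B x / (1 + real n * bump a b x)\<^sup>2"]) simp
  moreover have "\<forall>x. x \<notin> {a..b} \<longrightarrow> real n * bump a b x / (1 + real n * bump a b x) = 0"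
    using bump_eq_0 by auto
  ultimately show ?thesis unfolding test_fun_on_def using assms by blast
qed

text \<open>Dominated convergence along the bump quotients, with the absolute value of
  \<open>h\<close> on the closed interval as majorant. The quotients vanish outside the interval, so
  \<open>J\<close> may be exchanged for it under the integral.\<close>

lemma integral_zero_of_test_funs:
  fixes h :: "real \<Rightarrow> real"
  assumes h: "set_integrable lebesgue {a..b} h" and ab: "{a..b} \<subseteq> J"
    and zero: "\<And>t. test_fun_on J t \<Longrightarrow> (LINT x:J|lebesgue. t x * h x) = 0"
  shows "(LINT x:{a<..<b}|lebesgue. h x) = 0"
proof -
  define t where "t n x = real n * bump a b x / (1 + real n * bump a b x)" for n x
  have tm [measurable]: "t n \<in> borel_measurable lebesgue" for n
    using test_fun_onD(3)[OF test_fun_on_bump[of a b UNIV]] unfolding t_def[abs_def]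
    by (intro borel_measurable_lebesgue_continuous) auto
  have hm [measurable]: "(\<lambda>x. indicator {a..b} x *\<^sub>R h x) \<in> borel_measurable lebesgue"
    using h unfolding set_integrable_def by auto
  have t01: "0 \<le> t n x" "t n x \<le> 1" for n x
    unfolding t_def using bump_nonneg[of a b x] by (auto simp: divide_simps add_pos_nonneg)
  have t_lim: "(\<lambda>n. t n x) \<longlonglongrightarrow> indicator {a<..<b} x" for x
  proof (cases "x \<in> {a<..<b}")
    case True
    then have u: "bump a b x > 0" by (simp add: bump_pos_iff)
    have "(\<lambda>n. 1 - inverse (1 + real n * bump a b x)) \<longlonglongrightarrow> 1 - 0"
      using u by (intro tendsto_intros tendsto_inverse_0_at_top filterlim_tendsto_add_at_top[OF tendsto_const]
           filterlim_at_top_mult_tendsto_pos[OF tendsto_const] filterlim_real_sequentially)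
    moreover have "1 - inverse (1 + real n * bump a b x) = t n x" for n
      using u by (simp add: t_def field_simps add_pos_nonneg add_nonneg_eq_0_iff)
    ultimately show ?thesis using True by simp
  qed (simp add: t_def bump_eq_0)
  have eq: "indicator J x *\<^sub>R (t n x * h x) = t n x * (indicator {a..b} x *\<^sub>R h x)" for n x
    using ab bump_eq_0[of x a b] by (auto simp: indicator_def t_def)
  have "(\<lambda>n. LINT x|lebesgue. t n x * (indicator {a..b} x *\<^sub>R h x))
      \<longlonglongrightarrow> (LINT x|lebesgue. indicator {a<..<b} x *\<^sub>R h x)"
  proof (rule integral_dominated_convergence[where w = "\<lambda>x. norm (indicator {a..b} x *\<^sub>R h x)"])
    have "(\<lambda>x. indicator {a<..<b} x *\<^sub>R (indicator {a..b} x *\<^sub>R h x)) \<in> borel_measurable lebesgue"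
      by (intro borel_measurable_scaleR borel_measurable_indicator hm) simp
    also have "(\<lambda>x. indicator {a<..<b} x *\<^sub>R (indicator {a..b} x *\<^sub>R h x)) = (\<lambda>x. indicator {a<..<b} x *\<^sub>R h x)"
      by (auto simp: indicator_def)
    finally show "(\<lambda>x. indicator {a<..<b} x *\<^sub>R h x) \<in> borel_measurable lebesgue" .
    show "integrable lebesgue (\<lambda>x. norm (indicator {a..b} x *\<^sub>R h x))"
      using h unfolding set_integrable_def by (rule integrable_norm)
    show "AE x in lebesgue. norm (t n x * (indicator {a..b} x *\<^sub>R h x)) \<le> norm (indicator {a..b} x *\<^sub>R h x)" for n
      using t01 by (intro always_eventually) (auto simp: abs_mult intro!: mult_left_le_one_le)
    show "AE x in lebesgue. (\<lambda>n. t n x * (indicator {a..b} x *\<^sub>R h x)) \<longlonglongrightarrow> indicator {a<..<b} x *\<^sub>R h x"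
    proof (intro always_eventually allI)
      fix x
      have "(\<lambda>n. t n x * (indicator {a..b} x *\<^sub>R h x)) \<longlonglongrightarrow> indicator {a<..<b} x * (indicator {a..b} x *\<^sub>R h x)"
        by (intro tendsto_intros t_lim)
      also have "indicator {a<..<b} x * (indicator {a..b} x *\<^sub>R h x) = indicator {a<..<b} x *\<^sub>R h x"
        by (auto simp: indicator_def)
      finally show "(\<lambda>n. t n x * (indicator {a..b} x *\<^sub>R h x)) \<longlonglongrightarrow> indicator {a<..<b} x *\<^sub>R h x" .
    qed
  qed measurable
  moreover have "(LINT x|lebesgue. t n x * (indicator {a..b} x *\<^sub>R h x)) = 0" for n
    using zero[OF test_fun_on_bump[OF ab, of n]]
    unfolding set_lebesgue_integral_def t_def[symmetric] eq .
  ultimately show ?thesis unfolding set_lebesgue_integral_def by (simp add: LIMSEQ_const_iff)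
qed

text \<open>All integrals of \<open>h\<close> over subintervals of a compact interval in
  \<open>J\<close> vanish, so the half-line lemma applies to \<open>h\<close> cut off to that
  interval. Countably many intervals with rational endpoints exhaust the open set \<open>J\<close>,
  and null sets survive a countable union.\<close>

lemma AE_zero_of_test_funs:
  fixes h :: "real \<Rightarrow> real"
  assumes h: "\<And>a b. {a..b} \<subseteq> J \<Longrightarrow> set_integrable lebesgue {a..b} h" and "open J"
    and zero: "\<And>t. test_fun_on J t \<Longrightarrow> (LINT x:J|lebesgue. t x * h x) = 0"
  shows "AE x in lebesgue. x \<in> J \<longrightarrow> h x = 0"
proof -
  have loc: "AE x in lebesgue. x \<in> {a<..<b} \<longrightarrow> h x = 0" if ab: "{a..b} \<subseteq> J" for a b
  proof -
    define H where "H x = indicator {a<..<b} x *\<^sub>R h x" for x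
    have "set_integrable lebesgue {a<..<b} h"
      by (rule set_integrable_subset[OF h[OF ab]]) auto
    then have Hint: "integrable lebesgue H" unfolding set_integrable_def H_def .
    \<comment> \<open>The half-line lemma lives on \<open>lborel\<close>, whereas \<open>H\<close>
      is only Lebesgue measurable, so a Borel representative takes its place.\<close>
    then obtain H' where H' [measurable]: "H' \<in> borel_measurable lborel" "AE x in lborel. H x = H' x"
      using completion_ex_borel_measurable_real by blast
    then have AE: "AE x in lebesgue. H x = H' x" by (simp add: AE_completion_iff)
    have H'm: "H' \<in> borel_measurable lebesgue" using H'(1) by (rule measurable_completion)
    have "integrable lebesgue H'"
      using Hint H'm AE integrable_cong_AE[of H lebesgue H'] by auto
    then have int: "integrable lborel H'" using H'(1) by (simp add: integrable_completion)
    have "(LINT y:{x<..}|lborel. H' y) = 0" for x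
    proof -
      have "(LINT y:{x<..}|lborel. H' y) = (LINT y:{x<..}|lebesgue. H' y)"
        unfolding set_lebesgue_integral_def by (subst integral_completion) auto
      also have "\<dots> = (LINT y:{x<..}|lebesgue. H y)"
        unfolding set_lebesgue_integral_def
      proof (rule integral_cong_AE)
        show "AE y in lebesgue. indicator {x<..} y *\<^sub>R H' y = indicator {x<..} y *\<^sub>R H y"
          using AE by eventually_elim simp
      qed (use Hint H'm in \<open>intro borel_measurable_scaleR borel_measurable_indicator; simp\<close>)+
      also have "\<dots> = (LINT y:{max a x<..<b}|lebesgue. h y)"
        unfolding set_lebesgue_integral_def H_def
        by (intro Bochner_Integration.integral_cong) (auto simp: indicator_def)
      also have "\<dots> = 0"
        using ab by (intro integral_zero_of_test_funs[OF h, where J = J] zero) auto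
      finally show ?thesis .
    qed
    then have "AE x in lborel. H' x = 0" by (rule AE_zero_if_integrals_zero_halfline[OF int])
    then have "AE x in lebesgue. H' x = 0" by (simp add: AE_completion_iff)
    with AE show ?thesis by eventually_elim (auto simp: H_def)
  qed
  define A where "A = {(a, b). a \<in> \<rat> \<and> b \<in> \<rat> \<and> {a..b} \<subseteq> J}"
  have "countable A"
    by (rule countable_subset[of _ "\<rat> \<times> \<rat>"]) (auto simp: A_def countable_rat)
  then have "AE x in lebesgue. \<forall>p\<in>A. x \<in> {fst p<..<snd p} \<longrightarrow> h x = 0"
    by (subst AE_ball_countable) (auto simp: A_def dest: loc)
  then show ?thesis
  proof eventually_elim
    case (elim x)
    show ?case
    proof
      assume "x \<in> J"
      then obtain e where e: "e > 0" "\<And>y. \<bar>y - x\<bar> < e \<Longrightarrow> y \<in> J"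
        using \<open>open J\<close> unfolding open_dist by (auto simp: dist_real_def)
      obtain a where a: "a \<in> \<rat>" "x - e < a" "a < x" using Rats_dense_in_real[of "x - e" x] e by auto
      obtain b where b: "b \<in> \<rat>" "x < b" "b < x + e" using Rats_dense_in_real[of x "x + e"] e by auto
      have "{a..b} \<subseteq> J" using a b by (auto intro!: e(2) simp: abs_if)
      then have "(a, b) \<in> A" using a b by (auto simp: A_def)
      then show "h x = 0" using elim a b by fastforce
    qed
  qed
qed

section \<open>Computing with chosen weak derivatives and traces\<close>

text \<open>The difference of two weak derivatives integrates to zero against every test function;
  the fundamental lemma is applied to its real and imaginary parts.\<close>

lemma weak_deriv_unique:
  assumes "open J" "has_weak_deriv J f g1" "has_weak_deriv J f g2"
  shows "AE x in lebesgue. x \<in> J \<longrightarrow> g1 x = g2 x"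
proof -
  define h where "h x = g1 x - g2 x" for x
  have int: "set_integrable lebesgue C g1" "set_integrable lebesgue C g2" if "compact C" "C \<subseteq> J" for C
    using assms that unfolding has_weak_deriv_def loc_integrable_on_def by auto
  have hC: "set_integrable lebesgue C h" if "compact C" "C \<subseteq> J" for C
    unfolding h_def using int that by (auto intro!: set_integral_diff)
  have zero: "(LINT x:J|lebesgue. t x *\<^sub>R h x) = 0" "set_integrable lebesgue J (\<lambda>x. t x *\<^sub>R h x)"
    if t: "test_fun_on J t" for t
  proof -
    obtain C where C: "compact C" "C \<subseteq> J" "\<And>x. x \<notin> C \<Longrightarrow> t x = 0"
      using t unfolding test_fun_on_def by auto
    \<comment> \<open>A test function is bounded on a compact set that carries it, so its product
      with a locally integrable function is integrable. Only then may the two integrals be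
      subtracted.\<close>
    have ti: "set_integrable lebesgue J (\<lambda>x. t x *\<^sub>R g x)" if g: "set_integrable lebesgue C g" for g :: "real \<Rightarrow> complex"
    proof -
      have "compact (t ` C)"
        using C(1) test_fun_onD(3)[OF t] by (intro compact_continuous_image) (auto intro: continuous_on_subset)
      then obtain B where B: "\<And>x. x \<in> C \<Longrightarrow> \<bar>t x\<bar> \<le> B"
        by (metis compact_imp_bounded bounded_iff imageI real_norm_def)
      have tm: "t \<in> borel_measurable lebesgue"
        by (intro borel_measurable_lebesgue_continuous test_fun_onD(3)[OF t])
      have "integrable lebesgue (\<lambda>x. t x *\<^sub>R (indicator C x *\<^sub>R g x))"
      proof (rule Bochner_Integration.integrable_bound)
        show "integrable lebesgue (\<lambda>x. B *\<^sub>R (indicator C x *\<^sub>R g x))"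
          using g unfolding set_integrable_def by (intro integrable_scaleR_right) auto
        show "(\<lambda>x. t x *\<^sub>R (indicator C x *\<^sub>R g x)) \<in> borel_measurable lebesgue"
          using borel_measurable_integrable[OF g[unfolded set_integrable_def]]
          by (rule borel_measurable_scaleR[OF tm])
        have "norm (t x *\<^sub>R (indicator C x *\<^sub>R g x)) \<le> norm (B *\<^sub>R (indicator C x *\<^sub>R g x))" for x
          using B[of x] by (auto simp: indicator_def intro!: mult_right_mono)
        then show "AE x in lebesgue. norm (t x *\<^sub>R (indicator C x *\<^sub>R g x)) \<le> norm (B *\<^sub>R (indicator C x *\<^sub>R g x))"
          by simp
      qed
      also have "(\<lambda>x. t x *\<^sub>R (indicator C x *\<^sub>R g x)) = (\<lambda>x. indicator J x *\<^sub>R (t x *\<^sub>R g x))"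
        using C by (auto simp: indicator_def fun_eq_iff)
      finally show ?thesis unfolding set_integrable_def .
    qed
    note t12 = ti[OF int(1)[OF C(1,2)]] ti[OF int(2)[OF C(1,2)]]
    show "set_integrable lebesgue J (\<lambda>x. t x *\<^sub>R h x)" using hC[OF C(1,2)] by (rule ti)
    have "(LINT x:J|lebesgue. t x *\<^sub>R g1 x) = (LINT x:J|lebesgue. t x *\<^sub>R g2 x)"
    proof -
      have "(LINT x:J|lebesgue. deriv t x *\<^sub>R f x) = - (LINT x:J|lebesgue. t x *\<^sub>R g x)"
        if "has_weak_deriv J f g" for g
        using that t unfolding has_weak_deriv_def by blast
      from this[OF assms(2)] this[OF assms(3)] show ?thesis by (simp only: neg_equal_iff_equal)
    qed
    then show "(LINT x:J|lebesgue. t x *\<^sub>R h x) = 0"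
      using set_integral_diff(2)[OF t12] by (simp add: h_def scaleR_diff_right)
  qed
  have "AE x in lebesgue. x \<in> J \<longrightarrow> Re (h x) = 0"
  proof (rule AE_zero_of_test_funs[OF _ assms(1)])
    show "set_integrable lebesgue {a..b} (\<lambda>x. Re (h x))" if "{a..b} \<subseteq> J" for a b
      using integrable_Re[OF hC[OF _ that, unfolded set_integrable_def]] by (simp add: set_integrable_def)
    show "(LINT x:J|lebesgue. t x * Re (h x)) = 0" if "test_fun_on J t" for t
      using integral_Re[OF zero(2)[OF that, unfolded set_integrable_def]] zero(1)[OF that]
      unfolding set_lebesgue_integral_def by (simp add: mult.assoc)
  qed
  moreover have "AE x in lebesgue. x \<in> J \<longrightarrow> Im (h x) = 0"
  proof (rule AE_zero_of_test_funs[OF _ assms(1)])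
    show "set_integrable lebesgue {a..b} (\<lambda>x. Im (h x))" if "{a..b} \<subseteq> J" for a b
      using integrable_Im[OF hC[OF _ that, unfolded set_integrable_def]] by (simp add: set_integrable_def)
    show "(LINT x:J|lebesgue. t x * Im (h x)) = 0" if "test_fun_on J t" for t
      using integral_Im[OF zero(2)[OF that, unfolded set_integrable_def]] zero(1)[OF that]
      unfolding set_lebesgue_integral_def by (simp add: mult.assoc)
  qed
  ultimately show ?thesis by eventually_elim (auto simp: h_def complex_eq_iff)
qed

text \<open>\<open>weak_deriv\<close> is an arbitrary choice, so equality almost everywhere is all
  that can be known of it. This is enough for \<open>H1_norm\<close> and, through continuous
  representatives, for \<open>trace_deriv_at\<close>.\<close>

lemma weak_deriv_AE:
  assumes "open J" "has_weak_deriv J f g"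
  shows "AE x in lebesgue. x \<in> J \<longrightarrow> weak_deriv J f x = g x"
proof -
  have "has_weak_deriv J f (weak_deriv J f)"
    unfolding weak_deriv_def using someI[of "\<lambda>g. has_weak_deriv J f g" g] assms(2) by simp
  then show ?thesis using weak_deriv_unique assms by blast
qed

text \<open>Two continuous representatives differ on an open subset of \<open>J\<close> of measure
  zero, which must be empty. Continuity carries the equality from \<open>J\<close> to its closure
  and so to \<open>c\<close>.\<close>

lemma trace_at_eq:
  assumes "open J" "c \<in> closure J" "continuous_on (closure J) g"
    and "AE x in lebesgue. x \<in> J \<longrightarrow> f x = g x"
  shows "trace_at J f c = g c"
proof -
  define g' where "g' = trace_at J f"
  have "AE x in lebesgue. x \<in> J \<longrightarrow> g x = f x" using assms(4) by eventually_elim auto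
  then have g': "continuous_on (closure J) g'" "AE x in lebesgue. x \<in> J \<longrightarrow> g' x = f x"
    unfolding g'_def trace_at_def
    using someI[of "\<lambda>g. continuous_on (closure J) g \<and> (AE x in lebesgue. x \<in> J \<longrightarrow> g x = f x)" g] assms(3)
    by auto
  define d where "d x = g' x - g x" for x
  have d: "continuous_on (closure J) d" unfolding d_def using g'(1) assms(3) by (intro continuous_intros)
  have "AE x in lebesgue. x \<in> J \<longrightarrow> d x = 0"
    using g'(2) assms(4) by eventually_elim (auto simp: d_def)
  then have "AE x in lebesgue. x \<notin> J \<inter> d -` (- {0})" by eventually_elim auto
  then have "negligible (J \<inter> d -` (- {0}))"
    using AE_iff_null_sets
    by (auto simp: eventually_ae_filter negligible_iff_null_sets intro: null_sets_completion_subset)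
  moreover have "open (J \<inter> d -` (- {0}))"
    using d closure_subset assms(1) by (intro continuous_open_preimage) (auto intro: continuous_on_subset)
  ultimately have "J \<inter> d -` (- {0}) = {}" using open_not_negligible by blast
  then have "d c = 0"
    by (intro continuous_constant_on_closure[OF d _ assms(2)]) auto
  then show ?thesis by (simp add: d_def g'_def)
qed

lemma L2_on_dominated:
  assumes "open J" "continuous_on J f" "set_integrable lebesgue J (\<lambda>x. (M x :: real)\<^sup>2)"
    and "\<And>x. x \<in> J \<Longrightarrow> norm (f x) \<le> M x"
  shows "f \<in> L2_on J"
  unfolding L2_on_def
proof (intro CollectI conjI)
  show "set_borel_measurable lebesgue J f"
    using set_borel_measurable_lebesgue_continuous assms by blast
  show "set_integrable lebesgue J (\<lambda>x. (norm (f x))\<^sup>2)"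
  proof (rule set_integrable_bound[OF assms(3)])
    show "set_borel_measurable lebesgue J (\<lambda>x. (norm (f x))\<^sup>2)"
      using assms by (intro set_borel_measurable_lebesgue_continuous continuous_intros)
    show "AE x in lebesgue. x \<in> J \<longrightarrow> norm ((norm (f x))\<^sup>2) \<le> norm ((M x)\<^sup>2)"
      using assms(4) by (intro always_eventually) (auto intro!: power_mono)
  qed
qed

lemma H1_norm_nonneg: "0 \<le> H1_norm J f"
  unfolding H1_norm_def by (auto intro!: add_nonneg_nonneg Bochner_Integration.integral_nonneg simp: set_lebesgue_integral_def)

text \<open>Meant for the error of a difference quotient, with \<open>e\<close> the distance of two
  frequencies and \<open>M\<close> a majorant independent of it. The 2 under the root counts the
  function and its derivative.\<close>

lemma H1_norm_le:
  assumes J: "open J" "convex J" "J \<noteq> {}"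
    and f: "\<And>x. x \<in> J \<Longrightarrow> (f has_vector_derivative g x) (at x)" and g: "continuous_on J g"
    and M: "set_integrable lebesgue J (\<lambda>x. (M x :: real)\<^sup>2)"
    and bound: "\<And>x. x \<in> J \<Longrightarrow> norm (f x) \<le> e * M x" "\<And>x. x \<in> J \<Longrightarrow> norm (g x) \<le> e * M x"
    and e: "0 \<le> e"
  shows "H1_norm J f \<le> e * sqrt (2 * (LINT x:J|lebesgue. (M x)\<^sup>2))"
proof -
  have AE: "AE x in lebesgue. x \<in> J \<longrightarrow> weak_deriv J f x = g x"
    by (intro weak_deriv_AE J has_weak_derivI f g)
  have eM: "integrable lebesgue (\<lambda>x. e\<^sup>2 * (indicator J x *\<^sub>R (M x)\<^sup>2))"
    using M unfolding set_integrable_def by (intro integrable_mult_right) auto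
  have le: "(LINT x:J|lebesgue. (norm (u x))\<^sup>2) \<le> e\<^sup>2 * (LINT x:J|lebesgue. (M x)\<^sup>2)"
    if "AE x in lebesgue. x \<in> J \<longrightarrow> norm (u x) \<le> e * M x" for u :: "real \<Rightarrow> complex"
  proof -
    have "(LINT x:J|lebesgue. (norm (u x))\<^sup>2) \<le> (LINT x|lebesgue. e\<^sup>2 * (indicator J x *\<^sub>R (M x)\<^sup>2))"
      unfolding set_lebesgue_integral_def
    proof (rule integral_mono_AE'[OF eM])
      show "AE x in lebesgue. indicator J x *\<^sub>R (norm (u x))\<^sup>2 \<le> e\<^sup>2 * (indicator J x *\<^sub>R (M x)\<^sup>2)"
        using that
      proof eventually_elim
        case (elim x)
        then show ?case
          by (auto simp: indicator_def power_mult_distrib[symmetric] intro!: power_mono)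
      qed
    qed auto
    then show ?thesis by (simp add: set_lebesgue_integral_def)
  qed
  have 1: "(LINT x:J|lebesgue. (norm (f x))\<^sup>2) \<le> e\<^sup>2 * (LINT x:J|lebesgue. (M x)\<^sup>2)"
    using bound by (intro le) auto
  have 2: "(LINT x:J|lebesgue. (norm (weak_deriv J f x))\<^sup>2) \<le> e\<^sup>2 * (LINT x:J|lebesgue. (M x)\<^sup>2)"
  proof (rule le)
    show "AE x in lebesgue. x \<in> J \<longrightarrow> norm (weak_deriv J f x) \<le> e * M x"
      using AE by eventually_elim (auto simp: bound)
  qed
  have "H1_norm J f \<le> sqrt (e\<^sup>2 * (2 * (LINT x:J|lebesgue. (M x)\<^sup>2)))"
    unfolding H1_norm_def by (rule real_sqrt_le_mono) (use 1 2 in linarith)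
  also have "\<dots> = e * sqrt (2 * (LINT x:J|lebesgue. (M x)\<^sup>2))"
    using e by (simp add: real_sqrt_mult)
  finally show ?thesis .
qed

section \<open>Differentiability as a map into the Sobolev space\<close>

text \<open>A parametrised family \<open>f \<omega> x\<close> in such a class is differentiable in \<open>\<omega>\<close> as a map into \<open>H\<^sup>1(J)\<close>,
  with derivative again in the class: the domination of \<open>\<partial>\<^sub>\<omega>\<^sup>2 f\<close> controls the difference quotient.\<close>

definition dominated_class :: "real set \<Rightarrow> real set \<Rightarrow> (real \<Rightarrow> real \<Rightarrow> real) set \<Rightarrow> bool" where
  "dominated_class S J \<C> \<longleftrightarrow> (\<forall>f\<in>\<C>.
     continuous_on (S \<times> UNIV) (\<lambda>(\<omega>, x). f \<omega> x) \<and>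
     (\<exists>g\<in>\<C>. \<forall>\<omega>\<in>S. \<forall>x. ((\<lambda>\<nu>. f \<nu> x) has_real_derivative g \<omega> x) (at \<omega>)) \<and>
     (\<exists>g\<in>\<C>. \<forall>\<omega>\<in>S. \<forall>x. (f \<omega> has_real_derivative g \<omega> x) (at x)) \<and>
     (\<forall>\<omega>\<in>S. \<exists>\<delta>>0. \<exists>M. ball \<omega> \<delta> \<subseteq> S \<and> set_integrable lebesgue J (\<lambda>x. (M x)\<^sup>2) \<and>
        (\<forall>\<nu>\<in>ball \<omega> \<delta>. \<forall>x\<in>J. \<bar>f \<nu> x\<bar> \<le> M x)))"

text \<open>Write f(y) - f(a) as the integral of \<open>fx\<close>, differentiate under the integral
  sign in the parameter, and recover the derivative in y from the fundamental theorem.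
  Differentiability of \<open>fw\<close> in x is thus part of the conclusion.\<close>

lemma mixed_partial_swap:
  fixes f :: "real \<Rightarrow> real \<Rightarrow> real"
  assumes S: "open S" "\<omega> \<in> S"
    and fw: "\<And>\<omega> x. \<omega> \<in> S \<Longrightarrow> ((\<lambda>\<nu>. f \<nu> x) has_real_derivative fw \<omega> x) (at \<omega>)"
    and fx: "\<And>\<omega> x. \<omega> \<in> S \<Longrightarrow> (f \<omega> has_real_derivative fx \<omega> x) (at x)"
    and fxw: "\<And>\<omega> x. \<omega> \<in> S \<Longrightarrow> ((\<lambda>\<nu>. fx \<nu> x) has_real_derivative fxw \<omega> x) (at \<omega>)"
    and cfx: "continuous_on (S \<times> UNIV) (\<lambda>(\<omega>, x). fx \<omega> x)"
    and cfxw: "continuous_on (S \<times> UNIV) (\<lambda>(\<omega>, x). fxw \<omega> x)"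
  shows "(fw \<omega> has_real_derivative fxw \<omega> x) (at x)"
proof -
  obtain d where d: "d > 0" "ball \<omega> d \<subseteq> S" using S openE by blast
  \<comment> \<open>Any base point to the left of x would do; it makes x an interior point of the
    interval on which \<open>eq\<close> holds.\<close>
  define a where "a = x - 1"
  have csec: "continuous_on A (\<lambda>y. g \<nu> y)" if "\<nu> \<in> S" "continuous_on (S \<times> UNIV) (\<lambda>(\<omega>, x). g \<omega> x)"
    for A \<nu> and g :: "real \<Rightarrow> real \<Rightarrow> real"
    using continuous_on_compose2[OF that(2) continuous_on_Pair[OF continuous_on_const[of A \<nu>] continuous_on_id]] that(1)
    by auto
  have eq: "fw \<omega> y = fw \<omega> a + integral {a..y} (fxw \<omega>)" if y: "y \<in> {a..x + 1}" for y
  proof -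
    have ftc: "integral {a..y} (fx \<nu>) = f \<nu> y - f \<nu> a" if "\<nu> \<in> S" for \<nu>
    proof (intro integral_unique fundamental_theorem_of_calculus)
      show "a \<le> y" using y by auto
      show "(f \<nu> has_vector_derivative fx \<nu> z) (at z within {a..y})" for z
        using fx[OF that, of z] by (simp add: has_real_derivative_iff_has_vector_derivative has_vector_derivative_at_within)
    qed
    have "((\<lambda>\<nu>. integral (cbox a y) (fx \<nu>)) has_real_derivative integral (cbox a y) (fxw \<omega>)) (at \<omega> within ball \<omega> d)"
    proof (rule leibniz_rule_field_derivative)
      show "((\<lambda>\<nu>. fx \<nu> t) has_real_derivative fxw \<nu> t) (at \<nu> within ball \<omega> d)" if "\<nu> \<in> ball \<omega> d" for \<nu> t
        using fxw d that by (blast intro: has_field_derivative_at_within)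
      show "fx \<nu> integrable_on cbox a y" if "\<nu> \<in> ball \<omega> d" for \<nu>
        using csec[OF _ cfx] d that by (auto intro!: integrable_continuous_real)
      show "continuous_on (ball \<omega> d \<times> cbox a y) (\<lambda>(x, t). fxw x t)"
        by (rule continuous_on_subset[OF cfxw]) (use d in auto)
    qed (use d in auto)
    then have 1: "((\<lambda>\<nu>. integral {a..y} (fx \<nu>)) has_real_derivative integral {a..y} (fxw \<omega>)) (at \<omega>)"
      using d by (simp add: at_within_open[of _ "ball \<omega> d"])
    have "((\<lambda>\<nu>. f \<nu> y - f \<nu> a) has_real_derivative integral {a..y} (fxw \<omega>)) (at \<omega>)"
      by (rule has_field_derivative_transform_within_open[OF 1 S]) (rule ftc)
    moreover have "((\<lambda>\<nu>. f \<nu> y - f \<nu> a) has_real_derivative fw \<omega> y - fw \<omega> a) (at \<omega>)"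
      by (intro DERIV_diff fw S)
    ultimately show ?thesis using DERIV_unique by fastforce
  qed
  have "((\<lambda>y. integral {a..y} (fxw \<omega>)) has_real_derivative fxw \<omega> x) (at x within {a..x + 1})"
    by (rule integral_has_real_derivative[OF csec[OF S(2) cfxw]]) (simp add: a_def)
  then have "((\<lambda>y. integral {a..y} (fxw \<omega>)) has_real_derivative fxw \<omega> x) (at x within {a<..<x + 1})"
    by (rule DERIV_subset) auto
  then have "((\<lambda>y. integral {a..y} (fxw \<omega>)) has_real_derivative fxw \<omega> x) (at x)"
    by (subst (asm) at_within_open) (auto simp: a_def)
  then have 2: "((\<lambda>y. fw \<omega> a + integral {a..y} (fxw \<omega>)) has_real_derivative fxw \<omega> x) (at x)"
    by (auto intro!: derivative_eq_intros)
  show ?thesis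
  proof (rule has_field_derivative_transform_within_open[OF 2, of "{a<..<x + 1}"])
    show "fw \<omega> a + integral {a..y} (fxw \<omega>) = fw \<omega> y" if "y \<in> {a<..<x + 1}" for y
      using that by (intro eq[symmetric]) auto
  qed (auto simp: a_def)
qed

text \<open>The mean value estimate is used twice on the segment from w to m: on \<open>f1\<close>,
  which gives |f1 z - f1 w| \<le> B |m - w|, and then on f(z) - f1(w) z, whose derivative is this
  very difference.\<close>

lemma taylor_quotient_bound:
  fixes f f1 f2 :: "real \<Rightarrow> real"
  assumes d1: "\<And>z. z \<in> ball w d \<Longrightarrow> (f has_real_derivative f1 z) (at z)"
    and d2: "\<And>z. z \<in> ball w d \<Longrightarrow> (f1 has_real_derivative f2 z) (at z)"
    and b: "\<And>z. z \<in> ball w d \<Longrightarrow> \<bar>f2 z\<bar> \<le> B" and m: "m \<in> ball w d" "m \<noteq> w"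
  shows "\<bar>(f m - f w) / (m - w) - f1 w\<bar> \<le> \<bar>m - w\<bar> * B"
proof -
  define K where "K = closed_segment w m"
  have w: "w \<in> ball w d" using m by (metis centre_in_ball ball_eq_empty empty_iff not_le)
  then have K: "K \<subseteq> ball w d" "convex K" "w \<in> K" "m \<in> K"
    unfolding K_def using m by (auto simp: closed_segment_subset simp del: mem_ball)
  have "norm (f1 z - f1 w) \<le> B * norm (z - w)" if "z \<in> K" for z
  proof (rule field_differentiable_bound[OF K(2)])
    show "(f1 has_real_derivative f2 y) (at y within K)" if "y \<in> K" for y
      using d2 K that by (blast intro: has_field_derivative_at_within)
    show "norm (f2 y) \<le> B" if "y \<in> K" for y using b K that by auto
  qed (use that K in auto)
  moreover have "norm (z - w) \<le> norm (m - w)" if "z \<in> K" for z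
    using segment_bound1[of z w m] that by (simp add: K_def)
  moreover have "0 \<le> B" using b[OF w] by linarith
  ultimately have le: "norm (f1 z - f1 w) \<le> B * norm (m - w)" if "z \<in> K" for z
    using order_trans[OF _ mult_left_mono] that by blast
  have "norm ((f m - f1 w * m) - (f w - f1 w * w)) \<le> (B * norm (m - w)) * norm (m - w)"
  proof (rule field_differentiable_bound[OF K(2), where f = "\<lambda>z. f z - f1 w * z" and f' = "\<lambda>z. f1 z - f1 w"])
    show "((\<lambda>y. f y - f1 w * y) has_real_derivative f1 y - f1 w) (at y within K)" if "y \<in> K" for y
    proof -
      have "(f has_real_derivative f1 y) (at y)" using d1 K(1) that by blast
      then have "((\<lambda>y. f y - f1 w * y) has_real_derivative f1 y - f1 w * 1) (at y)"
        by (intro DERIV_diff DERIV_cmult DERIV_ident)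
      then show ?thesis by (auto intro: has_field_derivative_at_within)
    qed
    show "norm (f1 z - f1 w) \<le> B * norm (m - w)" if "z \<in> K" for z using le[OF that] .
  qed (use K in auto)
  then have "\<bar>f m - f w - f1 w * (m - w)\<bar> \<le> (\<bar>m - w\<bar> * B) * \<bar>m - w\<bar>"
    by (simp add: algebra_simps)
  moreover have "(f m - f w) / (m - w) - f1 w = (f m - f w - f1 w * (m - w)) / (m - w)"
    using m by (simp add: diff_divide_distrib)
  ultimately show ?thesis using m by (simp add: divide_le_eq)
qed

context
  fixes S J :: "real set" and \<C>
  assumes S: "open S" and J: "open J" "convex J" "J \<noteq> {}" and C: "dominated_class S J \<C>"
begin

lemma dominated_class_continuous:
  assumes "f \<in> \<C>" shows "continuous_on (S \<times> UNIV) (\<lambda>(\<omega>, x). f \<omega> x)"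
  using C assms unfolding dominated_class_def by blast

lemma dominated_class_param_deriv:
  assumes "f \<in> \<C>"
  obtains g where "g \<in> \<C>" "\<And>\<omega> x. \<omega> \<in> S \<Longrightarrow> ((\<lambda>\<nu>. f \<nu> x) has_real_derivative g \<omega> x) (at \<omega>)"
  using C assms unfolding dominated_class_def by metis

lemma dominated_class_deriv:
  assumes "f \<in> \<C>"
  obtains g where "g \<in> \<C>" "\<And>\<omega> x. \<omega> \<in> S \<Longrightarrow> (f \<omega> has_real_derivative g \<omega> x) (at x)"
  using C assms unfolding dominated_class_def by metis

lemma dominated_class_bound:
  assumes "f \<in> \<C>" "\<omega> \<in> S"
  obtains d M where "d > 0" "ball \<omega> d \<subseteq> S" "set_integrable lebesgue J (\<lambda>x. (M x)\<^sup>2)"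
    "\<And>\<nu> x. \<nu> \<in> ball \<omega> d \<Longrightarrow> x \<in> J \<Longrightarrow> \<bar>f \<nu> x\<bar> \<le> M x"
  using C assms unfolding dominated_class_def by metis

lemma dominated_class_L2:
  assumes "f \<in> \<C>" "\<omega> \<in> S"
  shows "(\<lambda>x. of_real (f \<omega> x)) \<in> L2_on J" "continuous_on A (\<lambda>x. of_real (f \<omega> x) :: complex)"
proof -
  obtain d M where M: "d > 0" "set_integrable lebesgue J (\<lambda>x. (M x)\<^sup>2)"
    "\<And>\<nu> x. \<nu> \<in> ball \<omega> d \<Longrightarrow> x \<in> J \<Longrightarrow> \<bar>f \<nu> x\<bar> \<le> M x"
    using dominated_class_bound[OF assms] by metis
  have "continuous_on A (\<lambda>x. f \<omega> x)" for A
    using continuous_on_compose2[OF dominated_class_continuous[OF assms(1)]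
        continuous_on_Pair[OF continuous_on_const[of A \<omega>] continuous_on_id]] assms(2)
    by auto
  then show c: "continuous_on A (\<lambda>x. of_real (f \<omega> x) :: complex)" for A by (intro continuous_intros)
  show "(\<lambda>x. of_real (f \<omega> x)) \<in> L2_on J"
    by (rule L2_on_dominated[OF J(1) c M(2)]) (use M in auto)
qed

lemma has_weak_deriv_of_real:
  assumes "g \<in> \<C>" "\<omega> \<in> S" "\<And>x. (f \<omega> has_real_derivative g \<omega> x) (at x)"
  shows "has_weak_deriv J (\<lambda>x. of_real (f \<omega> x)) (\<lambda>x. of_real (g \<omega> x))"
  using dominated_class_L2(2)[OF assms(1,2)] assms(3)
  by (intro has_weak_derivI J has_vector_derivative_of_real)
     (auto simp: has_real_derivative_iff_has_vector_derivative)

lemma dominated_class_sobolev: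
  assumes "f \<in> \<C>" "\<omega> \<in> S"
  shows "(\<lambda>x. of_real (f \<omega> x)) \<in> sobolev n J"
  using assms(1)
proof (induction n arbitrary: f)
  case 0
  then show ?case using dominated_class_L2(1) assms(2) by simp
next
  case (Suc n)
  obtain g where g: "g \<in> \<C>" "\<And>\<omega> x. \<omega> \<in> S \<Longrightarrow> (f \<omega> has_real_derivative g \<omega> x) (at x)"
    using dominated_class_deriv[OF Suc.prems] by metis
  have "has_weak_deriv J (\<lambda>x. of_real (f \<omega> x)) (\<lambda>x. of_real (g \<omega> x))"
    using g assms(2) by (intro has_weak_deriv_of_real) auto
  then show ?case using Suc.IH[OF g(1)] dominated_class_L2(1)[OF Suc.prems assms(2)] by auto
qed

lemma dominated_class_H1_derivative:
  assumes f: "f \<in> \<C>" and g: "g \<in> \<C>" "\<And>\<omega> x. \<omega> \<in> S \<Longrightarrow> ((\<lambda>\<nu>. f \<nu> x) has_real_derivative g \<omega> x) (at \<omega>)"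
    and w: "\<omega> \<in> S"
  shows "((\<lambda>\<mu>. H1_norm J (\<lambda>x. (of_real (f \<mu> x) - of_real (f \<omega> x)) /\<^sub>R (\<mu> - \<omega>) - of_real (g \<omega> x))) \<longlongrightarrow> 0)
    (at \<omega> within S)"
proof -
  obtain fx where fx: "fx \<in> \<C>" "\<And>\<omega> x. \<omega> \<in> S \<Longrightarrow> (f \<omega> has_real_derivative fx \<omega> x) (at x)"
    using dominated_class_deriv[OF f] by metis
  obtain fxw where fxw: "fxw \<in> \<C>" "\<And>\<omega> x. \<omega> \<in> S \<Longrightarrow> ((\<lambda>\<nu>. fx \<nu> x) has_real_derivative fxw \<omega> x) (at \<omega>)"
    using dominated_class_param_deriv[OF fx(1)] by metis
  obtain fxww where fxww: "fxww \<in> \<C>" "\<And>\<omega> x. \<omega> \<in> S \<Longrightarrow> ((\<lambda>\<nu>. fxw \<nu> x) has_real_derivative fxww \<omega> x) (at \<omega>)"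
    using dominated_class_param_deriv[OF fxw(1)] by metis
  obtain fww where fww: "fww \<in> \<C>" "\<And>\<omega> x. \<omega> \<in> S \<Longrightarrow> ((\<lambda>\<nu>. g \<nu> x) has_real_derivative fww \<omega> x) (at \<omega>)"
    using dominated_class_param_deriv[OF g(1)] by metis
  \<comment> \<open>Hence the x-derivative of the difference-quotient error of \<open>f\<close> is
    the same error formed with \<open>fx\<close>, and one Taylor estimate serves both terms of the
    norm.\<close>
  have gx: "(g \<omega> has_real_derivative fxw \<omega> x) (at x)" for x
    by (rule mixed_partial_swap[OF S w g(2) fx(2) fxw(2) dominated_class_continuous[OF fx(1)]
          dominated_class_continuous[OF fxw(1)]])
  obtain d1 M1 where M1: "d1 > 0" "ball \<omega> d1 \<subseteq> S" "set_integrable lebesgue J (\<lambda>x. (M1 x)\<^sup>2)"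
    "\<And>\<nu> x. \<nu> \<in> ball \<omega> d1 \<Longrightarrow> x \<in> J \<Longrightarrow> \<bar>fww \<nu> x\<bar> \<le> M1 x"
    using dominated_class_bound[OF fww(1) w] by metis
  obtain d2 M2 where M2: "d2 > 0" "ball \<omega> d2 \<subseteq> S" "set_integrable lebesgue J (\<lambda>x. (M2 x)\<^sup>2)"
    "\<And>\<nu> x. \<nu> \<in> ball \<omega> d2 \<Longrightarrow> x \<in> J \<Longrightarrow> \<bar>fxww \<nu> x\<bar> \<le> M2 x"
    using dominated_class_bound[OF fxww(1) w] by metis
  define d where "d = min d1 d2"
  \<comment> \<open>A common majorant whose square is the sum of two integrable squares by
    construction.\<close>
  define M where "M x = sqrt ((M1 x)\<^sup>2 + (M2 x)\<^sup>2)" for x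
  have d: "d > 0" "ball \<omega> d \<subseteq> S" using M1 M2 by (auto simp: d_def)
  have Mint: "set_integrable lebesgue J (\<lambda>x. (M x)\<^sup>2)"
    unfolding M_def using set_integral_add(1)[OF M1(3) M2(3)] by simp
  have MM: "M1 x \<le> M x" "M2 x \<le> M x" for x
    unfolding M_def by (auto intro: real_le_rsqrt)
  define r where "r \<mu> x = (f \<mu> x - f \<omega> x) / (\<mu> - \<omega>) - g \<omega> x" for \<mu> x
  define r' where "r' \<mu> x = (fx \<mu> x - fx \<omega> x) / (\<mu> - \<omega>) - fxw \<omega> x" for \<mu> x
  have rr: "((of_real (f \<mu> x) - of_real (f \<omega> x)) /\<^sub>R (\<mu> - \<omega>) - of_real (g \<omega> x) :: complex) = of_real (r \<mu> x)" for \<mu> x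
    by (simp add: r_def scaleR_conv_of_real divide_inverse mult.commute)
  define c where "c = sqrt (2 * (LINT x:J|lebesgue. (M x)\<^sup>2))"
  have bound: "H1_norm J (\<lambda>x. of_real (r \<mu> x)) \<le> \<bar>\<mu> - \<omega>\<bar> * c" if \<mu>: "\<mu> \<in> ball \<omega> d" "\<mu> \<noteq> \<omega>" for \<mu>
    unfolding c_def
  proof (rule H1_norm_le[OF J _ _ Mint])
    have \<mu>S: "\<mu> \<in> S" using \<mu> d by auto
    have "(r \<mu> has_real_derivative r' \<mu> x) (at x)" for x
      unfolding r_def r'_def by (intro DERIV_diff DERIV_cdivide fx gx w \<mu>S)
    then show "((\<lambda>x. complex_of_real (r \<mu> x)) has_vector_derivative of_real (r' \<mu> x)) (at x)" for x
      by (intro has_vector_derivative_of_real) (simp add: has_real_derivative_iff_has_vector_derivative)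
    have "continuous_on J (\<lambda>x. (of_real (fx \<mu> x) - of_real (fx \<omega> x)) / of_real (\<mu> - \<omega>) - of_real (fxw \<omega> x) :: complex)"
      using \<mu> by (intro continuous_intros dominated_class_L2(2) fx(1) fxw(1) w \<mu>S) auto
    then show "continuous_on J (\<lambda>x. complex_of_real (r' \<mu> x))" by (simp add: r'_def)
    show "norm (complex_of_real (r \<mu> x)) \<le> \<bar>\<mu> - \<omega>\<bar> * M x" if x: "x \<in> J" for x
    proof -
      have "\<bar>r \<mu> x\<bar> \<le> \<bar>\<mu> - \<omega>\<bar> * M1 x"
        unfolding r_def using \<mu> d x
        by (intro taylor_quotient_bound[of \<omega> d _ _ "\<lambda>\<nu>. fww \<nu> x"] g fww M1) (auto simp: d_def)
      also have "\<dots> \<le> \<bar>\<mu> - \<omega>\<bar> * M x" using MM by (intro mult_left_mono) auto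
      finally show ?thesis by simp
    qed
    show "norm (complex_of_real (r' \<mu> x)) \<le> \<bar>\<mu> - \<omega>\<bar> * M x" if x: "x \<in> J" for x
    proof -
      have "\<bar>r' \<mu> x\<bar> \<le> \<bar>\<mu> - \<omega>\<bar> * M2 x"
        unfolding r'_def using \<mu> d x
        by (intro taylor_quotient_bound[of \<omega> d _ _ "\<lambda>\<nu>. fxww \<nu> x"] fxw fxww M2) (auto simp: d_def)
      also have "\<dots> \<le> \<bar>\<mu> - \<omega>\<bar> * M x" using MM by (intro mult_left_mono) auto
      finally show ?thesis by simp
    qed
  qed auto
  have "((\<lambda>\<mu>. \<bar>\<mu> - \<omega>\<bar> * c) \<longlongrightarrow> 0) (at \<omega> within S)"
    by (auto intro!: tendsto_eq_intros)
  moreover have "\<forall>\<^sub>F \<mu> in at \<omega> within S. norm (H1_norm J (\<lambda>x. of_real (r \<mu> x))) \<le> \<bar>\<mu> - \<omega>\<bar> * c"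
    unfolding eventually_at using d bound H1_norm_nonneg
    by (intro exI[of _ d]) (auto simp: dist_commute)
  ultimately show ?thesis unfolding rr by (rule Lim_null_comparison[rotated])
qed

text \<open>The class yields each parameter derivative only existentially; dependent choice
  assembles the sequence that \<open>H1_smooth_on\<close> asks for as a witness.\<close>

lemma dominated_class_deriv_sequence:
  assumes "f \<in> \<C>"
  obtains D where "D 0 = f" "\<And>k. D k \<in> \<C>"
    "\<And>k \<omega> x. \<omega> \<in> S \<Longrightarrow> ((\<lambda>\<nu>. D k \<nu> x) has_real_derivative D (Suc k) \<omega> x) (at \<omega>)"
proof -
  define P where "P f g \<longleftrightarrow> (\<forall>\<omega>\<in>S. \<forall>x. ((\<lambda>\<nu>. f \<nu> x) has_real_derivative g \<omega> x) (at \<omega>))" for f g :: "real \<Rightarrow> real \<Rightarrow> real"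
  have "\<exists>D. D 0 = f \<and> (\<forall>k. D k \<in> \<C> \<and> P (D k) (D (Suc k)))"
  proof -
    have "\<exists>g. g \<in> \<C> \<and> P f g" if "f \<in> \<C>" for f
      using C that unfolding dominated_class_def P_def by blast
    then have "\<exists>D. \<forall>k. (D k \<in> \<C> \<and> (k = 0 \<longrightarrow> D k = f)) \<and> P (D k) (D (Suc k))"
      using assms by (intro dependent_nat_choice) auto
    then show ?thesis by blast
  qed
  then show ?thesis using that unfolding P_def by metis
qed

end

lemma H1_smooth_onI:
  assumes S: "open S" and L: "L > 0"
    and C0: "dominated_class S {-L<..<L} \<C>0" and C1: "dominated_class S {L<..} \<C>1"
    and f: "f \<in> \<C>0" and g: "g \<in> \<C>1"
    and F: "\<And>\<omega> e x. \<omega> \<in> S \<Longrightarrow> F \<omega> e x = of_real (if e = 0 then f \<omega> x else g \<omega> x)"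
  shows "H1_smooth_on N L S F"
proof -
  have J0: "open {-L<..<L}" "convex {-L<..<L}" "{-L<..<L} \<noteq> {}" using L by auto
  have J1: "open {L<..}" "convex {L<..}" "{L<..} \<noteq> {}" by (auto intro: exI[of _ "L + 1"])
  note cl0 = S J0 C0 and cl1 = S J1 C1
  obtain D0 where D0: "D0 0 = f" "\<And>k. D0 k \<in> \<C>0"
    "\<And>k \<omega> x. \<omega> \<in> S \<Longrightarrow> ((\<lambda>\<nu>. D0 k \<nu> x) has_real_derivative D0 (Suc k) \<omega> x) (at \<omega>)"
    using dominated_class_deriv_sequence[OF cl0 f] by metis
  obtain D1 where D1: "D1 0 = g" "\<And>k. D1 k \<in> \<C>1"
    "\<And>k \<omega> x. \<omega> \<in> S \<Longrightarrow> ((\<lambda>\<nu>. D1 k \<nu> x) has_real_derivative D1 (Suc k) \<omega> x) (at \<omega>)"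
    using dominated_class_deriv_sequence[OF cl1 g] by metis
  define D :: "nat \<Rightarrow> real \<Rightarrow> graph_fun"
    where "D k \<omega> e x = of_real (if e = 0 then D0 k \<omega> x else D1 k \<omega> x)" for k \<omega> e x
  show ?thesis
    unfolding H1_smooth_on_def
  proof (intro exI[of _ D] conjI allI ballI)
    fix \<omega> assume w: "\<omega> \<in> S"
    show "D 0 \<omega> = F \<omega>" using F[OF w] by (auto simp: fun_eq_iff D_def D0 D1)
    fix k
    show "D k \<omega> \<in> graph_sobolev 1 N L"
      unfolding graph_sobolev_def D_def edge_def
      using dominated_class_sobolev[OF cl0 D0(2) w, of k 1] dominated_class_sobolev[OF cl1 D1(2) w, of k 1]
      by auto
    have "((\<lambda>\<mu>. H1_norm (edge L e) (\<lambda>x. (D k \<mu> e x - D k \<omega> e x) /\<^sub>R (\<mu> - \<omega>) - D (Suc k) \<omega> e x)) \<longlongrightarrow> 0)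
          (at \<omega> within S)" for e
      using dominated_class_H1_derivative[OF cl0 D0(2) D0(2) D0(3) w, of k]
        dominated_class_H1_derivative[OF cl1 D1(2) D1(2) D1(3) w, of k]
      by (cases "e = 0") (simp_all add: D_def edge_def)
    then have "((\<lambda>\<mu>. sqrt (\<Sum>e\<le>N. (H1_norm (edge L e) (\<lambda>x. (D k \<mu> e x - D k \<omega> e x) /\<^sub>R (\<mu> - \<omega>) - D (Suc k) \<omega> e x))\<^sup>2))
        \<longlongrightarrow> sqrt (\<Sum>e\<le>N. 0\<^sup>2)) (at \<omega> within S)"
      by (intro tendsto_intros)
    then show "((\<lambda>\<mu>. graph_H1_norm N L
                (\<lambda>e x. (D k \<mu> e x - D k \<omega> e x) /\<^sub>R (\<mu> - \<omega>) - D (Suc k) \<omega> e x)) \<longlongrightarrow> 0)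
          (at \<omega> within S)"
      by (simp add: graph_H1_norm_def)
  qed
qed

section \<open>Families on the loop and on the half-lines\<close>

text \<open>On the bounded edge a constant is a square-integrable majorant, and compactness of a
  closed frequency ball times [-L, L] provides one. Closure under both derivatives is
  \<open>smooth_on_gradient\<close>.\<close>

lemma dominated_class_smooth:
  assumes S: "open S"
  shows "dominated_class S {-L<..<L} {f. smooth_on (S \<times> UNIV) (\<lambda>p. f (fst p) (snd p))}"
  unfolding dominated_class_def
proof (intro ballI conjI)
  fix f assume "f \<in> {f. smooth_on (S \<times> UNIV) (\<lambda>p. f (fst p) (snd p :: real))}"
  then have f: "smooth_on (S \<times> UNIV) (\<lambda>p. f (fst p) (snd p))" by simp
  have op: "open (S \<times> (UNIV :: real set))" using S by (intro open_Times) auto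
  show c: "continuous_on (S \<times> UNIV) (\<lambda>(\<omega>, x). f \<omega> x)"
    using smooth_onD_continuous[OF f] by (simp add: split_beta)
  obtain f1 f2 where d: "\<forall>p\<in>S \<times> UNIV. ((\<lambda>p. f (fst p) (snd p)) has_derivative (\<lambda>v. f1 p * fst v + f2 p * snd v)) (at p)"
    and s: "smooth_on (S \<times> UNIV) f1" "smooth_on (S \<times> UNIV) f2"
    using smooth_on_gradient[OF op f] by blast
  have fd: "((\<lambda>\<nu>. f \<nu> x) has_real_derivative f1 (\<omega>, x)) (at \<omega>)" "(f \<omega> has_real_derivative f2 (\<omega>, x)) (at x)"
    if "\<omega> \<in> S" for \<omega> x
    using has_derivative_imp_partials[OF bspec[OF d, of "(\<omega>, x)"]] that by auto
  show "\<exists>g\<in>{f. smooth_on (S \<times> UNIV) (\<lambda>p. f (fst p) (snd p))}. \<forall>\<omega>\<in>S. \<forall>x. ((\<lambda>\<nu>. f \<nu> x) has_real_derivative g \<omega> x) (at \<omega>)"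
    using fd(1) s(1) by (intro bexI[of _ "\<lambda>\<omega> x. f1 (\<omega>, x)"]) auto
  show "\<exists>g\<in>{f. smooth_on (S \<times> UNIV) (\<lambda>p. f (fst p) (snd p))}. \<forall>\<omega>\<in>S. \<forall>x. (f \<omega> has_real_derivative g \<omega> x) (at x)"
    using fd(2) s(2) by (intro bexI[of _ "\<lambda>\<omega> x. f2 (\<omega>, x)"]) auto
  fix \<omega> assume "\<omega> \<in> S"
  then obtain d where d: "d > 0" "cball \<omega> d \<subseteq> S" using S open_contains_cball by blast
  have "compact ((\<lambda>(\<omega>, x). f \<omega> x) ` (cball \<omega> d \<times> {-L..L}))"
    using d by (intro compact_continuous_image continuous_on_subset[OF c] compact_Times) auto
  then obtain B where B: "\<forall>y\<in>(\<lambda>(\<omega>, x). f \<omega> x) ` (cball \<omega> d \<times> {-L..L}). norm y \<le> B"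
    using compact_imp_bounded bounded_iff by metis
  have "ball \<omega> d \<subseteq> S" using d ball_subset_cball by blast
  moreover have "set_integrable lebesgue {-L<..<L} (\<lambda>x. B\<^sup>2)"
    by (rule set_integrable_subset[of _ "{-L..L}"]) (auto intro!: absolutely_integrable_continuous_real)
  moreover have "\<bar>f \<nu> x\<bar> \<le> B" if "\<nu> \<in> ball \<omega> d" "x \<in> {-L<..<L}" for \<nu> x
    using B that by force
  ultimately show "\<exists>\<delta>>0. \<exists>M. ball \<omega> \<delta> \<subseteq> S \<and> set_integrable lebesgue {-L<..<L} (\<lambda>x. (M x)\<^sup>2) \<and>
        (\<forall>\<nu>\<in>ball \<omega> \<delta>. \<forall>x\<in>{-L<..<L}. \<bar>f \<nu> x\<bar> \<le> M x)"
    using d(1) by (intro exI[of _ d] exI[of _ "\<lambda>_. B"] conjI) auto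
qed

section \<open>Exponentially decaying families on the half-lines\<close>

text \<open>Raise u \<le> exp u with u = d y / (j + 1) to the power j. Dividing by j + 1 instead of
  j covers j = 0. The estimate lets exponential decay absorb the powers of x - L.\<close>

lemma power_le_exp:
  fixes y d :: real
  assumes "0 \<le> y" "0 < d"
  shows "y ^ j \<le> ((real j + 1) / d) ^ j * exp (d * y)"
proof -
  define n where "n = real j + 1"
  have n: "0 < n" by (simp add: n_def)
  have "d * y / n \<le> exp (d * y / n)" using exp_ge_add_one_self[of "d * y / n"] by linarith
  then have "y \<le> n / d * exp (d * y / n)" using n assms by (simp add: field_simps)
  then have "y ^ j \<le> (n / d * exp (d * y / n)) ^ j" using assms by (intro power_mono)
  also have "\<dots> = (n / d) ^ j * exp (real j * (d * y / n))"
    by (simp only: power_mult_distrib exp_of_nat_mult)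
  also have "\<dots> \<le> (n / d) ^ j * exp (d * y)"
  proof (intro mult_left_mono)
    have "real j / n * (d * y) \<le> 1 * (d * y)"
      using assms n by (intro mult_right_mono) (auto simp: n_def)
    then show "exp (real j * (d * y / n)) \<le> exp (d * y)" by simp
  qed (use assms n in auto)
  finally show ?thesis by (simp add: n_def)
qed

text \<open>These are the monomials that differentiation reproduces: a derivative of tanh^i sech
  brings the powers i - 1 and i + 1 of tanh, and the \<omega>-derivative of the phase brings a
  factor x - L, hence the exponent \<open>j\<close>. The tail itself is the case i = j = 0.\<close>

definition sech_tanh :: "(real \<Rightarrow> real) \<Rightarrow> (real \<Rightarrow> real) \<Rightarrow> real \<Rightarrow> (real \<Rightarrow> real) \<Rightarrow> nat \<Rightarrow> nat \<Rightarrow> real \<Rightarrow> real \<Rightarrow> real" where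
  "sech_tanh \<alpha> \<beta> L g j i \<omega> x =
     g \<omega> * (x - L) ^ j * tanh (\<alpha> \<omega> * (x - L) + \<beta> \<omega>) ^ i / cosh (\<alpha> \<omega> * (x - L) + \<beta> \<omega>)"

inductive_set sech_span :: "real set \<Rightarrow> (real \<Rightarrow> real) \<Rightarrow> (real \<Rightarrow> real) \<Rightarrow> real \<Rightarrow> (real \<Rightarrow> real \<Rightarrow> real) set"
  for S \<alpha> \<beta> L where
  mono: "smooth_on S g \<Longrightarrow> sech_tanh \<alpha> \<beta> L g j i \<in> sech_span S \<alpha> \<beta> L"
| add: "f \<in> sech_span S \<alpha> \<beta> L \<Longrightarrow> h \<in> sech_span S \<alpha> \<beta> L \<Longrightarrow> (\<lambda>\<omega> x. f \<omega> x + h \<omega> x) \<in> sech_span S \<alpha> \<beta> L"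

text \<open>This combines tanh' = 1 - tanh^2 with sech' = - tanh sech. For i = 0 the truncated
  exponent i - 1 is harmless because its coefficient is zero.\<close>

lemma tanh_power_div_cosh_deriv:
  fixes W :: "real \<Rightarrow> real"
  assumes "(W has_real_derivative W') (at z)"
  shows "((\<lambda>z. tanh (W z) ^ i / cosh (W z)) has_real_derivative
     W' * (real i * tanh (W z) ^ (i - 1) - (real i + 1) * tanh (W z) ^ (i + 1)) / cosh (W z)) (at z)"
proof -
  have c: "cosh (W z) \<noteq> 0" by simp
  have "((\<lambda>z. tanh (W z) ^ i / cosh (W z)) has_real_derivative
     ((real i * tanh (W z) ^ (i - 1) * ((1 - (tanh (W z))\<^sup>2) * W')) * cosh (W z) - tanh (W z) ^ i * (sinh (W z) * W')) / (cosh (W z) * cosh (W z))) (at z)"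
    using assms c by (auto intro!: derivative_eq_intros)
  also have "((real i * tanh (W z) ^ (i - 1) * ((1 - (tanh (W z))\<^sup>2) * W')) * cosh (W z) - tanh (W z) ^ i * (sinh (W z) * W')) / (cosh (W z) * cosh (W z))
     = W' * (real i * tanh (W z) ^ (i - 1) * (1 - (tanh (W z))\<^sup>2) - tanh (W z) ^ i * tanh (W z)) / cosh (W z)"
    using c by (simp add: tanh_def[of "W z"] field_simps)
  also have "real i * tanh (W z) ^ (i - 1) * (1 - (tanh (W z))\<^sup>2) - tanh (W z) ^ i * tanh (W z)
     = real i * tanh (W z) ^ (i - 1) - (real i + 1) * tanh (W z) ^ (i + 1)"
    by (cases i) (simp_all add: algebra_simps power2_eq_square)
  finally show ?thesis .
qed

lemma sech_span_deriv:
  assumes S: "open S" and ab: "smooth_on S \<alpha>" "smooth_on S \<beta>" and f: "f \<in> sech_span S \<alpha> \<beta> L"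
  shows "\<exists>g\<in>sech_span S \<alpha> \<beta> L. \<forall>\<omega>\<in>S. \<forall>x. ((\<lambda>\<nu>. f \<nu> x) has_real_derivative g \<omega> x) (at \<omega>)"
    and "\<exists>g\<in>sech_span S \<alpha> \<beta> L. \<forall>\<omega>\<in>S. \<forall>x. (f \<omega> has_real_derivative g \<omega> x) (at x)"
proof -
  have "(\<exists>g\<in>sech_span S \<alpha> \<beta> L. \<forall>\<omega>\<in>S. \<forall>x. ((\<lambda>\<nu>. f \<nu> x) has_real_derivative g \<omega> x) (at \<omega>)) \<and>
    (\<exists>g\<in>sech_span S \<alpha> \<beta> L. \<forall>\<omega>\<in>S. \<forall>x. (f \<omega> has_real_derivative g \<omega> x) (at x))"
    using f
  proof induction
    case (mono g j i)
    obtain \<alpha>' where a: "\<And>x. x \<in> S \<Longrightarrow> (\<alpha> has_real_derivative \<alpha>' x) (at x)" "smooth_on S \<alpha>'"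
      using smooth_on_real_derivative[OF S ab(1)] by metis
    obtain \<beta>' where b: "\<And>x. x \<in> S \<Longrightarrow> (\<beta> has_real_derivative \<beta>' x) (at x)" "smooth_on S \<beta>'"
      using smooth_on_real_derivative[OF S ab(2)] by metis
    obtain g' where g: "\<And>x. x \<in> S \<Longrightarrow> (g has_real_derivative g' x) (at x)" "smooth_on S g'"
      using smooth_on_real_derivative[OF S mono] by metis
    let ?m = "sech_tanh \<alpha> \<beta> L"
    \<comment> \<open>Product rule: one term from \<open>g\<close>, then two for each of the
      summands \<alpha>' (x - L) and \<beta>' of the phase derivative, the former raising the power
      of x - L. The bracketing follows the binary sum rule of the span.\<close>
    define dw where "dw \<omega> x = ?m g' j i \<omega> x + (
        ?m (\<lambda>\<omega>. real i * (g \<omega> * \<alpha>' \<omega>)) (Suc j) (i - 1) \<omega> x + (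
        ?m (\<lambda>\<omega>. - (real i + 1) * (g \<omega> * \<alpha>' \<omega>)) (Suc j) (i + 1) \<omega> x + (
        ?m (\<lambda>\<omega>. real i * (g \<omega> * \<beta>' \<omega>)) j (i - 1) \<omega> x +
        ?m (\<lambda>\<omega>. - (real i + 1) * (g \<omega> * \<beta>' \<omega>)) j (i + 1) \<omega> x)))" for \<omega> x
    define dx where "dx \<omega> x = ?m (\<lambda>\<omega>. real j * g \<omega>) (j - 1) i \<omega> x + (
        ?m (\<lambda>\<omega>. real i * (g \<omega> * \<alpha> \<omega>)) j (i - 1) \<omega> x +
        ?m (\<lambda>\<omega>. - (real i + 1) * (g \<omega> * \<alpha> \<omega>)) j (i + 1) \<omega> x)" for \<omega> x
    have "dw \<in> sech_span S \<alpha> \<beta> L" "dx \<in> sech_span S \<alpha> \<beta> L"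
      unfolding dw_def[abs_def] dx_def[abs_def]
      by (intro sech_span.intros smooth_on_mult smooth_on_const g(2) a(2) b(2) mono ab)+
    moreover have "((\<lambda>\<nu>. ?m g j i \<nu> x) has_real_derivative dw \<omega> x) (at \<omega>)" if "\<omega> \<in> S" for \<omega> x
    proof -
      define W where "W \<nu> = \<alpha> \<nu> * (x - L) + \<beta> \<nu>" for \<nu>
      have W: "(W has_real_derivative \<alpha>' \<omega> * (x - L) + \<beta>' \<omega>) (at \<omega>)"
        unfolding W_def by (intro DERIV_add DERIV_cmult_right a b that)
      have "((\<lambda>\<nu>. (g \<nu> * (x - L) ^ j) * (tanh (W \<nu>) ^ i / cosh (W \<nu>))) has_real_derivative
        g' \<omega> * (x - L) ^ j * (tanh (W \<omega>) ^ i / cosh (W \<omega>)) +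
        (\<alpha>' \<omega> * (x - L) + \<beta>' \<omega>) * (real i * tanh (W \<omega>) ^ (i - 1) - (real i + 1) * tanh (W \<omega>) ^ (i + 1)) / cosh (W \<omega>) * (g \<omega> * (x - L) ^ j)) (at \<omega>)"
        by (rule DERIV_mult[OF DERIV_cmult_right[OF g(1)[OF that]] tanh_power_div_cosh_deriv[OF W]])
      also have "g' \<omega> * (x - L) ^ j * (tanh (W \<omega>) ^ i / cosh (W \<omega>)) +
        (\<alpha>' \<omega> * (x - L) + \<beta>' \<omega>) * (real i * tanh (W \<omega>) ^ (i - 1) - (real i + 1) * tanh (W \<omega>) ^ (i + 1)) / cosh (W \<omega>) * (g \<omega> * (x - L) ^ j)
        = dw \<omega> x"
        unfolding dw_def sech_tanh_def W_def[symmetric] add_divide_distrib[symmetric] times_divide_eq_left times_divide_eq_right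
        by (rule arg_cong[where f = "\<lambda>u. u / cosh (W \<omega>)"]) (simp add: algebra_simps)
      finally show ?thesis by (simp add: sech_tanh_def W_def)
    qed
    moreover have "(?m g j i \<omega> has_real_derivative dx \<omega> x) (at x)" if "\<omega> \<in> S" for \<omega> x
    proof -
      define W where "W x = \<alpha> \<omega> * (x - L) + \<beta> \<omega>" for x
      have W: "(W has_real_derivative \<alpha> \<omega>) (at x)"
        unfolding W_def by (auto intro!: derivative_eq_intros)
      have p: "((\<lambda>x. g \<omega> * (x - L) ^ j) has_real_derivative g \<omega> * (real j * (x - L) ^ (j - 1))) (at x)"
        by (auto intro!: derivative_eq_intros)
      have "((\<lambda>x. (g \<omega> * (x - L) ^ j) * (tanh (W x) ^ i / cosh (W x))) has_real_derivative
        g \<omega> * (real j * (x - L) ^ (j - 1)) * (tanh (W x) ^ i / cosh (W x)) +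
        \<alpha> \<omega> * (real i * tanh (W x) ^ (i - 1) - (real i + 1) * tanh (W x) ^ (i + 1)) / cosh (W x) * (g \<omega> * (x - L) ^ j)) (at x)"
        by (rule DERIV_mult[OF p tanh_power_div_cosh_deriv[OF W]])
      also have "g \<omega> * (real j * (x - L) ^ (j - 1)) * (tanh (W x) ^ i / cosh (W x)) +
        \<alpha> \<omega> * (real i * tanh (W x) ^ (i - 1) - (real i + 1) * tanh (W x) ^ (i + 1)) / cosh (W x) * (g \<omega> * (x - L) ^ j)
        = dx \<omega> x"
        unfolding dx_def sech_tanh_def W_def[symmetric] add_divide_distrib[symmetric] times_divide_eq_left times_divide_eq_right
        by (rule arg_cong[where f = "\<lambda>u. u / cosh (W x)"]) (simp add: algebra_simps)
      finally show ?thesis by (simp add: sech_tanh_def[abs_def] W_def)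
    qed
    ultimately show ?case by blast
  next
    case (add f h)
    then obtain fw fx hw hx where m: "fw \<in> sech_span S \<alpha> \<beta> L" "fx \<in> sech_span S \<alpha> \<beta> L"
       "hw \<in> sech_span S \<alpha> \<beta> L" "hx \<in> sech_span S \<alpha> \<beta> L"
      and d: "\<forall>\<omega>\<in>S. \<forall>x. ((\<lambda>\<nu>. f \<nu> x) has_real_derivative fw \<omega> x) (at \<omega>)"
       "\<forall>\<omega>\<in>S. \<forall>x. (f \<omega> has_real_derivative fx \<omega> x) (at x)"
       "\<forall>\<omega>\<in>S. \<forall>x. ((\<lambda>\<nu>. h \<nu> x) has_real_derivative hw \<omega> x) (at \<omega>)"
       "\<forall>\<omega>\<in>S. \<forall>x. (h \<omega> has_real_derivative hx \<omega> x) (at x)"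
      by blast
    show ?case
    proof (intro conjI)
      show "\<exists>g\<in>sech_span S \<alpha> \<beta> L. \<forall>\<omega>\<in>S. \<forall>x. ((\<lambda>\<nu>. f \<nu> x + h \<nu> x) has_real_derivative g \<omega> x) (at \<omega>)"
        using d by (intro bexI[OF _ sech_span.add[OF m(1) m(3)]] ballI allI DERIV_add) auto
      show "\<exists>g\<in>sech_span S \<alpha> \<beta> L. \<forall>\<omega>\<in>S. \<forall>x. ((\<lambda>x. f \<omega> x + h \<omega> x) has_real_derivative g \<omega> x) (at x)"
        using d by (intro bexI[OF _ sech_span.add[OF m(2) m(4)]] ballI allI DERIV_add) auto
    qed
  qed
  then show "\<exists>g\<in>sech_span S \<alpha> \<beta> L. \<forall>\<omega>\<in>S. \<forall>x. ((\<lambda>\<nu>. f \<nu> x) has_real_derivative g \<omega> x) (at \<omega>)"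
    and "\<exists>g\<in>sech_span S \<alpha> \<beta> L. \<forall>\<omega>\<in>S. \<forall>x. (f \<omega> has_real_derivative g \<omega> x) (at x)" by blast+
qed

lemma sech_span_continuous:
  assumes ab: "smooth_on S \<alpha>" "smooth_on S \<beta>" and f: "f \<in> sech_span S \<alpha> \<beta> L"
  shows "continuous_on (S \<times> UNIV) (\<lambda>(\<omega>, x). f \<omega> x)"
  using f
proof induction
  case (mono g j i)
  have *: "continuous_on (S \<times> UNIV) (\<lambda>p. h (fst p))" if "smooth_on S h" for h
    by (rule continuous_on_compose2[OF smooth_onD_continuous[OF that] continuous_on_fst[OF continuous_on_id]]) auto
  note *[OF mono] *[OF ab(1)] *[OF ab(2)]
  then show ?case
    unfolding sech_tanh_def split_beta by (intro continuous_intros) auto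
qed (auto simp: split_beta intro: continuous_intros)

text \<open>The bound sech W \<le> 2 exp(- W) and the positive minimum of \<alpha> over a closed
  ball of frequencies give one decay rate for the whole ball. Sums take the smaller radius and the
  smaller rate.\<close>

lemma sech_span_decay:
  assumes S: "open S" and ab: "smooth_on S \<alpha>" "smooth_on S \<beta>" and pos: "\<And>\<omega>. \<omega> \<in> S \<Longrightarrow> 0 < \<alpha> \<omega>"
    and f: "f \<in> sech_span S \<alpha> \<beta> L" and w: "\<omega> \<in> S"
  shows "\<exists>\<delta>>0. \<exists>\<epsilon>>0. \<exists>C\<ge>0. ball \<omega> \<delta> \<subseteq> S \<and>
    (\<forall>\<nu>\<in>ball \<omega> \<delta>. \<forall>x>L. \<bar>f \<nu> x\<bar> \<le> C * exp (- \<epsilon> * (x - L)))"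
  using f
proof induction
  case (mono g j i)
  obtain d where d: "d > 0" "cball \<omega> d \<subseteq> S" using S w open_contains_cball by blast
  have bdd: "\<exists>B. \<forall>\<nu>\<in>cball \<omega> d. \<bar>h \<nu>\<bar> \<le> B" if "smooth_on S h" for h
  proof -
    have "compact (h ` cball \<omega> d)"
      by (intro compact_continuous_image continuous_on_subset[OF smooth_onD_continuous[OF that]] d(2)) auto
    then have "bounded (h ` cball \<omega> d)" by (rule compact_imp_bounded)
    then show ?thesis unfolding bounded_iff by auto
  qed
  obtain G where G: "\<forall>\<nu>\<in>cball \<omega> d. \<bar>g \<nu>\<bar> \<le> G" using bdd[OF mono] by blast
  obtain B where B: "\<forall>\<nu>\<in>cball \<omega> d. \<bar>\<beta> \<nu>\<bar> \<le> B" using bdd[OF ab(2)] by blast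
  have "\<exists>\<nu>0\<in>cball \<omega> d. \<forall>\<nu>\<in>cball \<omega> d. \<alpha> \<nu>0 \<le> \<alpha> \<nu>"
    using d by (intro continuous_attains_inf continuous_on_subset[OF smooth_onD_continuous[OF ab(1)]]) auto
  then obtain \<nu>0 where \<nu>0: "\<nu>0 \<in> cball \<omega> d" "\<forall>\<nu>\<in>cball \<omega> d. \<alpha> \<nu>0 \<le> \<alpha> \<nu>" by blast
  define e where "e = \<alpha> \<nu>0"
  have e: "0 < e" unfolding e_def using pos \<nu>0 d by blast
  \<comment> \<open>Half of the decay rate \<open>e\<close> is spent on the power of x - L; the
    other half remains in the final bound.\<close>
  define P where "P = ((real j + 1) / (e / 2)) ^ j"
  have P: "0 \<le> P" using e by (simp add: P_def)
  have G0: "0 \<le> G" using G \<nu>0(1) by force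
  have "\<bar>sech_tanh \<alpha> \<beta> L g j i \<nu> x\<bar> \<le> (G * P * 2 * exp B) * exp (- (e / 2) * (x - L))"
    if \<nu>: "\<nu> \<in> ball \<omega> d" and x: "x > L" for \<nu> x
  proof -
    have \<nu>c: "\<nu> \<in> cball \<omega> d" using \<nu> by auto
    define y where "y = x - L"
    have y: "0 \<le> y" using x by (simp add: y_def)
    define W where "W = \<alpha> \<nu> * y + \<beta> \<nu>"
    have "e * y - B \<le> W"
    proof -
      have "e * y \<le> \<alpha> \<nu> * y" using \<nu>0 \<nu>c y by (intro mult_right_mono) (auto simp: e_def)
      moreover have "- B \<le> \<beta> \<nu>" using B \<nu>c by fastforce
      ultimately show ?thesis by (simp add: W_def)
    qed
    then have "exp (- W) \<le> exp (B - e * y)" by simp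
    moreover have "exp W / 2 \<le> cosh W" by (simp add: cosh_def)
    then have "1 / cosh W \<le> 1 / (exp W / 2)" by (intro divide_left_mono) auto
    then have "1 / cosh W \<le> 2 * exp (- W)" by (simp add: exp_minus field_simps)
    ultimately have ch: "1 / cosh W \<le> 2 * exp (B - e * y)" by linarith
    have "\<bar>tanh W\<bar> \<le> 1" using tanh_real_bounds[of W] by auto
    then have th: "\<bar>tanh W\<bar> ^ i \<le> 1" by (intro power_le_one) auto
    have "\<bar>sech_tanh \<alpha> \<beta> L g j i \<nu> x\<bar> = \<bar>g \<nu>\<bar> * y ^ j * \<bar>tanh W\<bar> ^ i * (1 / cosh W)"
      using y by (simp add: sech_tanh_def y_def[symmetric] W_def abs_mult power_abs)
    also have "\<dots> \<le> G * (P * exp (e / 2 * y)) * 1 * (2 * exp (B - e * y))"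
    proof (intro mult_mono)
      show "\<bar>g \<nu>\<bar> \<le> G" using G \<nu>c by blast
      show "y ^ j \<le> P * exp (e / 2 * y)" unfolding P_def using power_le_exp[OF y, of "e / 2" j] e by simp
    qed (use ch th y G0 P in auto)
    also have "\<dots> = (G * P * 2) * (exp (e / 2 * y) * exp (B - e * y))" by (simp only: mult.assoc mult.left_commute mult_1_left)
    also have "exp (e / 2 * y) * exp (B - e * y) = exp (B + - (e / 2) * y)"
      unfolding mult_exp_exp by (rule arg_cong[where f = exp]) (simp add: field_simps)
    also have "\<dots> = exp B * exp (- (e / 2) * y)" by (rule exp_add)
    also have "(G * P * 2) * \<dots> = (G * P * 2 * exp B) * exp (- (e / 2) * y)" by (simp only: mult.assoc)
    finally show ?thesis by (simp add: y_def)
  qed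
  moreover have "ball \<omega> d \<subseteq> S" using d ball_subset_cball by blast
  moreover have "0 \<le> G * P * 2 * exp B" using G0 P by simp
  ultimately show ?case using d(1) e by (intro exI[of _ d] exI[of _ "e / 2"] exI[of _ "G * P * 2 * exp B"] conjI) auto
next
  case (add f h)
  then obtain d1 e1 C1 d2 e2 C2 where 1: "d1 > 0" "e1 > 0" "C1 \<ge> 0" "ball \<omega> d1 \<subseteq> S"
      "\<forall>\<nu>\<in>ball \<omega> d1. \<forall>x>L. \<bar>f \<nu> x\<bar> \<le> C1 * exp (- e1 * (x - L))"
    and 2: "d2 > 0" "e2 > 0" "C2 \<ge> 0" "ball \<omega> d2 \<subseteq> S"
      "\<forall>\<nu>\<in>ball \<omega> d2. \<forall>x>L. \<bar>h \<nu> x\<bar> \<le> C2 * exp (- e2 * (x - L))"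
    by blast
  define d where "d = min d1 d2"
  define e where "e = min e1 e2"
  have "\<bar>f \<nu> x + h \<nu> x\<bar> \<le> (C1 + C2) * exp (- e * (x - L))" if \<nu>: "\<nu> \<in> ball \<omega> d" and x: "x > L" for \<nu> x
  proof -
    have ex: "exp (- e1 * (x - L)) \<le> exp (- e * (x - L))" "exp (- e2 * (x - L)) \<le> exp (- e * (x - L))"
      using x by (auto simp: e_def intro!: mult_right_mono)
    have "\<bar>f \<nu> x\<bar> \<le> C1 * exp (- e1 * (x - L))" "\<bar>h \<nu> x\<bar> \<le> C2 * exp (- e2 * (x - L))"
      using 1 2 \<nu> x by (auto simp: d_def)
    moreover have "C1 * exp (- e1 * (x - L)) \<le> C1 * exp (- e * (x - L))"
      "C2 * exp (- e2 * (x - L)) \<le> C2 * exp (- e * (x - L))"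
      using 1 2 ex by (auto intro!: mult_left_mono)
    ultimately show ?thesis unfolding distrib_right by linarith
  qed
  moreover have "ball \<omega> d \<subseteq> S" using 1 by (auto simp: d_def)
  moreover have "d > 0" "e > 0" "0 \<le> C1 + C2" using 1 2 by (auto simp: d_def e_def)
  ultimately show ?case by (intro exI[of _ d] exI[of _ e] exI[of _ "C1 + C2"] conjI) auto
qed

lemma dominated_class_sech_span:
  assumes S: "open S" and ab: "smooth_on S \<alpha>" "smooth_on S \<beta>" and pos: "\<And>\<omega>. \<omega> \<in> S \<Longrightarrow> 0 < \<alpha> \<omega>"
  shows "dominated_class S {L<..} (sech_span S \<alpha> \<beta> L)"
  unfolding dominated_class_def
proof (intro ballI conjI)
  fix f \<omega> assume f: "f \<in> sech_span S \<alpha> \<beta> L" and w: "\<omega> \<in> S"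
  obtain d e C where d: "d > 0" "e > 0" "ball \<omega> d \<subseteq> S"
      "\<forall>\<nu>\<in>ball \<omega> d. \<forall>x>L. \<bar>f \<nu> x\<bar> \<le> C * exp (- e * (x - L))"
    using sech_span_decay[OF S ab pos f w] by blast
  have "(\<lambda>x. exp (- (2 * e) * x)) integrable_on {L..}"
    using has_integral_exp_minus_to_infinity[of "2 * e" L] d(2) by (auto simp: integrable_on_def)
  then have "set_integrable lebesgue {L..} (\<lambda>x. exp (- (2 * e) * x))"
    by (rule nonnegative_absolutely_integrable_1) auto
  then have "set_integrable lebesgue {L<..} (\<lambda>x. exp (- (2 * e) * x))"
    by (rule set_integrable_subset) auto
  then have "set_integrable lebesgue {L<..} (\<lambda>x. (C\<^sup>2 * exp (2 * e * L)) * exp (- (2 * e) * x))"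
    by (rule set_integrable_mult_right)
  also have "(\<lambda>x. (C\<^sup>2 * exp (2 * e * L)) * exp (- (2 * e) * x)) = (\<lambda>x. (C * exp (- e * (x - L)))\<^sup>2)"
  proof
    fix x
    have "(exp (- e * (x - L)))\<^sup>2 = exp (2 * e * L) * exp (- (2 * e) * x)"
      unfolding exp_add[symmetric] exp_double[symmetric] by (simp add: algebra_simps)
    then show "(C\<^sup>2 * exp (2 * e * L)) * exp (- (2 * e) * x) = (C * exp (- e * (x - L)))\<^sup>2"
      by (simp add: power_mult_distrib)
  qed
  finally show "\<exists>\<delta>>0. \<exists>M. ball \<omega> \<delta> \<subseteq> S \<and> set_integrable lebesgue {L<..} (\<lambda>x. (M x)\<^sup>2) \<and>
        (\<forall>\<nu>\<in>ball \<omega> \<delta>. \<forall>x\<in>{L<..}. \<bar>f \<nu> x\<bar> \<le> M x)"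
    using d by (intro exI[of _ d] exI[of _ "\<lambda>x. C * exp (- e * (x - L))"] conjI) auto
qed (use sech_span_deriv[OF S ab] sech_span_continuous[OF ab] in blast)+

section \<open>The pendulum integral\<close>

text \<open>The substitution \<open>t = 2 s\<close> turns the Legendre integrand \<open>1 - k\<^sup>2 sin\<^sup>2 s\<close> into a multiple of
  \<open>1 + q cos t\<close> with \<open>q = k\<^sup>2 / (2 - k\<^sup>2)\<close>. The integral over \<open>[0, \<theta>]\<close> is rescaled to \<open>[0, 1]\<close>, so that
  negative \<open>\<theta>\<close> need no oriented integral.\<close>

definition pend_time :: "real \<Rightarrow> real \<Rightarrow> real" where
  "pend_time \<theta> q = \<theta> * integral {0..1} (\<lambda>s. 1 / sqrt (1 + q * cos (\<theta> * s)))"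

definition pend_angle :: "real \<Rightarrow> real \<Rightarrow> real" where
  "pend_angle y q = (THE \<theta>. pend_time \<theta> q = y)"

lemma pend_pos:
  fixes q t :: real
  assumes "\<bar>q\<bar> < 1" shows "0 < 1 + q * cos t"
proof -
  have "\<bar>q * cos t\<bar> \<le> \<bar>q\<bar> * 1" unfolding abs_mult by (intro mult_left_mono) auto
  then show ?thesis using assms by linarith
qed

lemma smooth_pend_integrand: "smooth_on (UNIV \<times> {-1<..<1::real}) (\<lambda>p. 1 / sqrt (1 + snd p * cos (fst p)))"
proof -
  have "open ((UNIV :: real set) \<times> {-1<..<1::real})" by (intro open_Times) auto
  moreover have "smooth_on (UNIV \<times> {-1<..<1::real}) (\<lambda>p. cos (fst p))"
    by (rule smooth_on_compose[OF smooth_on_cos smooth_on_fst]) auto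
  moreover have "0 < 1 + snd p * cos (fst p)" if "p \<in> UNIV \<times> {-1<..<1}" for p :: "real \<times> real"
    using that pend_pos[of "snd p" "fst p"] by auto
  ultimately show ?thesis
    by (intro smooth_on_divide smooth_on_compose_sqrt smooth_on_const smooth_on_add smooth_on_mult smooth_on_snd) auto
qed

lemma smooth_pend_time: "smooth_on (UNIV \<times> {-1<..<1}) (\<lambda>p. pend_time (fst p) (snd p))"
  using smooth_antiderivative(1)[OF _ _ smooth_pend_integrand] unfolding pend_time_def by simp

lemma pend_time_deriv:
  assumes "\<bar>q\<bar> < 1"
  shows "((\<lambda>\<theta>. pend_time \<theta> q) has_real_derivative 1 / sqrt (1 + q * cos \<theta>)) (at \<theta>)"
  using smooth_antiderivative(2)[OF _ _ smooth_pend_integrand, of q \<theta>] assms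
  unfolding pend_time_def by (simp add: abs_less_iff)

lemma pend_time_strict_mono:
  assumes "\<bar>q\<bar> < 1" "\<theta> < \<theta>'"
  shows "pend_time \<theta> q < pend_time \<theta>' q"
proof (rule DERIV_pos_imp_increasing[OF assms(2)])
  fix x
  have "0 < 1 / sqrt (1 + q * cos x)" using pend_pos[OF assms(1), of x] by simp
  with pend_time_deriv[OF assms(1), of x]
  show "\<exists>y. ((\<lambda>\<theta>. pend_time \<theta> q) has_real_derivative y) (at x) \<and> 0 < y" by blast
qed

lemma pend_time_eq_iff: "\<bar>q\<bar> < 1 \<Longrightarrow> pend_time \<theta> q = pend_time \<theta>' q \<longleftrightarrow> \<theta> = \<theta>'"
  by (metis pend_time_strict_mono linorder_neqE_linordered_idom order_less_irrefl)

lemma pend_time_0 [simp]: "pend_time 0 q = 0"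
  by (simp add: pend_time_def)

lemma pend_time_minus: "pend_time (- \<theta>) q = - pend_time \<theta> q"
  by (simp add: pend_time_def)

text \<open>The integrand is 2 pi periodic, so the increment over one turn does not depend on
  \<theta>; at \<theta> = - pi oddness shows that it is twice the half period.\<close>

lemma pend_time_add_2pi:
  assumes "\<bar>q\<bar> < 1"
  shows "pend_time (\<theta> + 2 * pi) q = pend_time \<theta> q + 2 * pend_time pi q"
proof -
  have "((\<lambda>\<theta>. pend_time (\<theta> + 2 * pi) q - pend_time \<theta> q) has_real_derivative 0) (at \<theta>)" for \<theta>
  proof -
    have "((\<lambda>\<theta>. pend_time (\<theta> + 2 * pi) q) has_real_derivative 1 / sqrt (1 + q * cos \<theta>)) (at \<theta>)"
      using pend_time_deriv[OF assms, of "\<theta> + 2 * pi"] unfolding DERIV_shift by simp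
    from DERIV_diff[OF this pend_time_deriv[OF assms, of \<theta>]] show ?thesis by simp
  qed
  then have "pend_time (\<theta> + 2 * pi) q - pend_time \<theta> q = pend_time (- pi + 2 * pi) q - pend_time (- pi) q"
    using DERIV_isconst_all[of "\<lambda>\<theta>. pend_time (\<theta> + 2 * pi) q - pend_time \<theta> q" \<theta> "- pi"] by blast
  then show ?thesis by (simp add: pend_time_minus)
qed

lemma pend_time_surj:
  assumes "\<bar>q\<bar> < 1"
  obtains \<theta> where "pend_time \<theta> q = y"
proof -
  have lower: "\<theta> / sqrt 2 \<le> pend_time \<theta> q" if "0 \<le> \<theta>" for \<theta>
  proof -
    have "pend_time 0 q - 0 / sqrt 2 \<le> pend_time \<theta> q - \<theta> / sqrt 2"
    proof (rule DERIV_nonneg_imp_nondecreasing[where f = "\<lambda>\<theta>. pend_time \<theta> q - \<theta> / sqrt 2", OF that])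
      fix x
      have "q * cos x \<le> \<bar>q\<bar> * \<bar>cos x\<bar>" by (metis abs_ge_self abs_mult)
      also have "\<dots> \<le> 1 * 1" using assms by (intro mult_mono) auto
      finally have "sqrt (1 + q * cos x) \<le> sqrt 2" by simp
      then have "1 / sqrt 2 \<le> 1 / sqrt (1 + q * cos x)"
        using pend_pos[OF assms, of x] by (intro divide_left_mono) auto
      moreover have "((\<lambda>\<theta>. pend_time \<theta> q - \<theta> / sqrt 2) has_real_derivative 1 / sqrt (1 + q * cos x) - 1 / sqrt 2) (at x)"
        by (intro DERIV_diff pend_time_deriv[OF assms] DERIV_cdivide DERIV_ident)
      ultimately show "\<exists>y. ((\<lambda>\<theta>. pend_time \<theta> q - \<theta> / sqrt 2) has_real_derivative y) (at x) \<and> 0 \<le> y"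
        by (intro exI[of _ "1 / sqrt (1 + q * cos x) - 1 / sqrt 2"]) simp
    qed
    then show ?thesis by simp
  qed
  \<comment> \<open>By \<open>lower\<close> the time grows at least like \<theta> / sqrt 2, so this
    choice and oddness bracket \<open>y\<close> between the values at - b and b.\<close>
  define b where "b = \<bar>y\<bar> * sqrt 2"
  have b: "0 \<le> b" "b / sqrt 2 = \<bar>y\<bar>" by (auto simp: b_def)
  have "pend_time (- b) q \<le> y" "y \<le> pend_time b q"
    using lower[OF b(1)] b(2) by (auto simp: pend_time_minus)
  moreover have "\<forall>x. - b \<le> x \<and> x \<le> b \<longrightarrow> isCont (\<lambda>\<theta>. pend_time \<theta> q) x"
    using pend_time_deriv[OF assms] DERIV_isCont by blast
  ultimately obtain x where "pend_time x q = y"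
    using IVT[of "\<lambda>\<theta>. pend_time \<theta> q" "- b" y b] b by auto
  then show ?thesis by (rule that)
qed

lemma pend_angle_time: "\<bar>q\<bar> < 1 \<Longrightarrow> pend_angle (pend_time \<theta> q) q = \<theta>"
  unfolding pend_angle_def by (rule the_equality) (auto simp: pend_time_eq_iff)

lemma pend_time_angle: "\<bar>q\<bar> < 1 \<Longrightarrow> pend_time (pend_angle y q) q = y"
  by (metis pend_angle_time pend_time_surj)

lemma smooth_pend_angle: "smooth_on (UNIV \<times> {-1<..<1}) (\<lambda>p. pend_angle (fst p) (snd p))"
proof (rule smooth_on_partial_inverse[OF _ smooth_pend_time])
  show "open ((UNIV :: real set) \<times> {-1<..<1::real})" by (intro open_Times) auto
  fix \<theta> q :: real assume "(\<theta>, q) \<in> UNIV \<times> {-1<..<1}"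
  then have q: "\<bar>q\<bar> < 1" by auto
  show "\<exists>d>0. ((\<lambda>\<theta>. pend_time (fst (\<theta>, q)) (snd (\<theta>, q))) has_real_derivative d) (at \<theta>)"
    using pend_time_deriv[OF q, of \<theta>] pend_pos[OF q, of \<theta>] by (intro exI[of _ "1 / sqrt (1 + q * cos \<theta>)"]) auto
qed (auto simp: pend_time_angle pend_angle_time abs_less_iff)

text \<open>Differentiability comes from smoothness, and the value from differentiating the identity
  pend_time (pend_angle y q) q = y. The result is the first-order energy equation of the
  pendulum.\<close>

lemma pend_angle_deriv:
  assumes "\<bar>q\<bar> < 1"
  shows "((\<lambda>y. pend_angle y q) has_real_derivative sqrt (1 + q * cos (pend_angle y q))) (at y)"
proof -
  have "open ((UNIV :: real set) \<times> {-1<..<1::real})" by (intro open_Times) auto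
  from smooth_on_partially_differentiable(1)[OF this smooth_pend_angle, of y q]
  obtain d where d: "((\<lambda>y. pend_angle y q) has_real_derivative d) (at y)"
    using assms by (auto simp: abs_less_iff)
  define r where "r = sqrt (1 + q * cos (pend_angle y q))"
  have "((\<lambda>y. pend_time (pend_angle y q) q) has_real_derivative 1 / r * d) (at y)"
    unfolding r_def using DERIV_chain2[OF pend_time_deriv[OF assms] d] .
  moreover have "((\<lambda>y. pend_time (pend_angle y q) q) has_real_derivative 1) (at y)"
    using assms by (simp add: pend_time_angle)
  ultimately have "1 / r * d = 1" by (rule DERIV_unique)
  moreover have "r > 0" unfolding r_def using pend_pos[OF assms] by simp
  ultimately have "d = r" by (simp add: field_simps)
  then show ?thesis using d by (simp add: r_def)
qed

section \<open>The half period as a function of q\<close>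

lemma pend_time_pi_eq_integral:
  assumes "\<bar>q\<bar> < 1"
  shows "pend_time pi q = integral {0..pi} (\<lambda>t. 1 / sqrt (1 + q * cos t))"
proof -
  have "((\<lambda>t. 1 / sqrt (1 + q * cos t)) has_integral (pend_time pi q - pend_time 0 q)) {0..pi}"
    using pend_time_deriv[OF assms]
    by (intro fundamental_theorem_of_calculus)
       (auto simp: has_real_derivative_iff_has_vector_derivative has_vector_derivative_at_within)
  then show ?thesis by (simp add: integral_unique)
qed

lemma inverse_sqrt_deriv:
  fixes r c :: real
  assumes "0 < 1 + r * c"
  shows "((\<lambda>q. 1 / sqrt (1 + q * c)) has_real_derivative - c / (2 * sqrt (1 + r * c) ^ 3)) (at r)"
proof -
  have s: "sqrt (1 + r * c) \<noteq> 0" using assms by simp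
  have "((\<lambda>q. 1 + q * c) has_real_derivative c) (at r)"
    using DERIV_add[OF DERIV_const[of 1] DERIV_cmult_right[OF DERIV_ident, of c]] by simp
  then have "((\<lambda>q. sqrt (1 + q * c)) has_real_derivative inverse (sqrt (1 + r * c)) / 2 * c) (at r)"
    using DERIV_chain2[where f = sqrt and g = "\<lambda>q. 1 + q * c" and x = r, OF DERIV_real_sqrt[OF assms]] by blast
  from DERIV_inverse'[OF this s]
  have "((\<lambda>q. inverse (sqrt (1 + q * c))) has_real_derivative - c / (2 * sqrt (1 + r * c) ^ 3)) (at r)"
    by (rule DERIV_cong) (use s in \<open>simp add: power3_eq_cube field_simps\<close>)
  then show ?thesis by (simp add: inverse_eq_divide)
qed

lemma pend_time_pi_deriv:
  assumes "0 < q" "q < 1"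
  shows "\<exists>d>0. (pend_time pi has_real_derivative d) (at q)"
proof -
  define \<phi> where "\<phi> q t = - cos t / (2 * sqrt (1 + q * cos t) ^ 3)" for q t
  have pos: "0 < 1 + r * cos t" if "r \<in> {-1<..<1}" for r t :: real using that pend_pos[of r t] by auto
  have nz: "sqrt (1 + r * cos t) \<noteq> 0" if "r \<in> {-1<..<1}" for r t :: real using pos[OF that, of t] by auto
  have "((\<lambda>q. integral (cbox 0 pi) (\<lambda>t. 1 / sqrt (1 + q * cos t))) has_real_derivative
      integral (cbox 0 pi) (\<phi> q)) (at q within {-1<..<1})"
  proof (rule leibniz_rule_field_derivative)
    fix r t :: real assume r: "r \<in> {-1<..<1}"
    have "((\<lambda>q. 1 / sqrt (1 + q * cos t)) has_real_derivative \<phi> r t) (at r)"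
      unfolding \<phi>_def by (rule inverse_sqrt_deriv[OF pos[OF r]])
    then show "((\<lambda>q. 1 / sqrt (1 + q * cos t)) has_real_derivative \<phi> r t) (at r within {-1<..<1})"
      by (rule has_field_derivative_at_within)
  next
    fix r :: real assume "r \<in> {-1<..<1}"
    then show "(\<lambda>t. 1 / sqrt (1 + r * cos t)) integrable_on cbox 0 pi"
      using nz by (auto intro!: integrable_continuous_real continuous_intros)
  next
    show "continuous_on ({-1<..<1} \<times> cbox 0 pi) (\<lambda>(q, t). \<phi> q t)"
      unfolding \<phi>_def split_beta using nz by (intro continuous_intros) auto
  qed (use assms in auto)
  then have D: "((\<lambda>q. integral {0..pi} (\<lambda>t. 1 / sqrt (1 + q * cos t))) has_real_derivative integral {0..pi} (\<phi> q)) (at q)"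
    using assms by (subst (asm) at_within_open) auto
  have "(pend_time pi has_real_derivative integral {0..pi} (\<phi> q)) (at q)"
    by (rule has_field_derivative_transform_within_open[OF D, of "{-1<..<1}"])
       (use assms in \<open>auto simp: pend_time_pi_eq_integral\<close>)
  moreover have "0 < integral {0..pi} (\<phi> q)"
  proof -
    \<comment> \<open>The integral of \<open>cos\<close> over \<open>[0, \<pi>]\<close> vanishes; adding a multiple of it makes the integrand nonnegative.\<close>
    define \<psi> where "\<psi> t = \<phi> q t + cos t / 2" for t
    have q: "q \<in> {-1<..<1}" using assms by auto
    have c\<phi>: "continuous_on {0..pi} (\<phi> q)"
      unfolding \<phi>_def using nz[OF q] by (intro continuous_intros) auto
    have c\<psi>: "continuous_on {0..pi} \<psi>" unfolding \<psi>_def by (intro continuous_intros c\<phi>) auto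
    have eq: "\<psi> t = cos t / 2 * (1 - 1 / sqrt (1 + q * cos t) ^ 3)" for t
      by (simp add: \<psi>_def \<phi>_def algebra_simps)
    \<comment> \<open>As q > 0, the root is at least 1 exactly when cos t is nonnegative, so the two
      factors in \<open>eq\<close> have the same sign.\<close>
    have nonneg: "0 \<le> \<psi> t" for t
    proof (cases "cos t \<ge> 0")
      case True
      then have "1 \<le> sqrt (1 + q * cos t)" using assms by simp
      then have "1 \<le> sqrt (1 + q * cos t) ^ 3" by (rule one_le_power)
      moreover have "0 < sqrt (1 + q * cos t) ^ 3" using calculation by linarith
      ultimately have "1 / sqrt (1 + q * cos t) ^ 3 \<le> 1" by (simp add: divide_le_eq)
      then show ?thesis unfolding eq using True by (intro mult_nonneg_nonneg) auto
    next
      case False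
      then have "sqrt (1 + q * cos t) \<le> 1" using assms by (simp add: mult_le_0_iff)
      then have "sqrt (1 + q * cos t) ^ 3 \<le> 1" using pos[OF q, of t] by (intro power_le_one) auto
      then have "1 \<le> 1 / sqrt (1 + q * cos t) ^ 3" using pos[OF q, of t] by (simp add: le_divide_eq)
      then show ?thesis unfolding eq using False by (intro mult_nonpos_nonpos) auto
    qed
    have "1 < sqrt (1 + q) ^ 3" using assms by (intro one_less_power) auto
    moreover from this have "0 < sqrt (1 + q) ^ 3" by linarith
    ultimately have "1 / sqrt (1 + q) ^ 3 < 1" by (simp only: divide_less_eq_1_pos)
    then have "0 < \<psi> 0" unfolding eq by simp
    have "(cos has_integral (sin pi - sin 0)) {0..pi}"
      by (intro fundamental_theorem_of_calculus)
         (auto simp: has_real_derivative_iff_has_vector_derivative[symmetric] intro!: derivative_eq_intros)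
    then have "((\<lambda>t. cos t / 2) has_integral 0) {0..pi}"
      using has_integral_divide[of cos 0 "{0..pi}" 2] by simp
    then have "integral {0..pi} \<psi> = integral {0..pi} (\<phi> q)"
      unfolding \<psi>_def using c\<phi>
      by (subst integral_add) (auto intro!: integrable_continuous_real simp: integral_unique continuous_intros)
    moreover have "0 < integral {0..pi} \<psi>"
    proof -
      have "0 \<le> integral {0..pi} \<psi>"
        using c\<psi> nonneg by (intro integral_nonneg integrable_continuous_real) auto
      moreover have "integral {0..pi} \<psi> \<noteq> 0"
      proof
        assume "integral {0..pi} \<psi> = 0"
        then have "(\<psi> has_integral 0) (cbox 0 pi)"
          using c\<psi> by (metis box_real(2) integrable_continuous_real integrable_integral)
        then have "\<psi> 0 = 0"
          by (rule has_integral_0_cbox_imp_0[rotated 2]) (use c\<psi> nonneg in \<open>auto dest: order.strict_trans2[OF pi_gt_zero]\<close>)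
        with \<open>0 < \<psi> 0\<close> show False by simp
      qed
      ultimately show ?thesis by linarith
    qed
    ultimately show ?thesis by simp
  qed
  ultimately show ?thesis by blast
qed

lemma pend_time_pi_0: "pend_time pi 0 = pi"
  by (simp add: pend_time_def)

lemma pend_time_pi_isCont: "\<bar>q\<bar> < 1 \<Longrightarrow> isCont (pend_time pi) q"
proof -
  assume "\<bar>q\<bar> < 1"
  moreover have "open ((UNIV :: real set) \<times> {-1<..<1::real})" by (intro open_Times) auto
  ultimately show ?thesis
    using smooth_on_partially_differentiable(2)[OF _ smooth_pend_time, of pi q] DERIV_isCont
    by (fastforce simp: abs_less_iff)
qed

lemma pend_time_pi_strict_mono:
  assumes "0 \<le> q" "q < q'" "q' < 1"
  shows "pend_time pi q < pend_time pi q'"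
\<comment> \<open>Positivity of the derivative is available only for q > 0, while the left endpoint
  may be 0; hence the open-interval criterion together with continuity up to the ends.\<close>
proof (rule DERIV_pos_imp_increasing_open[OF assms(2)])
  show "\<exists>y. (pend_time pi has_real_derivative y) (at x) \<and> 0 < y" if "q < x" "x < q'" for x
    using pend_time_pi_deriv[of x] that assms by auto
  show "continuous_on {q..q'} (pend_time pi)"
    using assms by (intro continuous_at_imp_continuous_on ballI pend_time_pi_isCont) auto
qed

text \<open>As q tends to 1 the integrand blows up at \<theta> = pi. With u = pi - \<theta> and e^2
  = 1 - q one has 1 + q cos \<theta> \<le> (e + u)^2, and 1 / (e + u) integrates to the logarithm.
  The bound diverges as q tends to 1, so the half period takes every value above pi.\<close>

lemma pend_time_pi_lower:
  assumes "0 \<le> q" "q < 1"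
  shows "ln ((sqrt (1 - q) + pi) / sqrt (1 - q)) \<le> pend_time pi q"
proof -
  define e where "e = sqrt (1 - q)"
  have e: "0 < e" "e\<^sup>2 = 1 - q" using assms by (auto simp: e_def)
  have q: "\<bar>q\<bar> < 1" using assms by auto
  have "pend_time 0 q + ln (e + pi - 0) \<le> pend_time pi q + ln (e + pi - pi)"
  proof (rule DERIV_nonneg_imp_nondecreasing[where f = "\<lambda>\<theta>. pend_time \<theta> q + ln (e + pi - \<theta>)"])
    fix x :: real assume x: "0 \<le> x" "x \<le> pi"
    define u where "u = pi - x"
    have u: "0 \<le> u" "cos x = - cos u" using x by (auto simp: u_def)
    have "(sin (u / 2))\<^sup>2 \<le> (u / 2)\<^sup>2"
      by (rule abs_le_square_iff[THEN iffD1]) (rule abs_sin_x_le_abs_x)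
    then have "1 - cos u \<le> u\<^sup>2 / 2"
      using cos_double_sin[of "u / 2"] by (simp add: power_divide)
    then have "1 - cos u \<le> u\<^sup>2" by (rule order_trans) simp
    have "1 + q * cos x = (1 - q) + q * (1 - cos u)" by (simp add: u algebra_simps)
    also have "\<dots> \<le> (1 - q) + 1 * (1 - cos u)"
      using assms by (intro add_mono mult_right_mono) auto
    also have "\<dots> \<le> e\<^sup>2 + u\<^sup>2" using \<open>1 - cos u \<le> u\<^sup>2\<close> e(2) by simp
    also have "\<dots> \<le> (e + u)\<^sup>2" using e u by (simp add: power2_sum)
    finally have "sqrt (1 + q * cos x) \<le> e + u" using e u by (intro real_le_lsqrt) auto
    then have le: "1 / (e + u) \<le> 1 / sqrt (1 + q * cos x)"
      using pend_pos[OF q, of x] e u by (intro divide_left_mono) auto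
    have "((\<lambda>\<theta>. ln (e + pi - \<theta>)) has_real_derivative - 1 / (e + u)) (at x)"
      using e u by (auto intro!: derivative_eq_intros simp: u_def algebra_simps)
    from DERIV_add[OF pend_time_deriv[OF q, of x] this] le
    show "\<exists>y. ((\<lambda>\<theta>. pend_time \<theta> q + ln (e + pi - \<theta>)) has_real_derivative y) (at x) \<and> 0 \<le> y"
      by (intro exI[of _ "1 / sqrt (1 + q * cos x) + - 1 / (e + u)"]) simp
  qed simp
  then have "ln (e + pi) - ln e \<le> pend_time pi q" by simp
  moreover have "0 < e + pi" using e pi_gt_zero by linarith
  ultimately show ?thesis using e(1) by (simp add: ln_div e_def[symmetric])
qed

definition half_period_inv :: "real \<Rightarrow> real" where
  "half_period_inv y = (THE q. 0 < q \<and> q < 1 \<and> pend_time pi q = y)"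

lemma half_period_inv_time:
  assumes "0 < q" "q < 1" shows "half_period_inv (pend_time pi q) = q"
  unfolding half_period_inv_def
proof (rule the_equality)
  fix r assume "0 < r \<and> r < 1 \<and> pend_time pi r = pend_time pi q"
  then show "r = q"
    using pend_time_pi_strict_mono[of r q] pend_time_pi_strict_mono[of q r] assms by force
qed (use assms in auto)

lemma half_period_inv:
  assumes "pi < y"
  shows "0 < half_period_inv y" "half_period_inv y < 1" "pend_time pi (half_period_inv y) = y"
proof -
  \<comment> \<open>The bound e \<le> pi / exp y makes (e + pi) / e at least exp y, so the
    logarithmic lower bound at b = 1 - e^2 reaches \<open>y\<close>; the 1/2 keeps \<open>b\<close>
    strictly between 0 and 1.\<close>
  define e where "e = min (1/2) (pi / exp y)"
  have e: "0 < e" "e < 1" "e \<le> pi / exp y" by (auto simp: e_def)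
  define b where "b = 1 - e\<^sup>2"
  have b: "0 < b" "b < 1" "sqrt (1 - b) = e"
    using e power_Suc_less_one[of e 1] by (auto simp: b_def power2_eq_square abs_square_less_1 mult_less_cancel_right1)
  have "exp y * e \<le> pi" using e(3) by (simp add: field_simps)
  then have "exp y \<le> (e + pi) / e" using e by (simp add: le_divide_eq)
  then have "y \<le> ln ((e + pi) / e)" using e by (subst ln_ge_iff) (auto intro!: divide_pos_pos add_pos_pos)
  also have "\<dots> \<le> pend_time pi b" using pend_time_pi_lower[of b] b by simp
  finally have "\<exists>q\<ge>0. q \<le> b \<and> pend_time pi q = y"
    using assms b by (intro IVT) (auto simp: pend_time_pi_0 intro!: pend_time_pi_isCont)
  then obtain q where q: "0 \<le> q" "q \<le> b" "pend_time pi q = y" by blast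
  then have "q \<noteq> 0" using assms by (auto simp: pend_time_pi_0)
  then have "0 < q" "q < 1" using q b by auto
  with half_period_inv_time[of q] q
  show "0 < half_period_inv y" "half_period_inv y < 1" "pend_time pi (half_period_inv y) = y" by auto
qed

lemma smooth_half_period_inv: "smooth_on {pi<..} half_period_inv"
proof (rule smooth_on_inverse[of "{0<..<1}" "pend_time pi"])
  show "smooth_on {0<..<1} (pend_time pi)"
    using smooth_on_compose_Pair[OF smooth_pend_time smooth_on_const smooth_on_id, of "{0<..<1}" pi] by simp
qed (auto simp: half_period_inv half_period_inv_time pend_time_pi_deriv)

section \<open>The dnoidal profile\<close>

text \<open>Here k^2 = 2 q / (1 + q) is the inverse of q = k^2 / (2 - k^2), and 1 - k^2 sin^2 s = (1
  + q cos 2s) / (1 + q). The right side is therefore an antiderivative that vanishes at 0, which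
  also covers negative \<theta>.\<close>

lemma elliptic_F_eq_pend_time:
  assumes q: "0 < q" "q < 1"
  shows "elliptic_F \<theta> (sqrt (2 * q / (1 + q))) = sqrt (1 + q) / 2 * pend_time (2 * \<theta>) q"
proof -
  let ?k = "sqrt (2 * q / (1 + q))"
  have aq: "\<bar>q\<bar> < 1" using q by auto
  have eq: "1 - ?k\<^sup>2 * (sin s)\<^sup>2 = (1 + q * cos (2 * s)) / (1 + q)" for s
    unfolding cos_double_sin using q by (simp add: field_simps)
  have pos: "0 < 1 - ?k\<^sup>2 * (sin s)\<^sup>2" for s unfolding eq using pend_pos[OF aq] q by simp
  have D: "((\<lambda>s. sqrt (1 + q) / 2 * pend_time (2 * s) q) has_real_derivative 1 / sqrt (1 - ?k\<^sup>2 * (sin s)\<^sup>2)) (at s)" for s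
  proof -
    have "((\<lambda>s. pend_time (2 * s) q) has_real_derivative 1 / sqrt (1 + q * cos (2 * s)) * 2) (at s)"
      by (rule DERIV_chain2[where f = "\<lambda>\<theta>. pend_time \<theta> q" and g = "\<lambda>s. 2 * s", OF pend_time_deriv[OF aq] DERIV_cmult_Id])
    from DERIV_cmult[OF this, of "sqrt (1 + q) / 2"]
    show ?thesis unfolding eq by (rule DERIV_cong) (simp add: real_sqrt_divide)
  qed
  have "elliptic_F \<theta> ?k = sqrt (1 + q) / 2 * pend_time (2 * \<theta>) q - sqrt (1 + q) / 2 * pend_time (2 * 0) q"
    unfolding elliptic_F_def zero_ereal_def
  proof (rule interval_integral_FTC_finite)
    have "sqrt (1 - ?k\<^sup>2 * (sin s)\<^sup>2) \<noteq> 0" for s using pos[of s] by simp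
    then show "continuous_on {min 0 \<theta>..max 0 \<theta>} (\<lambda>s. 1 / sqrt (1 - ?k\<^sup>2 * (sin s)\<^sup>2))"
      by (intro continuous_intros) auto
    show "((\<lambda>s. sqrt (1 + q) / 2 * pend_time (2 * s) q) has_vector_derivative 1 / sqrt (1 - ?k\<^sup>2 * (sin x)\<^sup>2))
        (at x within {min 0 \<theta>..max 0 \<theta>})" for x
      using D[of x] by (simp only: has_real_derivative_iff_has_vector_derivative has_vector_derivative_at_within)
  qed
  then show ?thesis by simp
qed

text \<open>The Jacobi amplitude is half a pendulum angle, and the half-angle formula turns the
  square of dn into a multiple of 1 + q cos.\<close>

lemma jacobi_dn_eq_pend_angle:
  assumes q: "0 < q" "q < 1"
  shows "jacobi_dn u (sqrt (2 * q / (1 + q))) =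
    sqrt ((1 + q * cos (pend_angle (2 * u / sqrt (1 + q)) q)) / (1 + q))"
proof -
  have aq: "\<bar>q\<bar> < 1" using q by auto
  have s: "sqrt (1 + q) > 0" using q by simp
  have am: "jacobi_am u (sqrt (2 * q / (1 + q))) = pend_angle (2 * u / sqrt (1 + q)) q / 2"
    unfolding jacobi_am_def elliptic_F_eq_pend_time[OF q]
  proof (rule the_equality)
    show "sqrt (1 + q) / 2 * pend_time (2 * (pend_angle (2 * u / sqrt (1 + q)) q / 2)) q = u"
      using s by (simp add: pend_time_angle[OF aq])
    fix \<theta> assume "sqrt (1 + q) / 2 * pend_time (2 * \<theta>) q = u"
    then have "pend_time (2 * \<theta>) q = 2 * u / sqrt (1 + q)" using s by (simp add: field_simps)
    then have "pend_angle (2 * u / sqrt (1 + q)) q = 2 * \<theta>" using pend_angle_time[OF aq, of "2 * \<theta>"] by simp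
    then show "\<theta> = pend_angle (2 * u / sqrt (1 + q)) q / 2" by simp
  qed
  have id: "1 - 2 * q / (1 + q) * (sin (x / 2))\<^sup>2 = (1 + q * cos x) / (1 + q)" for x
  proof -
    have "cos x = 1 - 2 * (sin (x / 2))\<^sup>2" using cos_double_sin[of "x / 2"] by simp
    then show ?thesis using q by (simp only:) (simp add: field_simps)
  qed
  have k2: "(sqrt (2 * q / (1 + q)))\<^sup>2 = 2 * q / (1 + q)" using q by simp
  show ?thesis unfolding jacobi_dn_def am k2 id ..
qed

section \<open>The dnoidal parameters in terms of q\<close>

text \<open>Each y in (0, sqrt \<omega>) has the form sqrt (\<omega> (1 - q)) for exactly one q in
  (0, 1), so the search for \<eta>2 becomes a search for q.\<close>

lemma eta1_of_modulus_of:
  assumes "0 < \<omega>" "0 < q" "q < 1"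
  shows "eta1_of \<omega> (sqrt (\<omega> * (1 - q))) = sqrt (\<omega> * (1 + q))"
    and "modulus_of \<omega> (sqrt (\<omega> * (1 - q))) = sqrt (2 * q / (1 + q))"
proof -
  have "2 * \<omega> - (sqrt (\<omega> * (1 - q)))\<^sup>2 = \<omega> * (1 + q)" using assms by (simp add: algebra_simps)
  then show 1: "eta1_of \<omega> (sqrt (\<omega> * (1 - q))) = sqrt (\<omega> * (1 + q))" unfolding eta1_of_def by simp
  have "(\<omega> * (1 + q) - \<omega> * (1 - q)) / (\<omega> * (1 + q)) = (\<omega> * (2 * q)) / (\<omega> * (1 + q))"
    by (simp add: algebra_simps)
  also have "\<dots> = 2 * q / (1 + q)" using assms by simp
  finally show "modulus_of \<omega> (sqrt (\<omega> * (1 - q))) = sqrt (2 * q / (1 + q))"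
    unfolding modulus_of_def 1 using assms by simp
qed

lemma period_condition_iff:
  assumes "0 < \<omega>" "0 < q" "q < 1"
  shows "sqrt 2 / eta1_of \<omega> (sqrt (\<omega> * (1 - q))) * elliptic_K (modulus_of \<omega> (sqrt (\<omega> * (1 - q)))) = L
    \<longleftrightarrow> pend_time pi q = sqrt (2 * \<omega>) * L"
proof -
  have eq: "sqrt 2 / sqrt (\<omega> * (1 + q)) * (sqrt (1 + q) / 2 * pend_time pi q) = pend_time pi q / (sqrt 2 * sqrt \<omega>)"
  proof -
    have "sqrt 2 / (A * B) * (B / 2 * P) = P / (sqrt 2 * A)" if "0 < A" "0 < B" for A B P :: real
      using that by (simp add: field_simps)
    from this[of "sqrt \<omega>" "sqrt (1 + q)"] show ?thesis using assms by (simp add: real_sqrt_mult)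
  qed
  have K: "elliptic_F (pi / 2) (sqrt (2 * q / (1 + q))) = sqrt (1 + q) / 2 * pend_time pi q"
    using elliptic_F_eq_pend_time[OF assms(2,3), of "pi / 2"] by simp
  show ?thesis
    unfolding eta1_of_modulus_of[OF assms] elliptic_K_def K eq
    using assms(1) by (auto simp: real_sqrt_mult divide_eq_eq mult.commute)
qed

text \<open>In terms of the profile, \<open>pend_param L \<omega>\<close> is \<open>(\<eta>\<^sub>1\<^sup>2 - \<eta>\<^sub>2\<^sup>2) / (2 \<omega>)\<close>.\<close>

definition pend_param :: "real \<Rightarrow> real \<Rightarrow> real" where
  "pend_param L \<omega> = half_period_inv (sqrt (2 * \<omega>) * L)"

text \<open>At the threshold frequency sqrt (2 \<omega>) L equals pi, the half period for q = 0;
  above it the period equation has a solution q > 0.\<close>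

lemma freq_lower_bound:
  assumes "L > 0" "\<omega> > pi\<^sup>2 / (2 * L\<^sup>2)"
  shows "0 < \<omega>" "pi < sqrt (2 * \<omega>) * L"
proof -
  have "0 < pi\<^sup>2 / (2 * L\<^sup>2)" using assms by simp
  then show w: "0 < \<omega>" using assms(2) by linarith
  have "pi\<^sup>2 < (sqrt (2 * \<omega>) * L)\<^sup>2"
    using assms w by (simp add: power_mult_distrib divide_less_eq mult.commute mult.left_commute)
  then show "pi < sqrt (2 * \<omega>) * L"
    using power2_less_imp_less assms w by fastforce
qed

lemma pend_param:
  assumes "L > 0" "\<omega> > pi\<^sup>2 / (2 * L\<^sup>2)"
  shows "0 < pend_param L \<omega>" "pend_param L \<omega> < 1" "pend_time pi (pend_param L \<omega>) = sqrt (2 * \<omega>) * L"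
  using half_period_inv[OF freq_lower_bound(2)[OF assms]] by (auto simp: pend_param_def)

lemma eta2_eq:
  assumes "L > 0" "\<omega> > pi\<^sup>2 / (2 * L\<^sup>2)"
  shows "eta2 L \<omega> = sqrt (\<omega> * (1 - pend_param L \<omega>))"
proof -
  note w = freq_lower_bound(1)[OF assms] and q = pend_param[OF assms]
  show ?thesis
    unfolding eta2_def
  proof (rule the_equality)
    show "0 < sqrt (\<omega> * (1 - pend_param L \<omega>)) \<and> sqrt (\<omega> * (1 - pend_param L \<omega>)) < sqrt \<omega> \<and>
      sqrt 2 / eta1_of \<omega> (sqrt (\<omega> * (1 - pend_param L \<omega>))) *
      elliptic_K (modulus_of \<omega> (sqrt (\<omega> * (1 - pend_param L \<omega>)))) = L"
      using w q period_condition_iff[OF w q(1,2), of L] by simp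
    fix y assume y: "0 < y \<and> y < sqrt \<omega> \<and> sqrt 2 / eta1_of \<omega> y * elliptic_K (modulus_of \<omega> y) = L"
    \<comment> \<open>Uniqueness: any admissible \<open>y\<close> is rewritten through its own
      parameter r, which the injective half period identifies with
      \<open>pend_param\<close>.\<close>
    define r where "r = 1 - y\<^sup>2 / \<omega>"
    have "y\<^sup>2 < \<omega>" using y w by (metis less_eq_real_def power_strict_mono real_sqrt_pow2 zero_less_numeral)
    then have r: "0 < r" "r < 1" using w y by (auto simp: r_def)
    have yr: "y = sqrt (\<omega> * (1 - r))" using w y by (simp add: r_def)
    have "pend_time pi r = sqrt (2 * \<omega>) * L"
      using y period_condition_iff[OF w r, of L] unfolding yr[symmetric] by blast
    then have "r = pend_param L \<omega>" using half_period_inv_time[OF r] by (simp add: pend_param_def)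
    then show "y = sqrt (\<omega> * (1 - pend_param L \<omega>))" using yr by simp
  qed
qed

lemma dn_modulus_eq:
  assumes "L > 0" "\<omega> > pi\<^sup>2 / (2 * L\<^sup>2)"
  shows "dn_modulus L \<omega> = sqrt (2 * pend_param L \<omega> / (1 + pend_param L \<omega>))"
  unfolding dn_modulus_def eta2_eq[OF assms]
  using eta1_of_modulus_of(2)[OF freq_lower_bound(1)[OF assms] pend_param(1,2)[OF assms]] .

lemma dnoidal_eq:
  assumes "L > 0" "\<omega> > pi\<^sup>2 / (2 * L\<^sup>2)"
  shows "dnoidal L \<omega> x =
    sqrt (\<omega> * (1 + pend_param L \<omega> * cos (pend_angle (sqrt (2 * \<omega>) * x) (pend_param L \<omega>))))"
proof -
  note w = freq_lower_bound(1)[OF assms] and q = pend_param[OF assms]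
  have e: "eta1 L \<omega> = sqrt (\<omega> * (1 + pend_param L \<omega>))"
    unfolding eta1_def eta2_eq[OF assms] by (rule eta1_of_modulus_of(1)[OF w q(1,2)])
  have "2 * (sqrt (\<omega> * (1 + pend_param L \<omega>)) / sqrt 2 * x) / sqrt (1 + pend_param L \<omega>) = sqrt (2 * \<omega>) * x"
  proof -
    have "2 * (A * B / sqrt 2 * x) / B = sqrt 2 * A * x" if "0 < A" "0 < B" for A B :: real
      using that by (simp add: field_simps)
    from this[of "sqrt \<omega>" "sqrt (1 + pend_param L \<omega>)"] show ?thesis using w q by (simp add: real_sqrt_mult)
  qed
  then show ?thesis
    unfolding dnoidal_def dn_modulus_eq[OF assms] jacobi_dn_eq_pend_angle[OF q(1,2)] e
    using w q by (simp add: real_sqrt_mult[symmetric])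
qed

lemma smooth_pend_param:
  assumes "L > 0"
  shows "smooth_on {pi\<^sup>2 / (2 * L\<^sup>2)<..} (pend_param L)"
proof -
  have "smooth_on {pi\<^sup>2 / (2 * L\<^sup>2)<..} (\<lambda>\<omega>. sqrt (2 * \<omega>) * L)"
    using freq_lower_bound(1)[OF assms]
    by (intro smooth_on_mult smooth_on_compose_sqrt smooth_on_const smooth_on_id) auto
  then show ?thesis
    unfolding pend_param_def[abs_def]
    by (rule smooth_on_compose[OF smooth_half_period_inv]) (use freq_lower_bound(2)[OF assms] in auto)
qed

text \<open>Since the square of the profile is \<omega> (1 + q cos T) and T' = sqrt 2 times the
  profile, the profile cancels from its first derivative. In the second, \<omega> q cos T is the
  square minus \<omega>, which yields the stationary equation.\<close>

lemma dnoidal_deriv: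
  assumes "L > 0" "\<omega> > pi\<^sup>2 / (2 * L\<^sup>2)"
  defines "q \<equiv> pend_param L \<omega>"
  defines "T x \<equiv> pend_angle (sqrt (2 * \<omega>) * x) q"
  shows "(dnoidal L \<omega> has_real_derivative - \<omega> * q * sin (T x) / sqrt 2) (at x)"
    and "((\<lambda>x. - \<omega> * q * sin (T x) / sqrt 2) has_real_derivative
      \<omega> * dnoidal L \<omega> x - (dnoidal L \<omega> x) ^ 3) (at x)"
proof -
  note w = freq_lower_bound(1)[OF assms(1,2)] and q = pend_param[OF assms(1,2), folded q_def]
  have aq: "\<bar>q\<bar> < 1" using q by auto
  have dn: "dnoidal L \<omega> y = sqrt (\<omega> * (1 + q * cos (T y)))" for y
    unfolding T_def q_def by (rule dnoidal_eq[OF assms(1,2)])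
  have pos: "0 < \<omega> * (1 + q * cos (T y))" for y using w pend_pos[OF aq] by simp
  have dpos: "0 < dnoidal L \<omega> y" for y unfolding dn using pos by simp
  have dsq: "(dnoidal L \<omega> y)\<^sup>2 = \<omega> * (1 + q * cos (T y))" for y unfolding dn using pos[of y] by simp
  have T: "(T has_real_derivative sqrt 2 * dnoidal L \<omega> y) (at y)" for y
  proof -
    have "(T has_real_derivative sqrt (1 + q * cos (T y)) * sqrt (2 * \<omega>)) (at y)"
      unfolding T_def
      by (rule DERIV_chain2[where f = "\<lambda>y. pend_angle y q" and g = "\<lambda>x. sqrt (2 * \<omega>) * x",
            OF pend_angle_deriv[OF aq] DERIV_cmult_Id])
    then show ?thesis unfolding dn by (simp add: real_sqrt_mult ac_simps)
  qed
  have c: "((\<lambda>x. \<omega> * (1 + q * cos (T x))) has_real_derivative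
      - \<omega> * q * sin (T y) * (sqrt 2 * dnoidal L \<omega> y)) (at y)" for y
    using T[of y] by (auto intro!: derivative_eq_intros)
  have "(dnoidal L \<omega> has_real_derivative
      inverse (sqrt (\<omega> * (1 + q * cos (T x)))) / 2 * (- \<omega> * q * sin (T x) * (sqrt 2 * dnoidal L \<omega> x))) (at x)"
    unfolding dn[abs_def]
    by (rule DERIV_chain2[where f = sqrt and g = "\<lambda>x. \<omega> * (1 + q * cos (T x))", OF DERIV_real_sqrt[OF pos] c[unfolded dn]])
  also have "inverse (sqrt (\<omega> * (1 + q * cos (T x)))) / 2 * (- \<omega> * q * sin (T x) * (sqrt 2 * dnoidal L \<omega> x))
      = - \<omega> * q * sin (T x) / sqrt 2"
    unfolding dn[symmetric] using dpos[of x] by (simp add: field_simps)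
  finally show "(dnoidal L \<omega> has_real_derivative - \<omega> * q * sin (T x) / sqrt 2) (at x)" .
  have "((\<lambda>x. - \<omega> * q * sin (T x) / sqrt 2) has_real_derivative
      - \<omega> * q * (cos (T x) * (sqrt 2 * dnoidal L \<omega> x)) / sqrt 2) (at x)"
    by (intro DERIV_cdivide DERIV_cmult DERIV_chain2[where f = sin and g = T, OF DERIV_sin T])
  also have "- \<omega> * q * (cos (T x) * (sqrt 2 * dnoidal L \<omega> x)) / sqrt 2 = (\<omega> - (dnoidal L \<omega> x)\<^sup>2) * dnoidal L \<omega> x"
    unfolding dsq by (simp add: algebra_simps)
  also have "\<dots> = \<omega> * dnoidal L \<omega> x - (dnoidal L \<omega> x) ^ 3"
    by (simp add: algebra_simps power2_eq_square power3_eq_cube)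
  finally show "((\<lambda>x. - \<omega> * q * sin (T x) / sqrt 2) has_real_derivative
      \<omega> * dnoidal L \<omega> x - (dnoidal L \<omega> x) ^ 3) (at x)" .
qed

lemma pend_angle_period:
  assumes "\<bar>q\<bar> < 1"
  shows "pend_angle (y + 2 * pend_time pi q) q = pend_angle y q + 2 * pi"
  using pend_angle_time[OF assms, of "pend_angle y q + 2 * pi"]
  by (simp add: pend_time_add_2pi[OF assms] pend_time_angle[OF assms])

section \<open>Matching at the vertex\<close>

lemma tanh_artanh_real:
  assumes "\<bar>x :: real\<bar> < 1"
  shows "tanh (artanh x) = x"
proof -
  have "exp (- 2 * artanh x) = exp (- ln ((1 + x) / (1 - x)))" by (simp add: artanh_def)
  also have "\<dots> = (1 - x) / (1 + x)" using assms by (simp add: exp_minus)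
  finally have e: "exp (- 2 * artanh x) = (1 - x) / (1 + x)" .
  have "0 < 1 + x" using assms by linarith
  then show ?thesis unfolding tanh_real_altdef e by (simp add: field_simps)
qed

lemma inverse_cosh_square: "(1 / cosh x)\<^sup>2 = 1 - (tanh x :: real)\<^sup>2"
proof -
  have "(1 / cosh x)\<^sup>2 = ((cosh x)\<^sup>2 - (sinh x)\<^sup>2) / (cosh x)\<^sup>2"
    unfolding hyperbolic_pythagoras by (simp add: power_divide)
  also have "\<dots> = 1 - (tanh x)\<^sup>2" by (simp add: diff_divide_distrib tanh_def power_divide)
  finally show ?thesis .
qed

lemma traces_of_real:
  fixes f f' :: "real \<Rightarrow> real"
  assumes J: "open J" "convex J" "J \<noteq> {}" and c: "c \<in> closure J"
    and f: "\<And>x. (f has_real_derivative f' x) (at x)" and f': "continuous_on UNIV f'"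
  shows "trace_at J (\<lambda>x. of_real (f x)) c = of_real (f c)"
    and "trace_deriv_at J (\<lambda>x. of_real (f x)) c = of_real (f' c)"
proof -
  have "continuous_on UNIV f"
    using f DERIV_isCont continuous_at_imp_continuous_on by blast
  then have cf: "continuous_on A (\<lambda>x. complex_of_real (f x))" for A
    by (intro continuous_intros) (auto intro: continuous_on_subset)
  have cf': "continuous_on A (\<lambda>x. complex_of_real (f' x))" for A
    using f' by (intro continuous_intros) (auto intro: continuous_on_subset)
  show "trace_at J (\<lambda>x. of_real (f x)) c = of_real (f c)"
    by (rule trace_at_eq[OF J(1) c cf]) simp
  have "has_weak_deriv J (\<lambda>x. of_real (f x)) (\<lambda>x. of_real (f' x))"
    using f cf' by (intro has_weak_derivI J has_vector_derivative_of_real)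
      (auto simp: has_real_derivative_iff_has_vector_derivative)
  then show "trace_deriv_at J (\<lambda>x. of_real (f x)) c = of_real (f' c)"
    by (intro trace_at_eq[OF J(1) c cf'] weak_deriv_AE J(1))
qed

text \<open>The relation between amplitude \<open>m\<close> and rate \<open>s\<close> gives \<psi>^2
  = 2 s^2 (1 - tanh^2), which converts the hyperbolic terms of the second derivative into the cubic
  one.\<close>

lemma sech_ode:
  fixes A s L m :: real
  defines "W x \<equiv> s * (x - L) + A" and "\<psi> x \<equiv> m * (1 / cosh (s * (x - L) + A))"
  assumes m: "m\<^sup>2 = 2 * s\<^sup>2"
  shows "(\<psi> has_real_derivative - s * tanh (W x) * \<psi> x) (at x)"
    and "((\<lambda>x. - s * tanh (W x) * \<psi> x) has_real_derivative s\<^sup>2 * \<psi> x - (\<psi> x) ^ 3) (at x)"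
proof -
  have W: "(W has_real_derivative s) (at x)" for x
    unfolding W_def by (auto intro!: derivative_eq_intros)
  have d1: "(\<psi> has_real_derivative - s * tanh (W x) * \<psi> x) (at x)" for x
    using DERIV_cmult[OF tanh_power_div_cosh_deriv[OF W[of x], of 0], of m]
    by (simp add: \<psi>_def[abs_def] W_def mult_ac)
  then show "(\<psi> has_real_derivative - s * tanh (W x) * \<psi> x) (at x)" .
  have t: "((\<lambda>x. tanh (W x)) has_real_derivative (1 - (tanh (W x))\<^sup>2) * s) (at x)"
    by (intro has_field_derivative_tanh W) simp
  have "((\<lambda>x. - s * tanh (W x) * \<psi> x) has_real_derivative
      - s * ((1 - (tanh (W x))\<^sup>2) * s) * \<psi> x + (- s * tanh (W x) * \<psi> x) * (- s * tanh (W x))) (at x)"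
    by (rule DERIV_mult[OF DERIV_cmult[OF t] d1])
  also have "- s * ((1 - (tanh (W x))\<^sup>2) * s) * \<psi> x + (- s * tanh (W x) * \<psi> x) * (- s * tanh (W x))
      = s\<^sup>2 * \<psi> x - 2 * s\<^sup>2 * (1 - (tanh (W x))\<^sup>2) * \<psi> x"
    by (simp add: algebra_simps power2_eq_square)
  also have "2 * s\<^sup>2 * (1 - (tanh (W x))\<^sup>2) = (\<psi> x)\<^sup>2"
  proof -
    show ?thesis
      using m unfolding inverse_cosh_square[symmetric] by (simp add: \<psi>_def W_def power_divide)
  qed
  finally show "((\<lambda>x. - s * tanh (W x) * \<psi> x) has_real_derivative s\<^sup>2 * \<psi> x - (\<psi> x) ^ 3) (at x)"
    by (simp add: power2_eq_square power3_eq_cube mult.assoc)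
qed

text \<open>The inverse hyperbolic tangent in the phase makes tanh at the vertex equal to c / sqrt
  \<omega>, so the logarithmic derivative of the tail there is - c. The condition on \<omega> is
  what puts the argument into (-1, 1).\<close>

lemma tail_at_vertex:
  assumes "Z < 0" "\<omega> > (real N)\<^sup>2 / Z\<^sup>2"
  defines "c \<equiv> - real N / Z"
  shows "tanh (artanh (- real N / (Z * sqrt \<omega>))) = c / sqrt \<omega>"
    and "tail N Z L \<omega> L = sqrt 2 * sqrt (\<omega> - c\<^sup>2)"
    and "\<bar>- real N / (Z * sqrt \<omega>)\<bar> < 1"
proof -
  have c: "0 \<le> c" "c\<^sup>2 < \<omega>" using assms by (auto simp: c_def power_divide divide_nonneg_neg)
  then have w: "0 < \<omega>" using zero_le_power2[of c] by linarith
  have "c < sqrt \<omega>" using c by (simp add: real_less_rsqrt)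
  then have r: "\<bar>c / sqrt \<omega>\<bar> < 1" using c w by simp
  have e: "- real N / (Z * sqrt \<omega>) = c / sqrt \<omega>" by (simp add: c_def)
  show "\<bar>- real N / (Z * sqrt \<omega>)\<bar> < 1" unfolding e by (rule r)
  show t: "tanh (artanh (- real N / (Z * sqrt \<omega>))) = c / sqrt \<omega>"
    unfolding e by (rule tanh_artanh_real[OF r])
  define A where "A = artanh (- real N / (Z * sqrt \<omega>))"
  have "(1 / cosh A)\<^sup>2 = 1 - (tanh A)\<^sup>2" by (rule inverse_cosh_square)
  also have "\<dots> = (\<omega> - c\<^sup>2) / \<omega>"
    unfolding A_def t using w by (simp add: power_divide field_simps)
  finally have "1 / cosh A = sqrt ((\<omega> - c\<^sup>2) / \<omega>)"
    by (intro real_sqrt_unique[symmetric]) auto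
  then have "tail N Z L \<omega> L = sqrt (2 * \<omega>) * sqrt ((\<omega> - c\<^sup>2) / \<omega>)" by (simp add: tail_def A_def)
  also have "\<dots> = sqrt 2 * sqrt (\<omega> - c\<^sup>2)" using w by (simp add: real_sqrt_mult real_sqrt_divide)
  finally show "tail N Z L \<omega> L = sqrt 2 * sqrt (\<omega> - c\<^sup>2)" .
qed

text \<open>The loop derivative at phase \<open>T\<close> is \<open>- \<omega> q sin T / sqrt 2\<close>, so matching it with the tail derivative
  at the vertex prescribes \<open>sin T\<close>; the branch \<open>T < pi / 2\<close> of the arcsine is the one with
  \<open>\<Phi>\<^sub>\<omega>\<^sup>2 > \<omega>\<close>.\<close>

definition vertex_sine :: "nat \<Rightarrow> real \<Rightarrow> real \<Rightarrow> real \<Rightarrow> real" where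
  "vertex_sine N Z L \<omega> = 2 * (- real N / Z) * sqrt (\<omega> - (real N)\<^sup>2 / Z\<^sup>2) / (\<omega> * pend_param L \<omega>)"

text \<open>Solved from the demand that the scaled argument sqrt (2 \<omega>) (L - a) at the vertex
  be the pendulum time of the prescribed arcsine, so that \<open>pend_angle\<close> returns this
  arcsine there.\<close>

definition loop_shift :: "nat \<Rightarrow> real \<Rightarrow> real \<Rightarrow> real \<Rightarrow> real" where
  "loop_shift N Z L \<omega> = L - pend_time (arcsin (vertex_sine N Z L \<omega>)) (pend_param L \<omega>) / sqrt (2 * \<omega>)"

section \<open>Frequencies in the set I\<close>

context
  fixes L Z :: real and N :: nat
  assumes L: "L > 0" and Z: "Z < 0" and N: "N \<ge> 1"
begin

lemma freq_setD:
  assumes "\<omega> \<in> freq_set N Z L"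
  shows "\<omega> > pi\<^sup>2 / (2 * L\<^sup>2)" "\<omega> > (real N)\<^sup>2 / Z\<^sup>2" "\<omega> > 0"
  using assms freq_lower_bound(1)[OF L] by (auto simp: freq_set_def omega_min_def)

lemma open_freq_set: "open (freq_set N Z L)"
proof -
  have "freq_set N Z L = {omega_min N Z L<..} \<inter> {\<omega>. 0 < Z\<^sup>2 * (k0 N Z L)^4 / (16 * (real N)\<^sup>2) * \<omega>\<^sup>2 - \<omega> + (real N)\<^sup>2 / Z\<^sup>2}"
    by (auto simp: freq_set_def)
  moreover have "open {\<omega>. 0 < Z\<^sup>2 * (k0 N Z L)^4 / (16 * (real N)\<^sup>2) * \<omega>\<^sup>2 - \<omega> + (real N)\<^sup>2 / Z\<^sup>2}"
    by (intro open_Collect_less continuous_intros)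
  ultimately show ?thesis by (simp add: open_Int)
qed

lemma k0_bounds:
  assumes "\<omega> > omega_min N Z L"
  shows "0 \<le> k0 N Z L" "(k0 N Z L) ^ 4 \<le> 4 * (pend_param L \<omega>)\<^sup>2"
proof -
  have dn: "dn_modulus L \<mu> = sqrt (2 * pend_param L \<mu> / (1 + pend_param L \<mu>))"
    "0 < pend_param L \<mu>" "pend_param L \<mu> < 1" if "\<mu> > omega_min N Z L" for \<mu>
    using dn_modulus_eq[OF L] pend_param[OF L] that by (auto simp: omega_min_def)
  have nonneg: "0 \<le> dn_modulus L \<mu>" if "\<mu> > omega_min N Z L" for \<mu> using dn[OF that] by simp
  show k: "0 \<le> k0 N Z L"
    unfolding k0_def using assms nonneg by (intro cINF_greatest) auto
  have "k0 N Z L \<le> dn_modulus L \<omega>"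
    unfolding k0_def using assms nonneg by (intro cINF_lower bdd_belowI[of _ 0]) auto
  then have "(k0 N Z L)\<^sup>2 \<le> (dn_modulus L \<omega>)\<^sup>2" using k by (intro power_mono)
  also have "\<dots> = 2 * pend_param L \<omega> / (1 + pend_param L \<omega>)" using dn[OF assms] by simp
  also have "\<dots> \<le> 2 * pend_param L \<omega>" using dn[OF assms] by (simp add: divide_le_eq)
  finally have "((k0 N Z L)\<^sup>2)\<^sup>2 \<le> (2 * pend_param L \<omega>)\<^sup>2" by (intro power_mono) auto
  then show "(k0 N Z L) ^ 4 \<le> 4 * (pend_param L \<omega>)\<^sup>2" by (simp add: power_mult_distrib)
qed

text \<open>With c = - N / Z, being less than 1 squares to 4 c^2 (\<omega> - c^2) < (\<omega> q)^2.
  Replacing q^2 by its lower bound k0^4 / 4 and dividing by 4 c^2 leaves exactly the positivity of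
  the quadratic in \<open>freq_set\<close>, which is where its 16 comes from.\<close>

lemma vertex_sine_bounds:
  assumes w: "\<omega> \<in> freq_set N Z L"
  shows "0 < vertex_sine N Z L \<omega>" "vertex_sine N Z L \<omega> < 1"
proof -
  note W = freq_setD[OF w] and q = pend_param[OF L freq_setD(1)[OF w]]
  define c where "c = - real N / Z"
  have c: "0 < c" "c\<^sup>2 = (real N)\<^sup>2 / Z\<^sup>2" using Z N by (auto simp: c_def power_divide divide_pos_neg)
  have d: "0 < \<omega> * pend_param L \<omega>" using W q by simp
  show "0 < vertex_sine N Z L \<omega>"
    unfolding vertex_sine_def c_def[symmetric] c(2)[symmetric] using c d W by simp
  have "omega_min N Z L < \<omega>" using w by (simp add: freq_set_def)
  note k0 = k0_bounds[OF this]
  have ek: "Z\<^sup>2 * (k0 N Z L)^4 / (16 * (real N)\<^sup>2) = (k0 N Z L)^4 / (16 * c\<^sup>2)"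
    using Z N by (simp add: c(2))
  have "0 < (k0 N Z L)^4 / (16 * c\<^sup>2) * \<omega>\<^sup>2 - \<omega> + c\<^sup>2"
    using w unfolding freq_set_def ek mem_Collect_eq c(2) by blast
  then have "\<omega> - c\<^sup>2 < (k0 N Z L)^4 / (16 * c\<^sup>2) * \<omega>\<^sup>2" by linarith
  also have "\<dots> \<le> 4 * (pend_param L \<omega>)\<^sup>2 / (16 * c\<^sup>2) * \<omega>\<^sup>2"
    using k0(2) c by (intro mult_right_mono divide_right_mono) auto
  finally have "4 * c\<^sup>2 * (\<omega> - c\<^sup>2) < (\<omega> * pend_param L \<omega>)\<^sup>2"
    using c(1) by (simp add: field_simps power_mult_distrib)
  moreover have "(2 * c * sqrt (\<omega> - c\<^sup>2))\<^sup>2 = 4 * c\<^sup>2 * (\<omega> - c\<^sup>2)"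
    using W c by (simp add: power_mult_distrib)
  ultimately have "2 * c * sqrt (\<omega> - c\<^sup>2) < \<omega> * pend_param L \<omega>"
    using d by (metis less_imp_le power2_less_imp_less)
  then show "vertex_sine N Z L \<omega> < 1"
    unfolding vertex_sine_def c_def[symmetric] c(2)[symmetric] using d by (simp add: divide_less_eq)
qed

text \<open>The angle at the vertex lies strictly between 0 and pi, and the pendulum times of these
  two angles are 0 and sqrt (2 \<omega>) L; monotonicity places L - a strictly between 0 and
  L.\<close>

lemma loop_shift_bounds:
  assumes w: "\<omega> \<in> freq_set N Z L"
  shows "0 < loop_shift N Z L \<omega>" "loop_shift N Z L \<omega> < L"
proof -
  note W = freq_setD[OF w] and q = pend_param[OF L freq_setD(1)[OF w]] and v = vertex_sine_bounds[OF w]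
  define T where "T = arcsin (vertex_sine N Z L \<omega>)"
  have aq: "\<bar>pend_param L \<omega>\<bar> < 1" using q by auto
  have "arcsin 0 < T" unfolding T_def using v by (intro arcsin_less_arcsin) auto
  then have T: "0 < T" by simp
  have "T \<le> pi / 2" unfolding T_def using v by (intro arcsin_ubound) auto
  then have T2: "T < pi" using pi_gt_zero by linarith
  have "0 < pend_time T (pend_param L \<omega>)"
    using pend_time_strict_mono[OF aq T] by simp
  then show "loop_shift N Z L \<omega> < L" using W by (simp add: loop_shift_def T_def)
  have "pend_time T (pend_param L \<omega>) < sqrt (2 * \<omega>) * L"
    using pend_time_strict_mono[OF aq T2] q(3) by simp
  then show "0 < loop_shift N Z L \<omega>"
    using W by (simp add: loop_shift_def T_def divide_less_eq mult.commute)
qed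

lemma smooth_loop_shift: "smooth_on (freq_set N Z L) (loop_shift N Z L)"
proof -
  let ?S = "freq_set N Z L"
  note op = open_freq_set
  have q: "smooth_on ?S (pend_param L)"
    by (rule smooth_on_subset[OF smooth_pend_param[OF L]]) (use freq_setD in auto)
  note qb = pend_param[OF L freq_setD(1)]
  have v: "smooth_on ?S (vertex_sine N Z L)"
    unfolding vertex_sine_def[abs_def]
    by (intro smooth_on_divide op smooth_on_mult smooth_on_const smooth_on_compose_sqrt smooth_on_diff smooth_on_id q)
       (use freq_setD qb in auto)
  have T: "smooth_on ?S (\<lambda>\<omega>. arcsin (vertex_sine N Z L \<omega>))"
  proof (rule smooth_on_compose[OF smooth_on_arcsin v])
    show "vertex_sine N Z L \<omega> \<in> {-1<..<1}" if "\<omega> \<in> ?S" for \<omega> using vertex_sine_bounds[OF that] by simp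
  qed
  have "smooth_on ?S (\<lambda>\<omega>. pend_time (arcsin (vertex_sine N Z L \<omega>)) (pend_param L \<omega>))"
  proof -
    have "smooth_on ?S (\<lambda>\<omega>. (\<lambda>p. pend_time (fst p) (snd p)) (arcsin (vertex_sine N Z L \<omega>), pend_param L \<omega>))"
    proof (rule smooth_on_compose_Pair[OF smooth_pend_time T q])
      show "(arcsin (vertex_sine N Z L \<omega>), pend_param L \<omega>) \<in> UNIV \<times> {-1<..<1}" if "\<omega> \<in> ?S" for \<omega>
        using qb[OF that] by simp
    qed
    then show ?thesis by simp
  qed
  then show ?thesis
    unfolding loop_shift_def[abs_def]
    by (intro smooth_on_divide op smooth_on_mult smooth_on_const smooth_on_compose_sqrt smooth_on_diff smooth_on_id)
       (use freq_setD in auto)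
qed

lemma smooth_loop_profile:
  "smooth_on (freq_set N Z L \<times> UNIV) (\<lambda>p. dnoidal L (fst p) (snd p - loop_shift N Z L (fst p)))"
proof -
  let ?S = "freq_set N Z L \<times> (UNIV :: real set)"
  have op: "open ?S" using open_freq_set by (intro open_Times) auto
  have fst: "smooth_on ?S (\<lambda>p. h (fst p))" if "smooth_on (freq_set N Z L) h" for h
    by (rule smooth_on_compose[OF that smooth_on_fst]) auto
  have q: "smooth_on ?S (\<lambda>p. pend_param L (fst p))"
    by (rule fst[OF smooth_on_subset[OF smooth_pend_param[OF L]]]) (use freq_setD in auto)
  note qb = pend_param[OF L freq_setD(1)]
  have y: "smooth_on ?S (\<lambda>p. sqrt (2 * fst p) * (snd p - loop_shift N Z L (fst p)))"
    by (intro op smooth_on_mult smooth_on_const smooth_on_compose_sqrt smooth_on_diff smooth_on_fst smooth_on_snd fst[OF smooth_loop_shift])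
       (use freq_setD in auto)
  have "smooth_on ?S (\<lambda>p. (\<lambda>p. pend_angle (fst p) (snd p)) (sqrt (2 * fst p) * (snd p - loop_shift N Z L (fst p)), pend_param L (fst p)))"
  proof (rule smooth_on_compose_Pair[OF smooth_pend_angle y q])
    show "(sqrt (2 * fst p) * (snd p - loop_shift N Z L (fst p)), pend_param L (fst p)) \<in> UNIV \<times> {-1<..<1}" if "p \<in> ?S" for p
      using qb[of "fst p"] that by auto
  qed
  then have T: "smooth_on ?S (\<lambda>p. pend_angle (sqrt (2 * fst p) * (snd p - loop_shift N Z L (fst p))) (pend_param L (fst p)))"
    by simp
  have cT: "smooth_on ?S (\<lambda>p. cos (pend_angle (sqrt (2 * fst p) * (snd p - loop_shift N Z L (fst p))) (pend_param L (fst p))))"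
    by (rule smooth_on_compose[OF smooth_on_cos T]) auto
  show ?thesis
  proof (rule smooth_on_cong[OF op])
    show "smooth_on ?S (\<lambda>p. sqrt (fst p * (1 + pend_param L (fst p) *
        cos (pend_angle (sqrt (2 * fst p) * (snd p - loop_shift N Z L (fst p))) (pend_param L (fst p))))))"
    proof (rule smooth_on_compose_sqrt[OF op])
      show "0 < fst p * (1 + pend_param L (fst p) * cos (pend_angle (sqrt (2 * fst p) * (snd p - loop_shift N Z L (fst p))) (pend_param L (fst p))))"
        if "p \<in> ?S" for p
        using that qb[of "fst p"] freq_setD(3)[of "fst p"] by (intro mult_pos_pos pend_pos) auto
    qed (intro smooth_on_mult smooth_on_add smooth_on_const smooth_on_fst q cT)
    show "sqrt (fst p * (1 + pend_param L (fst p) *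
        cos (pend_angle (sqrt (2 * fst p) * (snd p - loop_shift N Z L (fst p))) (pend_param L (fst p)))))
        = dnoidal L (fst p) (snd p - loop_shift N Z L (fst p))" if "p \<in> ?S" for p
      using that by (intro dnoidal_eq[OF L freq_setD(1), symmetric]) auto
  qed
qed

lemma smooth_tail_phase: "smooth_on (freq_set N Z L) (\<lambda>\<omega>. artanh (- real N / (Z * sqrt \<omega>)))"
proof (rule smooth_on_compose[OF smooth_on_artanh])
  have "smooth_on (freq_set N Z L) (\<lambda>\<omega>. (- real N / Z) * (1 / sqrt \<omega>))"
    by (intro smooth_on_divide open_freq_set smooth_on_mult smooth_on_const smooth_on_compose_sqrt smooth_on_id)
       (use freq_setD in auto)
  then show "smooth_on (freq_set N Z L) (\<lambda>\<omega>. - real N / (Z * sqrt \<omega>))" by simp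
  show "- real N / (Z * sqrt \<omega>) \<in> {-1<..<1}" if "\<omega> \<in> freq_set N Z L" for \<omega>
    using tail_at_vertex(3)[OF Z freq_setD(2)[OF that]] by (simp only: abs_less_iff) auto
qed

lemma tail_in_sech_span:
  "tail N Z L \<in> sech_span (freq_set N Z L) sqrt (\<lambda>\<omega>. artanh (- real N / (Z * sqrt \<omega>))) L"
proof -
  have "smooth_on (freq_set N Z L) (\<lambda>\<omega>. sqrt (2 * \<omega>))"
    by (intro open_freq_set smooth_on_mult smooth_on_const smooth_on_compose_sqrt smooth_on_id)
       (use freq_setD in auto)
  from sech_span.mono[OF this, of sqrt "\<lambda>\<omega>. artanh (- real N / (Z * sqrt \<omega>))" L 0 0]
  show ?thesis by (simp add: sech_tanh_def[abs_def] tail_def[abs_def])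
qed

lemma dominated_class_tail:
  "dominated_class (freq_set N Z L) {L<..} (sech_span (freq_set N Z L) sqrt (\<lambda>\<omega>. artanh (- real N / (Z * sqrt \<omega>))) L)"
proof (rule dominated_class_sech_span[OF open_freq_set _ smooth_tail_phase])
  show "smooth_on (freq_set N Z L) sqrt"
    using smooth_on_compose_sqrt[OF open_freq_set smooth_on_id] freq_setD by simp
qed (use freq_setD in auto)

section \<open>Boundary conditions at the vertex\<close>

text \<open>The arguments at the two ends of the loop differ by a full period 2 L, so the angles
  differ by 2 pi; this settles continuity of the loop and of its derivative at once.\<close>

lemma dnoidal_at_vertex:
  assumes w: "\<omega> \<in> freq_set N Z L"
  defines "a \<equiv> loop_shift N Z L \<omega>" and "q \<equiv> pend_param L \<omega>"
  shows "dnoidal L \<omega> (- L - a) = dnoidal L \<omega> (L - a)"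
    and "sin (pend_angle (sqrt (2 * \<omega>) * (- L - a)) q) = sin (pend_angle (sqrt (2 * \<omega>) * (L - a)) q)"
    and "sin (pend_angle (sqrt (2 * \<omega>) * (L - a)) q) = vertex_sine N Z L \<omega>"
proof -
  note W = freq_setD[OF w] and qb = pend_param[OF L freq_setD(1)[OF w], folded q_def]
  have aq: "\<bar>q\<bar> < 1" using qb by auto
  have "sqrt (2 * \<omega>) * (L - a) = sqrt (2 * \<omega>) * (- L - a) + 2 * pend_time pi q"
    unfolding qb(3) by (simp add: algebra_simps)
  then have p: "pend_angle (sqrt (2 * \<omega>) * (L - a)) q = pend_angle (sqrt (2 * \<omega>) * (- L - a)) q + 2 * pi"
    using pend_angle_period[OF aq] by simp
  then show "sin (pend_angle (sqrt (2 * \<omega>) * (- L - a)) q) = sin (pend_angle (sqrt (2 * \<omega>) * (L - a)) q)"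
    by simp
  show "dnoidal L \<omega> (- L - a) = dnoidal L \<omega> (L - a)"
    unfolding dnoidal_eq[OF L W(1)] q_def[symmetric] p by simp
  have "sqrt (2 * \<omega>) * (L - a) = pend_time (arcsin (vertex_sine N Z L \<omega>)) q"
    using W by (simp add: a_def loop_shift_def q_def)
  then have "pend_angle (sqrt (2 * \<omega>) * (L - a)) q = arcsin (vertex_sine N Z L \<omega>)"
    using pend_angle_time[OF aq] by simp
  then show "sin (pend_angle (sqrt (2 * \<omega>) * (L - a)) q) = vertex_sine N Z L \<omega>"
    using vertex_sine_bounds[OF w] by simp
qed

lemma Theta_eq: "e \<noteq> 0 \<Longrightarrow> Theta N Z L a \<omega> e = (\<lambda>x. of_real (tail N Z L \<omega> x))"
  and Theta_0_eq: "Theta N Z L a \<omega> 0 = (\<lambda>x. of_real (dnoidal L \<omega> (x - a)))"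
  by (auto simp: Theta_def fun_eq_iff)

lemma loop_deriv:
  fixes a :: real
  assumes w: "\<omega> \<in> freq_set N Z L"
  defines "d x \<equiv> - \<omega> * pend_param L \<omega> * sin (pend_angle (sqrt (2 * \<omega>) * (x - a)) (pend_param L \<omega>)) / sqrt 2"
  shows "((\<lambda>x. dnoidal L \<omega> (x - a)) has_real_derivative d x) (at x)"
    and "(d has_real_derivative \<omega> * dnoidal L \<omega> (x - a) - (dnoidal L \<omega> (x - a)) ^ 3) (at x)"
proof -
  have s: "((\<lambda>x. x - a) has_real_derivative 1) (at x)" by (auto intro!: derivative_eq_intros)
  note D = dnoidal_deriv[OF L freq_setD(1)[OF w], of "x - a"]
  show "((\<lambda>x. dnoidal L \<omega> (x - a)) has_real_derivative d x) (at x)"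
    using DERIV_chain2[where f = "dnoidal L \<omega>" and g = "\<lambda>x. x - a", OF D(1) s] by (simp add: d_def)
  show "(d has_real_derivative \<omega> * dnoidal L \<omega> (x - a) - (dnoidal L \<omega> (x - a)) ^ 3) (at x)"
    using DERIV_chain2[where g = "\<lambda>x. x - a", OF D(2) s] by (simp add: d_def[abs_def])
qed

lemma tail_deriv:
  assumes w: "\<omega> \<in> freq_set N Z L"
  defines "d x \<equiv> - sqrt \<omega> * tanh (sqrt \<omega> * (x - L) + artanh (- real N / (Z * sqrt \<omega>))) * tail N Z L \<omega> x"
  shows "(tail N Z L \<omega> has_real_derivative d x) (at x)"
    and "(d has_real_derivative \<omega> * tail N Z L \<omega> x - (tail N Z L \<omega> x) ^ 3) (at x)"
proof -
  have w0: "0 < \<omega>" using freq_setD[OF w] by simp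
  have "(sqrt (2 * \<omega>))\<^sup>2 = 2 * (sqrt \<omega>)\<^sup>2" using w0 by simp
  note D = sech_ode[OF this, of L "artanh (- real N / (Z * sqrt \<omega>))" x]
  show "(tail N Z L \<omega> has_real_derivative d x) (at x)"
    using D(1) by (simp add: d_def tail_def[abs_def])
  show "(d has_real_derivative \<omega> * tail N Z L \<omega> x - (tail N Z L \<omega> x) ^ 3) (at x)"
    using D(2) w0 by (simp add: d_def[abs_def] tail_def[abs_def])
qed

lemma standing_wave_Theta:
  assumes w: "\<omega> \<in> freq_set N Z L"
  shows "standing_wave N L \<omega> (Theta N Z L a \<omega>)"
  unfolding standing_wave_def
proof (intro allI impI)
  have *: "\<exists>U1 U2. \<forall>x\<in>J. ((\<lambda>x. complex_of_real (u x)) has_vector_derivative U1 x) (at x) \<and> (U1 has_vector_derivative U2 x) (at x) \<and>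
     - U2 x + of_real \<omega> * of_real (u x) - of_real ((norm (complex_of_real (u x)))\<^sup>2) * of_real (u x) = 0"
    if d: "\<And>x. (u has_real_derivative d x) (at x)" "\<And>x. (d has_real_derivative \<omega> * u x - (u x) ^ 3) (at x)" for u d J
  proof (intro exI ballI conjI)
    show "((\<lambda>x. complex_of_real (u x)) has_vector_derivative of_real (d x)) (at x)" for x
      by (rule has_vector_derivative_of_real[OF d(1)])
    show "((\<lambda>x. complex_of_real (d x)) has_vector_derivative of_real (\<omega> * u x - (u x) ^ 3)) (at x)" for x
      by (rule has_vector_derivative_of_real[OF d(2)])
    show "- complex_of_real (\<omega> * u x - (u x) ^ 3) + of_real \<omega> * of_real (u x) - of_real ((norm (complex_of_real (u x)))\<^sup>2) * of_real (u x) = 0" for x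
      by (simp add: power2_eq_square power3_eq_cube)
  qed
  fix e
  show "\<exists>U1 U2. \<forall>x\<in>edge L e. (Theta N Z L a \<omega> e has_vector_derivative U1 x) (at x) \<and> (U1 has_vector_derivative U2 x) (at x) \<and>
     - U2 x + of_real \<omega> * Theta N Z L a \<omega> e x - of_real ((norm (Theta N Z L a \<omega> e x))\<^sup>2) * Theta N Z L a \<omega> e x = 0"
  proof (cases "e = 0")
    case True
    show ?thesis unfolding True Theta_0_eq by (rule *[OF loop_deriv[OF w]])
  next
    case False
    show ?thesis unfolding Theta_eq[OF False] by (rule *[OF tail_deriv[OF w]])
  qed
qed

lemma Theta_in_D'_dom:
  assumes w: "\<omega> \<in> freq_set N Z L"
  shows "Theta N Z L (loop_shift N Z L \<omega>) \<omega> \<in> D'_dom N Z L"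
proof -
  let ?a = "loop_shift N Z L \<omega>" and ?U = "Theta N Z L (loop_shift N Z L \<omega>) \<omega>"
  have J0: "open {-L<..<L}" "convex {-L<..<L}" "{-L<..<L} \<noteq> {}" using L by auto
  have J1: "open {L<..}" "convex {L<..}" "{L<..} \<noteq> {}" by (auto intro: exI[of _ "L + 1"])
  have "(\<lambda>x. complex_of_real (dnoidal L \<omega> (x - ?a))) \<in> sobolev 2 {-L<..<L}"
    using dominated_class_sobolev[OF open_freq_set J0 dominated_class_smooth[OF open_freq_set] _ w,
        of "\<lambda>\<omega> x. dnoidal L \<omega> (x - loop_shift N Z L \<omega>)" 2] smooth_loop_profile by simp
  moreover have "(\<lambda>x. complex_of_real (tail N Z L \<omega> x)) \<in> sobolev 2 {L<..}"
    by (rule dominated_class_sobolev[OF open_freq_set J1 dominated_class_tail tail_in_sech_span w])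
  ultimately have sob: "?U \<in> graph_sobolev 2 N L"
    by (auto simp: graph_sobolev_def edge_def Theta_0_eq Theta_eq)
  define d0 where "d0 x = - \<omega> * pend_param L \<omega> * sin (pend_angle (sqrt (2 * \<omega>) * (x - ?a)) (pend_param L \<omega>)) / sqrt 2" for x
  define d1 where "d1 x = - sqrt \<omega> * tanh (sqrt \<omega> * (x - L) + artanh (- real N / (Z * sqrt \<omega>))) * tail N Z L \<omega> x" for x
  note D0 = loop_deriv[OF w, of ?a, folded d0_def[abs_def]] and D1 = tail_deriv[OF w, folded d1_def[abs_def]]
  have c0: "continuous_on UNIV d0" and c1: "continuous_on UNIV d1"
    using D0(2) D1(2) by (auto intro!: continuous_at_imp_continuous_on DERIV_isCont simp: d0_def[abs_def] d1_def[abs_def])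
  have cl0: "L \<in> closure {-L<..<L}" "-L \<in> closure {-L<..<L}" using L by auto
  have cl1: "L \<in> closure {L<..}" by simp
  have t0: "trace_at (edge L 0) (?U 0) x = of_real (dnoidal L \<omega> (x - ?a))"
     "trace_deriv_at (edge L 0) (?U 0) x = of_real (d0 x)" if "x \<in> closure {-L<..<L}" for x
    using traces_of_real[OF J0 that, of "\<lambda>x. dnoidal L \<omega> (x - ?a)" d0] D0(1) c0
    by (simp_all add: edge_def Theta_0_eq d0_def)
  have t1: "trace_at (edge L j) (?U j) L = of_real (tail N Z L \<omega> L)"
     "trace_deriv_at (edge L j) (?U j) L = of_real (d1 L)" if "j \<noteq> 0" for j
    using traces_of_real[OF J1 cl1, of "tail N Z L \<omega>" d1] D1(1) c1 that
    by (simp_all add: edge_def Theta_eq d1_def)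
  define c where "c = - real N / Z"
  have c2: "c\<^sup>2 = (real N)\<^sup>2 / Z\<^sup>2" by (simp add: c_def power_divide)
  note W = freq_setD[OF w] and q = pend_param[OF L freq_setD(1)[OF w]]
  have tv: "tail N Z L \<omega> L = sqrt 2 * sqrt (\<omega> - c\<^sup>2)"
    unfolding c_def by (rule tail_at_vertex(2)[OF Z W(2)])
  have d1L: "d1 L = - c * tail N Z L \<omega> L"
    using tail_at_vertex(1)[OF Z W(2)] W by (simp add: d1_def c_def)
  \<comment> \<open>The factor \<omega> q cancels against the denominator of
    \<open>vertex_sine\<close>, and 2 / sqrt 2 = sqrt 2 turns the rest into the tail value.\<close>
  have d0L: "d0 L = - c * tail N Z L \<omega> L"
  proof -
    have "d0 L = - (\<omega> * pend_param L \<omega>) * (2 * c * sqrt (\<omega> - c\<^sup>2) / (\<omega> * pend_param L \<omega>)) / sqrt 2"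
      unfolding d0_def dnoidal_at_vertex(3)[OF w] vertex_sine_def c_def[symmetric] c2[symmetric] by simp
    also have "\<dots> = - c * sqrt (\<omega> - c\<^sup>2) * (2 / sqrt 2)" using W q by simp
    also have "\<dots> = - c * tail N Z L \<omega> L" unfolding tv by (simp add: real_div_sqrt)
    finally show ?thesis .
  qed
  have "d0 L = d0 (- L)" unfolding d0_def dnoidal_at_vertex(2)[OF w] ..
  moreover have "dnoidal L \<omega> (L - ?a) = dnoidal L \<omega> (- L - ?a)" using dnoidal_at_vertex(1)[OF w] by simp
  \<comment> \<open>All N tails are equal, so the sum in the vertex condition is N times one value,
    and Z (- c) = N closes it.\<close>
  moreover have "of_nat N * complex_of_real (tail N Z L \<omega> L) = of_real Z * of_real (d1 L)"
  proof -
    have "real N * tail N Z L \<omega> L = Z * d1 L" unfolding d1L c_def using Z by simp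
    then show ?thesis by (metis of_real_mult of_real_of_nat_eq)
  qed
  ultimately show ?thesis
    unfolding D'_dom_def using sob N
    by (simp add: t0[OF cl0(1)] t0[OF cl0(2)] t1 d0L d1L)
qed

end

theorem theorem5p3:
  fixes L Z :: real and N :: nat
  assumes "L > 0" and "Z < 0" and "N \<ge> 1"
  shows "\<exists>a :: real \<Rightarrow> real.
    (\<forall>\<omega> \<in> freq_set N Z L. 0 < a \<omega> \<and> a \<omega> < L \<and>
        Theta N Z L (a \<omega>) \<omega> \<in> D'_dom N Z L \<and>
        standing_wave N L \<omega> (Theta N Z L (a \<omega>) \<omega>)) \<and>
    H1_smooth_on N L (freq_set N Z L) (\<lambda>\<omega>. Theta N Z L (a \<omega>) \<omega>)"
proof (intro exI[of _ "loop_shift N Z L"] conjI ballI)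
  note loop_shift_bounds[OF assms] Theta_in_D'_dom[OF assms] standing_wave_Theta[OF assms]
  then show "0 < loop_shift N Z L \<omega>" "loop_shift N Z L \<omega> < L"
    "Theta N Z L (loop_shift N Z L \<omega>) \<omega> \<in> D'_dom N Z L"
    "standing_wave N L \<omega> (Theta N Z L (loop_shift N Z L \<omega>) \<omega>)" if "\<omega> \<in> freq_set N Z L" for \<omega>
    using that by blast+
  show "H1_smooth_on N L (freq_set N Z L) (\<lambda>\<omega>. Theta N Z L (loop_shift N Z L \<omega>) \<omega>)"
  proof (rule H1_smooth_onI[OF open_freq_set[OF assms] assms(1)])
    show "dominated_class (freq_set N Z L) {-L<..<L} {f. smooth_on (freq_set N Z L \<times> UNIV) (\<lambda>p. f (fst p) (snd p))}"
      by (rule dominated_class_smooth[OF open_freq_set[OF assms]])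
    show "(\<lambda>\<omega> x. dnoidal L \<omega> (x - loop_shift N Z L \<omega>)) \<in> {f. smooth_on (freq_set N Z L \<times> UNIV) (\<lambda>p. f (fst p) (snd p))}"
      using smooth_loop_profile[OF assms] by simp
    show "Theta N Z L (loop_shift N Z L \<omega>) \<omega> e x =
        of_real (if e = 0 then dnoidal L \<omega> (x - loop_shift N Z L \<omega>) else tail N Z L \<omega> x)" for \<omega> e x
      by (simp add: Theta_def)
  qed (rule dominated_class_tail[OF assms] tail_in_sech_span[OF assms])+
qed

end
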